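(* Suppose that the skew product $F:\Sigma\to\Sigma$, $F(\underline x,y)=(\sigma(\underline x),G(\underline x,y))$, satisfies (G1) and (G2), and let $\mu_0$ be the unique $F$-invariant probability measure in $S^\infty$. For a Lipschitz function $\varphi\in\mathrm H(\Sigma)$ let $\phi=\varphi-\int\varphi\,d\mu_0$ and $$\sigma_\varphi^2:=\int_\Sigma\phi^2\,d\mu_0+2\sum_{j=1}^\infty\int_\Sigma\phi\cdot(\phi\circ F^j)\,d\mu_0 .$$ Then $\sigma_\varphi^2<\infty$, and $\sigma_\varphi^2=0$ if and only if $\phi=u\circ F-u$ for some $u\in L^2(\mu_0)$. Moreover, if $\sigma_\varphi^2>0$, then for every interval $I\subset\mathbb R$ $$\lim_{n\to\infty}\mu_0\left(z\in\Sigma:\frac1{\sqrt n}\sum_{j=0}^{n-1}\Big(\varphi(F^j(z))-\int\varphi\,d\mu_0\Big)\in I\right)=\frac1{\sigma_\varphi\sqrt{2\pi}}\int_I e^{-\frac{t^2}{2\sigma_\varphi^2}}\,dt .$$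
   Context: $A$ is an aperiodic $N\times N$ matrix with entries in $\{0,1\}$, $\Sigma_A^+=\{\underline x=(x_i)_{i\ge 0}: x_i\in\{1,\dots,N\},\ A_{x_i,x_{i+1}}=1\ \forall i\ge 0\}$, $\theta\in(0,1)$ is fixed, $d_\theta(\underline x,\underline y)=\sum_{i\ge0}\theta^i(1-\delta_{x_i,y_i})$ (Kronecker delta), $\sigma$ is the left shift and $m$ is a fixed $\sigma$-invariant Markov measure on $\Sigma_A^+$. $\mathcal F_\theta(\Sigma_A^+)$ is the space of $d_\theta$-Lipschitz real functions. $(K,d)$ is a compact metric space with $\operatorname{diam}K=1$, $\Sigma=\Sigma_A^+\times K$ (product metric $d_\theta+d$). $\mathrm H(\Sigma)$ is the space of real Lipschitz functions on $\Sigma$. $G:\Sigma\to K$ is measurable. (G1) There is $0<\alpha<1$ such that for $m$-a.e. $\underline x$: $d(G(\underline x,y_1),G(\underline x,y_2))\le\alpha\, d(y_1,y_2)$ for all $y_1,y_2\in K$. (G2) For each $y\in K$ there is $k_y\ge0$ with $d(G(\underline x^1,y),G(\underline x^2,y))\le k_y d_\theta(\underline x^1,\underline x^2)$ for all $\underline x^1,\underline x^2$, and $\sup_{y}k_y<\infty$. $\mathcal{AB}_m$ is the set of finite signed Borel measures $\mu$ on $\Sigma$ with $\pi_1^*\mu^\pm\ll m$ (push-forwards of the Jordan parts under $\pi_1:\Sigma\to\Sigma_A^+$). For positive $\mu\in\mathcal{AB}_m$ with Rokhlin disintegration $(\{\mu_\gamma\},\phi_1m)$ along the fibers $\gamma_{\underline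 x}=\{\underline x\}\times K$ ($\mu_\gamma$ probability measures, $\phi_1=d(\pi_1^*\mu)/dm$), $\mu|_{\gamma_{\underline x}}$ is the measure on $K$ obtained by pushing $\phi_1(\underline x)\mu_{\gamma_{\underline x}}$ forward under $(\underline x,y)\mapsto y$; for signed $\mu$, $\mu|_\gamma=\mu^+|_\gamma-\mu^-|_\gamma$. For a signed measure $\nu$ on $K$, $\|\nu\|_W=\sup\{|\int g\,d\nu|:\operatorname{Lip}(g)\le1,\|g\|_\infty\le1\}$. $\|\mu\|_\infty=\operatorname{ess\,sup}_{\underline x}\|\mu|_{\gamma_{\underline x}}\|_W$ (w.r.t. $m$), and $S^\infty=\{\mu\in\mathcal{AB}_m:\|\mu\|_\infty<\infty,\ d(\pi_1^*\mu)/dm\in\mathcal F_\theta(\Sigma_A^+)\}$. It is known that under (G1) there is a unique $F$-invariant probability measure $\mu_0\in S^\infty$. *)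

theory Defs
  imports "HOL-Probability.Probability"
begin

section \<open>Subshifts of finite type\<close>

text \<open>The symbols are the elements of a finite type \<open>'n\<close>, so that \<open>N = CARD('n)\<close>; the transition
  matrix is a square matrix over the naturals indexed by \<open>'n\<close>.\<close>

primrec mat_pow :: "nat^'n^'n \<Rightarrow> nat \<Rightarrow> nat^'n^'n" where
  "mat_pow A 0 = mat 1"
| "mat_pow A (Suc k) = A ** mat_pow A k"

definition aperiodic :: "nat^'n^'n \<Rightarrow> bool" where
  "aperiodic A \<longleftrightarrow> (\<exists>k\<ge>1. \<forall>i j. mat_pow A k $ i $ j > 0)"

definition SFT :: "nat^'n^'n \<Rightarrow> (nat \<Rightarrow> 'n) set" where
  "SFT A = {x. \<forall>i. A $ x i $ x (Suc i) = 1}"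

definition left_shift :: "(nat \<Rightarrow> 'n) \<Rightarrow> nat \<Rightarrow> 'n" where
  "left_shift x = (\<lambda>i. x (Suc i))"

definition d_theta :: "real \<Rightarrow> (nat \<Rightarrow> 'n) \<Rightarrow> (nat \<Rightarrow> 'n) \<Rightarrow> real" where
  "d_theta \<theta> x y = (\<Sum>i. \<theta> ^ i * (1 - of_bool (x i = y i)))"

definition sft_metric :: "real \<Rightarrow> nat^'n^'n \<Rightarrow> (nat \<Rightarrow> 'n) metric" where
  "sft_metric \<theta> A = metric (SFT A, d_theta \<theta>)"

text \<open>The compact space \<open>K\<close> is a type of class \<^class>\<open>metric_space\<close>.\<close>

definition skew_dist ::
  "real \<Rightarrow> (nat \<Rightarrow> 'n) \<times> 'k::metric_space \<Rightarrow> (nat \<Rightarrow> 'n) \<times> 'k \<Rightarrow> real" where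
  "skew_dist \<theta> z w = d_theta \<theta> (fst z) (fst w) + dist (snd z) (snd w)"

definition skew_metric :: "real \<Rightarrow> nat^'n^'n \<Rightarrow> ((nat \<Rightarrow> 'n) \<times> 'k::metric_space) metric" where
  "skew_metric \<theta> A = metric (SFT A \<times> UNIV, skew_dist \<theta>)"

definition skew_product ::
  "((nat \<Rightarrow> 'n) \<times> 'k \<Rightarrow> 'k) \<Rightarrow> (nat \<Rightarrow> 'n) \<times> 'k \<Rightarrow> (nat \<Rightarrow> 'n) \<times> 'k" where
  "skew_product G = (\<lambda>(x, y). (left_shift x, G (x, y)))"

text \<open>The expressions \<^term>\<open>metric (M, d)\<close> above are meaningful only because the functions
  are metrics, which requires \<open>0 < \<theta> < 1\<close>.\<close>

lemma d_theta_summable: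
  assumes "0 < \<theta>" "\<theta> < 1"
  shows "summable (\<lambda>i. \<theta> ^ i * (1 - of_bool (x i = y i)) :: real)"
proof (rule summable_comparison_test')
  show "summable (\<lambda>i. \<theta> ^ i)"
    using assms by (intro summable_geometric) auto
qed (use assms in auto)

lemma Metric_space_d_theta:
  assumes "0 < \<theta>" "\<theta> < 1"
  shows "Metric_space S (d_theta \<theta>)"
proof
  fix x y z :: "nat \<Rightarrow> 'a"
  note summ = d_theta_summable[OF assms]
  show "0 \<le> d_theta \<theta> x y"
    unfolding d_theta_def using assms by (intro suminf_nonneg summ) auto
  show "d_theta \<theta> x y = d_theta \<theta> y x"
    unfolding d_theta_def by (intro suminf_cong) auto
  show "d_theta \<theta> x y = 0 \<longleftrightarrow> x = y"
  proof
    assume "d_theta \<theta> x y = 0"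
    then have "\<forall>i. \<theta> ^ i * (1 - of_bool (x i = y i)) = 0"
      unfolding d_theta_def
      by (subst (asm) suminf_eq_zero_iff) (use assms summ[of x y] in auto)
    then show "x = y" using assms by (auto simp: fun_eq_iff split: if_splits)
  qed (simp add: d_theta_def)
  show "d_theta \<theta> x z \<le> d_theta \<theta> x y + d_theta \<theta> y z"
    unfolding d_theta_def
    by (subst suminf_add[OF summ summ], intro suminf_le summable_add summ)
       (use assms in \<open>auto simp: of_bool_def\<close>)
qed

lemma Metric_space_skew_dist:
  assumes "0 < \<theta>" "\<theta> < 1"
  shows "Metric_space S (skew_dist \<theta>)"
proof -
  interpret D: Metric_space UNIV "d_theta \<theta>" by (rule Metric_space_d_theta[OF assms])
  show ?thesis
  proof
    fix x y z :: "(nat \<Rightarrow> 'a) \<times> 'b"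
    show "0 \<le> skew_dist \<theta> x y" by (simp add: skew_dist_def)
    show "skew_dist \<theta> x y = skew_dist \<theta> y x" 
      by (simp add: skew_dist_def D.commute dist_commute)
    show "skew_dist \<theta> x y = 0 \<longleftrightarrow> x = y"
      using D.nonneg[of "fst x" "fst y"] D.zero[of "fst x" "fst y"] zero_le_dist[of "snd x" "snd y"]
      by (auto simp: skew_dist_def prod_eq_iff add_nonneg_eq_0_iff)
    show "skew_dist \<theta> x z \<le> skew_dist \<theta> x y + skew_dist \<theta> y z"
      using D.triangle[of "fst x" "fst y" "fst z"] dist_triangle[of "snd x" "snd z" "snd y"]
      by (simp add: skew_dist_def)
  qed
qed

lemma sft_metric_simps:
  assumes "0 < \<theta>" "\<theta> < 1"
  shows "mspace (sft_metric \<theta> A) = SFT A" "mdist (sft_metric \<theta> A) = d_theta \<theta>"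
  unfolding sft_metric_def
  by (rule Metric_space.mspace_metric Metric_space.mdist_metric, rule Metric_space_d_theta[OF assms])+

lemma skew_metric_simps:
  assumes "0 < \<theta>" "\<theta> < 1"
  shows "mspace (skew_metric \<theta> A) = SFT A \<times> UNIV" "mdist (skew_metric \<theta> A) = skew_dist \<theta>"
  unfolding skew_metric_def
  by (rule Metric_space.mspace_metric Metric_space.mdist_metric, rule Metric_space_skew_dist[OF assms])+


section \<open>Borel measures on metric spaces\<close>

definition borel_metric :: "'a metric \<Rightarrow> 'a measure" where
  "borel_metric X = sigma (mspace X) {U. openin (mtopology_of X) U}"

definition invariant_measure :: "('a \<Rightarrow> 'a) \<Rightarrow> 'a measure \<Rightarrow> bool" where
  "invariant_measure T M \<longleftrightarrow> T \<in> measurable M M \<and> distr M M T = M"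

text \<open>A Markov measure is given by a stochastic matrix compatible with \<open>A\<close> (positive exactly at the
  admissible transitions) and an initial probability vector.\<close>

definition Markov_measure :: "real \<Rightarrow> nat^'n^'n \<Rightarrow> (nat \<Rightarrow> 'n) measure \<Rightarrow> bool" where
  "Markov_measure \<theta> A m \<longleftrightarrow>
     sets m = sets (borel_metric (sft_metric \<theta> A)) \<and> prob_space m \<and>
     (\<exists>(P :: real^'n^'n) (p :: real^'n).
        (\<forall>i j. 0 \<le> P $ i $ j) \<and> (\<forall>i. (\<Sum>j\<in>UNIV. P $ i $ j) = 1) \<and>
        (\<forall>i j. 0 < P $ i $ j \<longleftrightarrow> A $ i $ j = 1) \<and>
        (\<forall>i. 0 \<le> p $ i) \<and> (\<Sum>i\<in>UNIV. p $ i) = 1 \<and>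
        (\<forall>n w. measure m {x \<in> SFT A. \<forall>i\<le>n. x i = w i}
                 = p $ w 0 * (\<Prod>i<n. P $ w i $ w (Suc i))))"


section \<open>Signed measures and their Jordan parts\<close>

text \<open>Finite signed measures on \<open>M\<close> are represented by real set functions; only their values on
  \<^term>\<open>sets M\<close> matter.\<close>

definition signed_measure :: "'a measure \<Rightarrow> ('a set \<Rightarrow> real) \<Rightarrow> bool" where
  "signed_measure M \<nu> \<longleftrightarrow> \<nu> {} = 0 \<and>
     (\<forall>E :: nat \<Rightarrow> 'a set. range E \<subseteq> sets M \<and> disjoint_family E \<longrightarrow> (\<lambda>i. \<nu> (E i)) sums \<nu> (\<Union>i. E i))"

text \<open>The positive part is \<open>\<nu>\<^sup>+(B) = sup {\<nu>(C) | C \<subseteq> B}\<close>.\<close>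

definition jordan_pos :: "'a measure \<Rightarrow> ('a set \<Rightarrow> real) \<Rightarrow> 'a measure" where
  "jordan_pos M \<nu> = measure_of (space M) (sets M) (\<lambda>B. SUP C\<in>{C \<in> sets M. C \<subseteq> B}. ennreal (\<nu> C))"

definition jordan_neg :: "'a measure \<Rightarrow> ('a set \<Rightarrow> real) \<Rightarrow> 'a measure" where
  "jordan_neg M \<nu> = jordan_pos M (\<lambda>B. - \<nu> B)"

lemma jordan_pos_measure:
  assumes "finite_measure N" "sets N = sets M"
  shows "jordan_pos M (measure N) = N"
proof -
  interpret finite_measure N by fact
  have *: "(SUP C\<in>{C \<in> sets M. C \<subseteq> B}. ennreal (measure N C)) = emeasure N B" if "B \<in> sets N" for B
    using that assms(2)
    by (intro antisym SUP_least SUP_upper2[of B])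
       (auto simp: emeasure_eq_measure intro!: ennreal_leI finite_measure_mono)
  have "jordan_pos M (measure N) = measure_of (space N) (sets N) (emeasure N)"
    unfolding jordan_pos_def assms(2)[symmetric] sets_eq_imp_space_eq[OF assms(2), symmetric]
  proof (rule measure_of_eq[OF sets.space_closed])
    fix B assume "B \<in> sigma_sets (space N) (sets N)"
    then have "B \<in> sets N" by (simp add: sets.sigma_sets_eq)
    from *[OF this] show "(SUP C\<in>{C \<in> sets N. C \<subseteq> B}. ennreal (measure N C)) = emeasure N B"
      by (simp add: assms(2))
  qed
  then show ?thesis by (simp add: measure_of_of_measure)
qed

lemma jordan_neg_measure:
  "jordan_neg M (measure N) = null_measure M"
proof -
  have "(SUP C\<in>{C \<in> sets M. C \<subseteq> B}. ennreal (- measure N C)) = 0" for B :: "'a set"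
    by (auto intro!: antisym SUP_least simp: ennreal_neg)
  then show ?thesis
    by (simp add: jordan_neg_def jordan_pos_def null_measure_def)
qed


section \<open>The space of signed measures with bounded Wasserstein-type norm along the fibers\<close>

definition AB :: "real \<Rightarrow> nat^'n^'n \<Rightarrow> (nat \<Rightarrow> 'n) measure
    \<Rightarrow> (((nat \<Rightarrow> 'n) \<times> 'k::metric_space) set \<Rightarrow> real) set" where
  "AB \<theta> A m = {\<mu>. let B = borel_metric (skew_metric \<theta> A) in
     signed_measure B \<mu> \<and>
     absolutely_continuous m (distr (jordan_pos B \<mu>) m fst) \<and>
     absolutely_continuous m (distr (jordan_neg B \<mu>) m fst)}"

text \<open>The density \<open>\<phi>\<^sub>1\<close> of the first marginal of a positive measure.\<close>

definition marginal_density ::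
  "(nat \<Rightarrow> 'n) measure \<Rightarrow> ((nat \<Rightarrow> 'n) \<times> 'k) measure \<Rightarrow> (nat \<Rightarrow> 'n) \<Rightarrow> ennreal" where
  "marginal_density m \<mu> = RN_deriv m (distr \<mu> m fst)"

text \<open>Rokhlin disintegration of a positive measure along the fibers \<open>{x} \<times> K\<close>; it is unique up to
  a null set of \<open>\<phi>\<^sub>1 m\<close>, so that the choice made below is immaterial.\<close>

definition disintegration ::
  "(nat \<Rightarrow> 'n) measure \<Rightarrow> ((nat \<Rightarrow> 'n) \<times> 'k) measure \<Rightarrow>
     ((nat \<Rightarrow> 'n) \<Rightarrow> ((nat \<Rightarrow> 'n) \<times> 'k) measure) \<Rightarrow> bool" where
  "disintegration m \<mu> \<kappa> \<longleftrightarrow>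
     \<kappa> \<in> measurable m (prob_algebra \<mu>) \<and>
     (\<forall>x\<in>space m. emeasure (\<kappa> x) ({x} \<times> UNIV) = 1) \<and>
     (\<forall>E\<in>sets \<mu>. emeasure \<mu> E = (\<integral>\<^sup>+x. marginal_density m \<mu> x * emeasure (\<kappa> x) E \<partial>m))"

definition fiber_restriction ::
  "(nat \<Rightarrow> 'n) measure \<Rightarrow> ((nat \<Rightarrow> 'n) \<times> 'k::metric_space) measure \<Rightarrow> (nat \<Rightarrow> 'n) \<Rightarrow> 'k measure" where
  "fiber_restriction m \<mu> x =
     distr (scale_measure (marginal_density m \<mu> x) ((SOME \<kappa>. disintegration m \<mu> \<kappa>) x)) borel snd"

text \<open>The norm \<open>\<parallel>\<nu>\<^sub>1 - \<nu>\<^sub>2\<parallel>\<^sub>W\<close> of a difference of two positive measures\<close>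

definition W_norm_diff :: "'k::metric_space measure \<Rightarrow> 'k measure \<Rightarrow> ennreal" where
  "W_norm_diff \<nu>1 \<nu>2 =
     (SUP g\<in>{g :: 'k \<Rightarrow> real. 1-lipschitz_on UNIV g \<and> (\<forall>y. \<bar>g y\<bar> \<le> 1)}.
        ennreal \<bar>(\<integral>y. g y \<partial>\<nu>1) - (\<integral>y. g y \<partial>\<nu>2)\<bar>)"

definition norm_inf :: "real \<Rightarrow> nat^'n^'n \<Rightarrow> (nat \<Rightarrow> 'n) measure
    \<Rightarrow> (((nat \<Rightarrow> 'n) \<times> 'k::metric_space) set \<Rightarrow> real) \<Rightarrow> ennreal" where
  "norm_inf \<theta> A m \<mu> = (let B = borel_metric (skew_metric \<theta> A) in
     esssup m (\<lambda>x. W_norm_diff (fiber_restriction m (jordan_pos B \<mu>) x)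
                               (fiber_restriction m (jordan_neg B \<mu>) x)))"

definition S_inf :: "real \<Rightarrow> nat^'n^'n \<Rightarrow> (nat \<Rightarrow> 'n) measure
    \<Rightarrow> (((nat \<Rightarrow> 'n) \<times> 'k::metric_space) set \<Rightarrow> real) set" where
  "S_inf \<theta> A m = {\<mu> \<in> AB \<theta> A m. norm_inf \<theta> A m \<mu> < \<infinity> \<and>
     (let B = borel_metric (skew_metric \<theta> A) in
      \<exists>f. Lipschitz_continuous_map (sft_metric \<theta> A) euclidean_metric f \<and>
          (AE x in m. enn2real (marginal_density m (jordan_pos B \<mu>) x)
                      - enn2real (marginal_density m (jordan_neg B \<mu>) x) = f x))}"


section \<open>The conditions on the fiber maps and the limit variance\<close>

definition G1 :: "(nat \<Rightarrow> 'n) measure \<Rightarrow> ((nat \<Rightarrow> 'n) \<times> 'k::metric_space \<Rightarrow> 'k) \<Rightarrow> bool" where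
  "G1 m G \<longleftrightarrow> (\<exists>\<alpha>. 0 < \<alpha> \<and> \<alpha> < 1 \<and>
     (AE x in m. \<forall>y1 y2. dist (G (x, y1)) (G (x, y2)) \<le> \<alpha> * dist y1 y2))"

definition G2 ::
  "real \<Rightarrow> nat^'n^'n \<Rightarrow> ((nat \<Rightarrow> 'n) \<times> 'k::metric_space \<Rightarrow> 'k) \<Rightarrow> bool" where
  "G2 \<theta> A G \<longleftrightarrow> (\<exists>k :: 'k \<Rightarrow> real.
     (\<forall>y. 0 \<le> k y \<and>
        (\<forall>x1\<in>SFT A. \<forall>x2\<in>SFT A. dist (G (x1, y)) (G (x2, y)) \<le> k y * d_theta \<theta> x1 x2)) \<and>
     bdd_above (range k))"

definition centered :: "'a measure \<Rightarrow> ('a \<Rightarrow> real) \<Rightarrow> 'a \<Rightarrow> real" where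
  "centered \<mu> \<phi> z = \<phi> z - (\<integral>w. \<phi> w \<partial>\<mu>)"

definition limit_variance :: "'a measure \<Rightarrow> ('a \<Rightarrow> 'a) \<Rightarrow> ('a \<Rightarrow> real) \<Rightarrow> real" where
  "limit_variance \<mu> F \<phi> =
     (\<integral>z. (centered \<mu> \<phi> z)\<^sup>2 \<partial>\<mu>)
       + 2 * (\<Sum>j. \<integral>z. centered \<mu> \<phi> z * centered \<mu> \<phi> ((F ^^ Suc j) z) \<partial>\<mu>)"

text \<open>The integrals and the series default to \<open>0\<close> or an arbitrary value where they do not exist;
  finiteness of the variance means that this does not occur.\<close>

definition limit_variance_finite :: "'a measure \<Rightarrow> ('a \<Rightarrow> 'a) \<Rightarrow> ('a \<Rightarrow> real) \<Rightarrow> bool" where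
  "limit_variance_finite \<mu> F \<phi> \<longleftrightarrow>
     integrable \<mu> \<phi> \<and>
     integrable \<mu> (\<lambda>z. (centered \<mu> \<phi> z)\<^sup>2) \<and>
     (\<forall>j. integrable \<mu> (\<lambda>z. centered \<mu> \<phi> z * centered \<mu> \<phi> ((F ^^ Suc j) z))) \<and>
     summable (\<lambda>j. \<integral>z. centered \<mu> \<phi> z * centered \<mu> \<phi> ((F ^^ Suc j) z) \<partial>\<mu>)"

definition L2_coboundary :: "'a measure \<Rightarrow> ('a \<Rightarrow> 'a) \<Rightarrow> ('a \<Rightarrow> real) \<Rightarrow> bool" where
  "L2_coboundary \<mu> F f \<longleftrightarrow>
     (\<exists>u \<in> borel_measurable \<mu>. integrable \<mu> (\<lambda>z. (u z)\<^sup>2) \<and> (AE z in \<mu>. f z = u (F z) - u z))"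

end

theory Submission
  imports Defs "HOL-Real_Asymp.Real_Asymp"
begin

text \<open>The contraction in the fibers and the Lipschitz dependence on the base make \<open>\<phi> \<circ> F\<^sup>r\<close> exponentially
  close, almost everywhere, to a function of the coordinates \<open>x\<^sub>0, \<dots>, x\<^sub>2\<^sub>r\<close>. Under \<open>\<mu>\<^sub>0\<close> these coordinates
  form the Markov chain given by \<open>m\<close>, which mixes exponentially fast because a power of its transition
  matrix is positive (Doeblin). Hence the covariances decay exponentially, which gives the finiteness of
  the variance and, through explicit second moments of Birkhoff sums, the coboundary criterion.

  The central limit theorem is proved without martingales: if \<open>f\<close> is the characteristic function of a
  normalised sum \<open>Z\<close> of block functions, then removing a neighbourhood of each summand and decoupling
  shows \<open>f'(t) = - t E(Z\<^sup>2) f(t) + o(1)\<close>, so \<open>f\<close> is close to a Gaussian; Levy's theorem concludes.\<close>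

section \<open>Functions of finitely many coordinates and mixing of Markov chains\<close>

text \<open>The obstacle is the fiber coordinate: no finite set of base coordinates determines it,
  and the contraction holds only almost everywhere. Iterating r times forgets the starting point in
  the fiber up to \<alpha>^r, so it is \<phi> \<circ> F^r and not \<phi> that is approximated;
  invariance of \<mu>0 lets the one replace the other inside integrals. The window of coordinates 0,
  ..., 2r is that long because after each of the r shifts at least r further coordinates must still
  be known, to keep the error fed in from the base of order \<theta>^r.

  In the limit theorem r grows with n, and so does the number of coordinates seen by each summand.
  Hence every mixing estimate depends on sup norms and on the gap between index sets, never on the
  sizes of those sets. The derivative of the characteristic function brings down one centred factor
  at a time, and comparing it with the exact E(Z^2) of the block sum avoids any separate computation
  of a variance for blocks.\<close>

definition depends_on :: "'a set \<Rightarrow> (nat \<Rightarrow> 'a \<Rightarrow> 'n) \<Rightarrow> nat set \<Rightarrow> ('a \<Rightarrow> 'b) \<Rightarrow> bool" where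
  "depends_on S X I U \<longleftrightarrow> (\<forall>z\<in>S. \<forall>z'\<in>S. (\<forall>i\<in>I. X i z = X i z') \<longrightarrow> U z = U z')"

lemma depends_onI:
  assumes "\<And>z z'. z \<in> S \<Longrightarrow> z' \<in> S \<Longrightarrow> (\<And>i. i \<in> I \<Longrightarrow> X i z = X i z') \<Longrightarrow> U z = U z'"
  shows "depends_on S X I U"
  unfolding depends_on_def by (intro ballI impI, rule assms) (assumption | erule (1) bspec)+

lemma depends_onD:
  assumes "depends_on S X I U" "z \<in> S" "z' \<in> S" "\<And>i. i \<in> I \<Longrightarrow> X i z = X i z'"
  shows "U z = U z'"
  by (rule assms(1)[unfolded depends_on_def, rule_format, OF assms(2,3)]) (rule assms(4))

lemma depends_on_mono:
  assumes "depends_on S X I U" "I \<subseteq> J"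
  shows "depends_on S X J U"
proof (rule depends_onI)
  fix z z' assume *: "z \<in> S" "z' \<in> S" "\<And>i. i \<in> J \<Longrightarrow> X i z = X i z'"
  show "U z = U z'"
    by (rule depends_onD[OF assms(1) *(1,2)], rule *(3), rule subsetD[OF assms(2)])
qed

lemma depends_on_const: "depends_on S X I (\<lambda>_. c)"
  by (rule depends_onI) (rule refl)

lemma depends_on_compose:
  assumes "depends_on S X I U"
  shows "depends_on S X I (\<lambda>z. g (U z))"
  by (rule depends_onI, rule arg_cong[of _ _ g], rule depends_onD[OF assms])

lemma depends_on_compose2:
  assumes "depends_on S X I U" "depends_on S X J V"
  shows "depends_on S X (I \<union> J) (\<lambda>z. g (U z) (V z))"
proof (rule depends_onI)
  fix z z' assume *: "z \<in> S" "z' \<in> S" "\<And>i. i \<in> I \<union> J \<Longrightarrow> X i z = X i z'"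
  have "U z = U z'" by (rule depends_onD[OF assms(1) *(1,2)], rule *(3), rule UnI1)
  moreover have "V z = V z'" by (rule depends_onD[OF assms(2) *(1,2)], rule *(3), rule UnI2)
  ultimately show "g (U z) (V z) = g (U z') (V z')" by (rule arg_cong2)
qed

lemma depends_on_sum:
  assumes "\<And>k. k \<in> K \<Longrightarrow> depends_on S X I (f k)"
  shows "depends_on S X I (\<lambda>z. \<Sum>k\<in>K. f k z)"
  by (rule depends_onI, rule sum.cong[OF refl], rule depends_onD[OF assms])

lemma depends_on_coord: "i \<in> I \<Longrightarrow> depends_on S X I (X i)"
  by (rule depends_onI)

primrec kernel_pow :: "('n::finite \<Rightarrow> 'n \<Rightarrow> real) \<Rightarrow> nat \<Rightarrow> 'n \<Rightarrow> 'n \<Rightarrow> real" where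
  "kernel_pow P 0 i j = of_bool (i = j)"
| "kernel_pow P (Suc k) i j = (\<Sum>l\<in>UNIV. P i l * kernel_pow P k l j)"

text \<open>The Markov operator of the chain. It acts on complex functions because the observables
  to be decoupled later are exponentials \<open>iexp\<close>.\<close>

definition transition_op :: "('n::finite \<Rightarrow> 'n \<Rightarrow> real) \<Rightarrow> ('n \<Rightarrow> complex) \<Rightarrow> 'n \<Rightarrow> complex" where
  "transition_op P f i = (\<Sum>j\<in>UNIV. of_real (P i j) * f j)"

text \<open>Turns a contraction by \<open>c\<close> in every \<open>k\<close> steps into a geometric
  rate per single step; the incomplete last period costs the factor \<open>1 / c\<close>. Used for
  the Doeblin period and, with \<open>k = 4\<close>, for covariances.\<close>

lemma power_div_le_geometric:
  fixes c :: real
  assumes "0 < c" "c < 1" "0 < k"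
  shows "c ^ (n div k) \<le> (1 / c) * root k c ^ n" "0 < root k c" "root k c < 1"
proof -
  show r: "0 < root k c" "root k c < 1" using assms by auto
  have "c ^ Suc (n div k) = root k c ^ (k * Suc (n div k))"
    unfolding power_mult using assms real_root_pow_pos[of k c] by presburger
  also have "\<dots> \<le> root k c ^ n"
  proof (rule power_decreasing)
    show "n \<le> k * Suc (n div k)" using dividend_less_times_div[of k n] assms by simp
  qed (use r in linarith)+
  finally show "c ^ (n div k) \<le> (1 / c) * root k c ^ n"
    using assms by (simp add: field_simps)
qed

text \<open>Integrability is not assumed: a function that is not integrable has integral 0 by
  convention, and then the bound is \<open>0 \<le> c\<close>.\<close>

lemma (in prob_space) norm_expectation_le:
  fixes f :: "'a \<Rightarrow> 'b::{banach, second_countable_topology}"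
  assumes "AE z in M. norm (f z) \<le> c" "0 \<le> c"
  shows "norm (\<integral>z. f z \<partial>M) \<le> c"
proof (cases "integrable M f")
  case True
  have "norm (\<integral>z. f z \<partial>M) \<le> (\<integral>z. norm (f z) \<partial>M)" by simp
  also have "\<dots> \<le> (\<integral>z. c \<partial>M)"
    by (rule integral_mono_AE) (use assms True in auto)
  finally show ?thesis by (simp add: prob_space)
qed (use assms in \<open>simp add: not_integrable_integral_eq\<close>)

lemma (in prob_space) expectation_diff_le:
  fixes f g :: "'a \<Rightarrow> 'b::{banach, second_countable_topology}"
  assumes "integrable M f" "integrable M g" "AE z in M. norm (f z - g z) \<le> c" "0 \<le> c"
  shows "norm ((\<integral>z. f z \<partial>M) - (\<integral>z. g z \<partial>M)) \<le> c"
  using norm_expectation_le[OF assms(3,4)] assms(1,2) by simp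

text \<open>The formula \<open>cylinder\<close> carries both the initial law and the Markov
  property, and \<open>primitive\<close> is the source of the Doeblin condition. The chain lives on
  an arbitrary probability space because the results are applied to \<open>m\<close> as well as to
  \<mu>0, where the coordinates do not determine the point.\<close>

locale finite_markov_chain = prob_space M for M :: "'a measure" +
  fixes X :: "nat \<Rightarrow> 'a \<Rightarrow> 'n::finite" and P :: "'n \<Rightarrow> 'n \<Rightarrow> real" and p :: "'n \<Rightarrow> real"
  assumes X_measurable [measurable]: "\<And>i. X i \<in> measurable M (count_space UNIV)"
    and P_nonneg: "\<And>i j. 0 \<le> P i j" and P_sum: "\<And>i. (\<Sum>j\<in>UNIV. P i j) = 1"
    and p_nonneg: "\<And>i. 0 \<le> p i" and p_sum: "(\<Sum>i\<in>UNIV. p i) = 1"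
    and stationary: "\<And>j. (\<Sum>i\<in>UNIV. p i * P i j) = p j"
    and primitive: "\<exists>k>0. \<forall>i j. kernel_pow P k i j > 0"
    and cylinder: "\<And>n w. prob {z \<in> space M. \<forall>i\<le>n. X i z = w i} = p (w 0) * (\<Prod>i<n. P (w i) (w (Suc i)))"
begin

abbreviation "depends \<equiv> depends_on (space M) X"

lemma cylinder_sets [measurable]: 
  "finite I \<Longrightarrow> {z \<in> space M. \<forall>i\<in>I. X i z = w i} \<in> sets M"
  by measurable

lemma integrable_cylinder: 
  "finite I \<Longrightarrow> integrable M (indicat_real {z \<in> space M. \<forall>i\<in>I. X i z = w i})"
  by (intro integrable_real_indicator) (auto simp: emeasure_finite less_top[symmetric])

text \<open>The words \<open>w\<close> on \<open>I\<close> cut the space into finitely many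
  cylinders on which \<open>U\<close> is constant; \<open>u w\<close> is its value at a chosen
  point, arbitrary if the cylinder is empty. These finite sums of indicators take the place of
  conditional expectations.\<close>

lemma depends_expand:
  fixes U :: "'a \<Rightarrow> 'b::real_normed_algebra_1"
  assumes "depends I U" "finite I"
  obtains u where "\<And>z. z \<in> space M \<Longrightarrow> 
    U z = (\<Sum>w\<in>(\<Pi>\<^sub>E i\<in>I. UNIV). indicator {z \<in> space M. \<forall>i\<in>I. X i z = w i} z *\<^sub>R u w)"
proof
  define u where "u w = U (SOME z. z \<in> space M \<and> (\<forall>i\<in>I. X i z = w i))" for w
  fix z assume z: "z \<in> space M"
  let ?w = "restrict (\<lambda>i. X i z) I"
  have "(\<Sum>w\<in>(\<Pi>\<^sub>E i\<in>I. UNIV). indicator {z \<in> space M. \<forall>i\<in>I. X i z = w i} z *\<^sub>R u w)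
      = (\<Sum>w\<in>(\<Pi>\<^sub>E i\<in>I. UNIV). if w = ?w then u ?w else 0)"
  proof (rule sum.cong[OF refl])
    fix w assume w: "w \<in> (\<Pi>\<^sub>E i\<in>I. (UNIV :: 'n set))"
    have "(\<forall>i\<in>I. X i z = w i) \<longleftrightarrow> w = ?w"
    proof
      assume "\<forall>i\<in>I. X i z = w i"
      then show "w = ?w" by (intro PiE_ext[OF w, of ?w]) auto
    qed auto
    then show "indicator {z \<in> space M. \<forall>i\<in>I. X i z = w i} z *\<^sub>R u w = (if w = ?w then u ?w else 0)"
      using z by (auto simp: indicator_def)
  qed
  also have "\<dots> = u ?w"
    using assms by (simp add: finite_PiE)
  also have "\<dots> = U z"
  proof -
    define y where "y = (SOME y. y \<in> space M \<and> (\<forall>i\<in>I. X i y = ?w i))"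
    have "y \<in> space M \<and> (\<forall>i\<in>I. X i y = ?w i)"
      unfolding y_def by (rule someI[of _ z]) (use z in auto)
    then have "U y = U z" by (intro depends_onD[OF assms(1)]) (use z in auto)
    then show ?thesis by (simp add: u_def y_def)
  qed
  finally show "U z = (\<Sum>w\<in>(\<Pi>\<^sub>E i\<in>I. UNIV). indicator {z \<in> space M. \<forall>i\<in>I. X i z = w i} z *\<^sub>R u w)" ..
qed

lemma depends_measurable:
  fixes U :: "'a \<Rightarrow> 'b::{real_normed_algebra_1, second_countable_topology}"
  assumes "depends I U" "finite I"
  shows "U \<in> borel_measurable M"
proof -
  obtain u where u: "\<And>z. z \<in> space M \<Longrightarrow> 
    U z = (\<Sum>w\<in>(\<Pi>\<^sub>E i\<in>I. UNIV). indicator {z \<in> space M. \<forall>i\<in>I. X i z = w i} z *\<^sub>R u w)"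
    using depends_expand[OF assms] by blast
  have "(\<lambda>z. \<Sum>w\<in>(\<Pi>\<^sub>E i\<in>I. UNIV). indicator {z \<in> space M. \<forall>i\<in>I. X i z = w i} z *\<^sub>R u w) \<in> borel_measurable M"
    using cylinder_sets[OF assms(2)]
    by (intro borel_measurable_sum borel_measurable_scaleR borel_measurable_indicator) auto
  then show ?thesis by (subst measurable_cong[OF u]) auto
qed

lemma depends_integrable:
  fixes U :: "'a \<Rightarrow> 'b::{real_normed_algebra_1, second_countable_topology, banach}"
  assumes "depends I U" "finite I"
  shows "integrable M U"
proof -
  obtain u where u: "\<And>z. z \<in> space M \<Longrightarrow> 
    U z = (\<Sum>w\<in>(\<Pi>\<^sub>E i\<in>I. UNIV). indicator {z \<in> space M. \<forall>i\<in>I. X i z = w i} z *\<^sub>R u w)"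
    using depends_expand[OF assms] by blast
  have "integrable M (\<lambda>z. \<Sum>w\<in>(\<Pi>\<^sub>E i\<in>I. UNIV). indicator {z \<in> space M. \<forall>i\<in>I. X i z = w i} z *\<^sub>R u w)"
    by (intro Bochner_Integration.integrable_sum integrable_scaleR_left integrable_cylinder assms)
  then show ?thesis by (subst Bochner_Integration.integrable_cong[OF refl u]) auto
qed

section \<open>The Markov property\<close>

lemma cylinder_step:
  "prob {z \<in> space M. (\<forall>i\<in>{..a}. X i z = w i) \<and> X (Suc a) z = j}
    = prob {z \<in> space M. \<forall>i\<in>{..a}. X i z = w i} * P (w a) j"
proof -
  let ?w = "w(Suc a := j)"
  have "{z \<in> space M. (\<forall>i\<in>{..a}. X i z = w i) \<and> X (Suc a) z = j} = {z \<in> space M. \<forall>i\<le>Suc a. X i z = ?w i}"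
    by (auto simp: le_Suc_eq)
  moreover have "{z \<in> space M. \<forall>i\<in>{..a}. X i z = w i} = {z \<in> space M. \<forall>i\<le>a. X i z = w i}"
    by auto
  moreover have "(\<Prod>i<a. P (?w i) (?w (Suc i))) = (\<Prod>i<a. P (w i) (w (Suc i)))"
    by (rule prod.cong) auto
  ultimately show ?thesis by (simp only: cylinder) simp
qed

text \<open>This is E(f(X_(a+1)) | X_0, ..., X_a) = (P f)(X_a), tested against functions of the
  past. Expanding \<open>U\<close> into cylinders reduces it to
  \<open>cylinder_step\<close>.\<close>

lemma markov_step:
  fixes U :: "'a \<Rightarrow> complex"
  assumes "depends {..a} U"
  shows "(\<integral>z. U z * f (X (Suc a) z) \<partial>M) = (\<integral>z. U z * transition_op P f (X a z) \<partial>M)"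
proof -
  obtain u where u: "\<And>z. z \<in> space M \<Longrightarrow> 
    U z = (\<Sum>w\<in>(\<Pi>\<^sub>E i\<in>{..a}. UNIV). indicator {z \<in> space M. \<forall>i\<in>{..a}. X i z = w i} z *\<^sub>R u w)"
    using depends_expand[OF assms] by blast
  let ?W = "\<Pi>\<^sub>E i\<in>{..a}. (UNIV :: 'n set)"
  let ?C = "\<lambda>w. {z \<in> space M. \<forall>i\<in>{..a}. X i z = w i}"
  let ?D = "\<lambda>w j. {z \<in> space M. (\<forall>i\<in>{..a}. X i z = w i) \<and> X (Suc a) z = j}"
  have C: "integrable M (indicat_real (?C w))" for w
    by (intro integrable_real_indicator) (auto simp: emeasure_finite less_top[symmetric])
  have D: "integrable M (indicat_real (?D w j))" for w j
    by (intro integrable_real_indicator) (auto simp: emeasure_finite less_top[symmetric])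
  have "(\<integral>z. U z * f (X (Suc a) z) \<partial>M)
      = (\<integral>z. (\<Sum>w\<in>?W. \<Sum>j\<in>UNIV. indicator (?D w j) z *\<^sub>R (u w * f j)) \<partial>M)"
  proof (rule Bochner_Integration.integral_cong[OF refl])
    fix z assume z: "z \<in> space M"
    have "(\<Sum>j\<in>UNIV. indicator (?D w j) z *\<^sub>R (u w * f j)) = indicator (?C w) z *\<^sub>R u w * f (X (Suc a) z)" for w
    proof -
      have "(\<Sum>j\<in>UNIV. indicator (?D w j) z *\<^sub>R (u w * f j))
        = (\<Sum>j\<in>UNIV. if j = X (Suc a) z then indicator (?C w) z *\<^sub>R (u w * f j) else 0)"
        by (rule sum.cong) (use z in \<open>auto simp: indicator_def\<close>)
      then show ?thesis by simp
    qed
    then show "U z * f (X (Suc a) z) = (\<Sum>w\<in>?W. \<Sum>j\<in>UNIV. indicator (?D w j) z *\<^sub>R (u w * f j))"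
      by (simp add: u[OF z] sum_distrib_right)
  qed
  also have "\<dots> = (\<Sum>w\<in>?W. \<Sum>j\<in>UNIV. prob (?D w j) *\<^sub>R (u w * f j))"
  proof -
    have "prob (?D w j) = (\<integral>z. indicator (?D w j) z \<partial>M)" for w j
      by simp
    moreover have "(\<integral>z. (\<Sum>w\<in>?W. \<Sum>j\<in>UNIV. indicator (?D w j) z *\<^sub>R (u w * f j)) \<partial>M)
       = (\<Sum>w\<in>?W. \<Sum>j\<in>UNIV. (\<integral>z. indicator (?D w j) z \<partial>M) *\<^sub>R (u w * f j))"
      using D by (simp only: Bochner_Integration.integral_sum Bochner_Integration.integrable_sum integrable_scaleR_left integral_scaleR_left)
    ultimately show ?thesis by presburger
  qed
  also have "\<dots> = (\<Sum>w\<in>?W. prob (?C w) *\<^sub>R (u w * transition_op P f (w a)))"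
    by (rule sum.cong[OF refl])
      (simp add: cylinder_step transition_op_def scaleR_conv_of_real sum_distrib_left sum_distrib_right mult_ac)
  also have "\<dots> = (\<Sum>w\<in>?W. (\<integral>z. indicator (?C w) z \<partial>M) *\<^sub>R (u w * transition_op P f (w a)))"
    by simp
  also have "\<dots> = (\<integral>z. (\<Sum>w\<in>?W. indicator (?C w) z *\<^sub>R (u w * transition_op P f (w a))) \<partial>M)"
    using C by (simp only: Bochner_Integration.integral_sum Bochner_Integration.integrable_sum integrable_scaleR_left integral_scaleR_left)
  also have "\<dots> = (\<integral>z. U z * transition_op P f (X a z) \<partial>M)"
  proof (rule Bochner_Integration.integral_cong[OF refl])
    fix z assume z: "z \<in> space M"
    show "(\<Sum>w\<in>?W. indicator (?C w) z *\<^sub>R (u w * transition_op P f (w a))) = U z * transition_op P f (X a z)"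
      unfolding u[OF z] sum_distrib_right
      by (rule sum.cong[OF refl]) (auto simp: indicator_def)
  qed
  finally show ?thesis .
qed

lemma markov_steps:
  fixes U :: "'a \<Rightarrow> complex"
  assumes "depends {..a} U"
  shows "(\<integral>z. U z * f (X (a + L) z) \<partial>M) = (\<integral>z. U z * (transition_op P ^^ L) f (X a z) \<partial>M)"
proof (induction L arbitrary: f)
  case (Suc L)
  have "depends {..a + L} U" using assms by (rule depends_on_mono) auto
  from markov_step[OF this, of f] Suc[of "transition_op P f"] show ?case
    by (simp add: funpow_swap1)
qed simp

section \<open>Doeblin contraction of the Markov operator\<close>

lemma transition_op_bound:
  assumes "\<And>j. cmod (f j) \<le> b" shows "cmod (transition_op P f i) \<le> b"
proof -
  have "cmod (transition_op P f i) \<le> (\<Sum>j\<in>UNIV. cmod (of_real (P i j) * f j))"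
    unfolding transition_op_def by (rule norm_sum)
  also have "\<dots> \<le> (\<Sum>j\<in>UNIV. P i j * b)"
    by (rule sum_mono) (auto simp: norm_mult P_nonneg intro!: mult_left_mono assms)
  finally show ?thesis by (simp add: sum_distrib_right[symmetric] P_sum)
qed

lemma transition_op_mean:
  "(\<Sum>i\<in>UNIV. of_real (p i) * transition_op P f i) = (\<Sum>i\<in>UNIV. of_real (p i) * f i)"
proof -
  have "(\<Sum>i\<in>UNIV. of_real (p i) * transition_op P f i)
      = (\<Sum>j\<in>UNIV. \<Sum>i\<in>UNIV. of_real (p i * P i j) * f j)"
    unfolding transition_op_def sum_distrib_left by (subst sum.swap) (simp add: mult_ac)
  also have "\<dots> = (\<Sum>j\<in>UNIV. of_real (p j) * f j)"
    by (simp add: sum_distrib_right[symmetric] of_real_sum[symmetric] stationary del: of_real_mult of_real_sum)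
  finally show ?thesis .
qed

lemma transition_op_funpow: 
  "(transition_op P ^^ k) f i = (\<Sum>j\<in>UNIV. of_real (kernel_pow P k i j) * f j)"
proof (induction k arbitrary: i)
  case 0
  have "(\<Sum>j\<in>UNIV. of_real (kernel_pow P 0 i j) * f j) = (\<Sum>j\<in>UNIV. if j = i then f j else 0)"
    by (rule sum.cong) auto
  then show ?case by simp
next
  case (Suc k)
  have "(transition_op P ^^ Suc k) f i = transition_op P ((transition_op P ^^ k) f) i" by simp
  also have "\<dots> = (\<Sum>l\<in>UNIV. \<Sum>j\<in>UNIV. of_real (P i l * kernel_pow P k l j) * f j)"
    by (simp add: transition_op_def Suc sum_distrib_left mult_ac)
  also have "\<dots> = (\<Sum>j\<in>UNIV. of_real (kernel_pow P (Suc k) i j) * f j)"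
    by (subst sum.swap) (simp add: sum_distrib_right)
  finally show ?case .
qed

lemma kernel_pow_sum: "(\<Sum>j\<in>UNIV. kernel_pow P k i j) = 1"
proof (induction k arbitrary: i)
  case 0 
  have "(\<Sum>j\<in>UNIV. kernel_pow P 0 i j) = (\<Sum>j\<in>UNIV. if j = i then 1 else 0)"
    by (rule sum.cong) auto
  then show ?case by simp
next
  case (Suc k)
  have "(\<Sum>j\<in>UNIV. kernel_pow P (Suc k) i j) = (\<Sum>l\<in>UNIV. \<Sum>j\<in>UNIV. P i l * kernel_pow P k l j)"
    by simp (rule sum.swap)
  also have "\<dots> = 1" by (simp add: sum_distrib_left[symmetric] Suc P_sum)
  finally show ?case .
qed

lemma p_le_1: "p j \<le> 1"
  using member_le_sum[of j UNIV p] p_nonneg p_sum by auto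

text \<open>Doeblin's argument: every entry of the k-step kernel is at least \<delta>, hence at
  least \<delta> p(j). A function of mean zero does not see the part \<delta> p(j), and what remains
  has row sums 1 - \<delta>, so k steps contract the sup norm of centred functions by that
  factor.\<close>

lemma transition_op_ergodic:
  "\<exists>C \<rho>. 0 \<le> C \<and> 0 < \<rho> \<and> \<rho> < 1 \<and> (\<forall>f b L i. (\<forall>j. cmod (f j) \<le> b) \<longrightarrow>
      cmod ((transition_op P ^^ L) f i - (\<Sum>j\<in>UNIV. of_real (p j) * f j)) \<le> C * \<rho> ^ L * b)"
proof -
  obtain k where k: "k > 0" "\<And>i j. kernel_pow P k i j > 0" using primitive by blast
  \<comment> \<open>The cap 1/2 keeps 1 - \<delta> positive, as the k-th root and the factor 1 / (1
    - \<delta>) require.\<close>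
  define \<delta> where "\<delta> = min (1/2) (Min ((\<lambda>(i, j). kernel_pow P k i j) ` UNIV))"
  have \<delta>0: "\<delta> > 0" unfolding \<delta>_def using k by (auto simp: Min_gr_iff)
  have \<delta>1: "\<delta> < 1" unfolding \<delta>_def by auto
  have \<delta>: "\<delta> \<le> kernel_pow P k i j" for i j
    unfolding \<delta>_def by (rule min.coboundedI2, rule Min_le) auto
  let ?mean = "\<lambda>f. \<Sum>j\<in>UNIV. of_real (p j) * f j :: complex"
  let ?T = "transition_op P"
  have contract: "cmod ((?T ^^ k) f i) \<le> (1 - \<delta>) * b" if f: "\<And>j. cmod (f j) \<le> b" "?mean f = 0" for f b i
  proof -
    have "(?T ^^ k) f i = (\<Sum>j\<in>UNIV. of_real (kernel_pow P k i j - \<delta> * p j) * f j)"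
      using f(2) by (simp add: transition_op_funpow left_diff_distrib sum_subtractf mult.assoc sum_distrib_left[symmetric])
    also have "cmod \<dots> \<le> (\<Sum>j\<in>UNIV. cmod (of_real (kernel_pow P k i j - \<delta> * p j) * f j))" by (rule norm_sum)
    also have "\<dots> \<le> (\<Sum>j\<in>UNIV. (kernel_pow P k i j - \<delta> * p j) * b)"
    proof (rule sum_mono)
      fix j
      have "\<delta> * p j \<le> kernel_pow P k i j"
        using mult_left_mono[OF p_le_1[of j], of \<delta>] \<delta>[of i j] \<delta>0 by linarith
      then show "cmod (of_real (kernel_pow P k i j - \<delta> * p j) * f j) \<le> (kernel_pow P k i j - \<delta> * p j) * b"
        unfolding norm_mult norm_of_real by (intro mult_mono f) auto
    qed
    also have "\<dots> = (1 - \<delta>) * b"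
      by (simp add: sum_distrib_right[symmetric] sum_subtractf kernel_pow_sum sum_distrib_left[symmetric] p_sum)
    finally show ?thesis .
  qed
  have mean: "?mean ((?T ^^ n) f) = ?mean f" for n f
    by (induction n) (simp_all add: transition_op_mean)
  \<comment> \<open>Only whole periods contract; for the remaining \<open>s\<close> steps it is
    enough that the operator does not increase the sup norm.\<close>
  have iter: "cmod ((?T ^^ (q * k + s)) f i) \<le> (1 - \<delta>) ^ q * b" 
    if f: "\<And>j. cmod (f j) \<le> b" "?mean f = 0" for f b i q s
  proof (induction q arbitrary: i)
    case 0 show ?case
    proof (induction s arbitrary: i)
      case (Suc s) then show ?case using transition_op_bound[of "(?T ^^ s) f" b i] by simp
    qed (simp add: f)
  next
    case (Suc q)
    have "(?T ^^ (Suc q * k + s)) f = (?T ^^ k) ((?T ^^ (q * k + s)) f)"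
      by (simp add: add.assoc funpow_add)
    then show ?case using contract[of "(?T ^^ (q * k + s)) f" "(1 - \<delta>) ^ q * b" i, OF Suc] f(2) by (simp add: mean mult.assoc)
  qed
  let ?\<rho> = "root k (1 - \<delta>)"
  have "cmod ((?T ^^ L) f i - ?mean f) \<le> (2 / (1 - \<delta>)) * ?\<rho> ^ L * b" if f: "\<forall>j. cmod (f j) \<le> b" for f b L i
  proof -
    have b: "0 \<le> b" using f norm_ge_zero order_trans by blast
    \<comment> \<open>Centring may double the bound, whence the 2 in the constant. Constants are
      fixed by the operator, so iterating \<open>g\<close> gives exactly the difference to be
      estimated.\<close>
    define g where "g j = f j - ?mean f" for j
    have mg: "?mean g = 0"
      by (simp add: g_def right_diff_distrib sum_subtractf sum_distrib_right[symmetric] of_real_sum[symmetric] p_sum del: of_real_sum)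
    have "cmod (?mean f) \<le> (\<Sum>j\<in>UNIV. p j * b)"
      by (rule order_trans[OF norm_sum sum_mono]) (use f in \<open>auto simp: norm_mult p_nonneg intro!: mult_left_mono\<close>)
    then have mf: "cmod (?mean f) \<le> b" by (simp add: sum_distrib_right[symmetric] p_sum)
    have g: "cmod (g j) \<le> 2 * b" for j
      using norm_triangle_ineq4[of "f j" "?mean f"] f[rule_format, of j] mf by (simp add: g_def)
    have "(?T ^^ L) g i = (?T ^^ L) f i - ?mean f"
    proof -
      have "(\<Sum>j\<in>UNIV. complex_of_real (kernel_pow P L i j) * ?mean f) = ?mean f"
        by (subst sum_distrib_right[symmetric], subst of_real_sum[symmetric], subst kernel_pow_sum) simp
      then show ?thesis
        by (simp add: transition_op_funpow g_def right_diff_distrib sum_subtractf)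
    qed
    then have "cmod ((?T ^^ L) f i - ?mean f) \<le> (1 - \<delta>) ^ (L div k) * (2 * b)"
      using iter[OF g mg, of "L div k" "L mod k" i] by (simp add: mult.commute)
    also have "\<dots> \<le> ((1 / (1 - \<delta>)) * ?\<rho> ^ L) * (2 * b)"
      using \<delta>0 \<delta>1 k b by (intro mult_right_mono power_div_le_geometric) auto
    finally show ?thesis by (simp add: mult_ac)
  qed
  moreover have "0 < ?\<rho>" "?\<rho> < 1" using power_div_le_geometric[of "1 - \<delta>" k] \<delta>0 \<delta>1 k by auto
  ultimately show ?thesis
    using \<delta>1 by (intro exI[of _ "2 / (1 - \<delta>)"] exI[of _ ?\<rho>]) auto
qed

text \<open>The Markov property for a whole stretch of the future: the conditional expectation of
  \<open>V\<close> given the coordinates up to \<open>b\<close> is a function of X_b alone, with the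
  bound of \<open>V\<close>. A single \<open>f\<close> serves all \<open>U\<close>. Each induction
  step integrates out the last coordinate.\<close>

lemma future_reduce:
  fixes V :: "'a \<Rightarrow> complex"
  assumes "depends {b..b + d} V" "\<And>z. z \<in> space M \<Longrightarrow> cmod (V z) \<le> B" "0 \<le> B"
  shows "\<exists>f. (\<forall>i. cmod (f i) \<le> B) \<and> (\<forall>U. depends {..b} U \<longrightarrow> (\<integral>z. U z * V z \<partial>M) = (\<integral>z. U z * f (X b z) \<partial>M))"
  using assms
proof (induction d arbitrary: V)
  case 0
  \<comment> \<open>\<open>V\<close> is a function of X_b here, and \<open>f\<close> reads its value
    off at a chosen point in state \<open>i\<close>; states that are never visited get 0, which
    respects the bound.\<close>
  define f where "f i = (if \<exists>z\<in>space M. X b z = i then V (SOME z. z \<in> space M \<and> X b z = i) else 0)" for i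
  have f: "f (X b z) = V z" if z: "z \<in> space M" for z
  proof -
    define y where "y = (SOME y. y \<in> space M \<and> X b y = X b z)"
    have y: "y \<in> space M \<and> X b y = X b z"
      unfolding y_def by (rule someI[of _ z]) (use z in auto)
    then have "V y = V z" by (intro depends_onD[OF 0(1)]) (use z in auto)
    then show ?thesis using z by (auto simp: f_def y_def)
  qed
  have "cmod (f i) \<le> B" for i
  proof (cases "\<exists>z\<in>space M. X b z = i")
    case True
    then obtain z where "z \<in> space M" "X b z = i" by blast
    then show ?thesis using f[of z] 0(2) by auto
  next
    case False then show ?thesis using 0(3) by (auto simp: f_def)
  qed
  moreover have "(\<integral>z. U z * V z \<partial>M) = (\<integral>z. U z * f (X b z) \<partial>M)" for U
    by (rule Bochner_Integration.integral_cong) (auto simp: f)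
  ultimately show ?case by blast
next
  case (Suc d)
  text \<open>Condition on the coordinates up to \<open>b + d\<close>; \<open>V\<close> then becomes a function of the state \<open>j\<close> at time \<open>b + d + 1\<close>.\<close>
  define R where "R z j y \<longleftrightarrow> y \<in> space M \<and> (\<forall>i\<in>{b..b + d}. X i y = X i z) \<and> X (Suc (b + d)) y = j" for z j y
  define W where "W z j = (if \<exists>y. R z j y then V (SOME y. R z j y) else 0)" for z j
  have W_self: "W z (X (Suc (b + d)) z) = V z" if z: "z \<in> space M" for z
  proof -
    define y where "y = (SOME y. R z (X (Suc (b + d)) z) y)"
    have ex: "R z (X (Suc (b + d)) z) z" using z by (auto simp: R_def)
    have y: "R z (X (Suc (b + d)) z) y"
      unfolding y_def by (rule someI[of _ z]) (rule ex)
    then have "V y = V z" 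
      by (intro depends_onD[OF Suc.prems(1)]) (use z in \<open>auto simp: R_def le_Suc_eq\<close>)
    then show ?thesis using ex by (auto simp: W_def y_def)
  qed
  have W_bound: "cmod (W z j) \<le> B" for z j
  proof (cases "\<exists>y. R z j y")
    case True
    then have "R z j (SOME y. R z j y)" by (rule someI_ex)
    then have "(SOME y. R z j y) \<in> space M" unfolding R_def by blast
    then show ?thesis using Suc.prems(2) True by (simp add: W_def)
  qed (use Suc.prems in \<open>auto simp: W_def\<close>)
  have W_dep: "depends {b..b + d} (\<lambda>z. W z)"
    unfolding depends_on_def
  proof (intro ballI impI)
    fix z z' assume "z \<in> space M" "z' \<in> space M" and eq: "\<forall>i\<in>{b..b + d}. X i z = X i z'"
    then have "R z = R z'" by (auto simp: R_def fun_eq_iff)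
    then show "W z = W z'" unfolding W_def by (simp cong del: if_weak_cong)
  qed
  \<comment> \<open>The conditional expectation of \<open>V\<close> given the coordinates up to b +
    d, a function of one coordinate fewer.\<close>
  define V' where "V' z = transition_op P (W z) (X (b + d) z)" for z
  have "depends ({b..b + d} \<union> {b..b + d}) V'"
    unfolding V'_def by (intro depends_on_compose2[OF W_dep depends_on_coord]) auto
  then have V'_dep: "depends {b..b + d} V'" by simp
  have V'_bound: "cmod (V' z) \<le> B" for z
    unfolding V'_def by (rule transition_op_bound) (rule W_bound)
  from Suc.IH[OF V'_dep V'_bound] Suc.prems(3) obtain f where f: "\<forall>i. cmod (f i) \<le> B"
    "\<And>U. depends {..b} U \<Longrightarrow> (\<integral>z. U z * V' z \<partial>M) = (\<integral>z. U z * f (X b z) \<partial>M)" by blast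
  have "(\<integral>z. U z * V z \<partial>M) = (\<integral>z. U z * f (X b z) \<partial>M)" if U: "depends {..b} U" for U
  proof -
    let ?n = "b + d"
    have dj: "depends {..?n} (\<lambda>z. U z * W z j)" for j
    proof -
      have "depends ({..b} \<union> {b..?n}) (\<lambda>z. U z * W z j)"
        using depends_on_compose2[OF U depends_on_compose[OF W_dep, of "\<lambda>g. g j"], of "(*)"] by simp
      then show ?thesis by (rule depends_on_mono) auto
    qed
    have dj': "depends {..Suc ?n} (\<lambda>z. U z * W z j * of_bool (X (Suc ?n) z = j))" for j
      by (rule depends_on_mono[OF depends_on_compose2[OF dj[of j] depends_on_coord[of "Suc ?n" "{..Suc ?n}"], of "\<lambda>x y. x * of_bool (y = j)"]]) auto
    have dj'': "depends {..?n} (\<lambda>z. U z * W z j * of_real (P (X ?n z) j))" for j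
      by (rule depends_on_mono[OF depends_on_compose2[OF dj[of j] depends_on_coord[of "?n" "{..?n}"], of "\<lambda>x y. x * of_real (P y j)"]]) auto
    \<comment> \<open>\<open>W z j\<close> involves the past and the new state jointly. Splitting by
      the state at the last time yields products of a function of the past and a function of one
      coordinate, which is the form of \<open>markov_step\<close>.\<close>
    have "(\<integral>z. U z * V z \<partial>M) = (\<integral>z. (\<Sum>j\<in>UNIV. U z * W z j * of_bool (X (Suc ?n) z = j)) \<partial>M)"
    proof (rule Bochner_Integration.integral_cong[OF refl])
      fix z assume z: "z \<in> space M"
      have "(\<Sum>j\<in>UNIV. U z * W z j * of_bool (X (Suc ?n) z = j)) = (\<Sum>j\<in>UNIV. if j = X (Suc ?n) z then U z * W z j else 0)"
        by (rule sum.cong) auto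
      then show "U z * V z = (\<Sum>j\<in>UNIV. U z * W z j * of_bool (X (Suc ?n) z = j))"
        using W_self[OF z] by simp
    qed
    also have "\<dots> = (\<Sum>j\<in>UNIV. (\<integral>z. U z * W z j * of_bool (X (Suc ?n) z = j) \<partial>M))"
      by (rule Bochner_Integration.integral_sum, rule depends_integrable[OF dj']) simp
    also have "\<dots> = (\<Sum>j\<in>UNIV. (\<integral>z. U z * W z j * transition_op P (\<lambda>x. of_bool (x = j)) (X ?n z) \<partial>M))"
      by (rule sum.cong[OF refl]) (rule markov_step[OF dj])
    also have "\<dots> = (\<Sum>j\<in>UNIV. (\<integral>z. U z * W z j * of_real (P (X ?n z) j) \<partial>M))"
    proof -
      have "transition_op P (\<lambda>x. of_bool (x = j)) i = of_real (P i j)" for i j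
      proof -
        have "transition_op P (\<lambda>x. of_bool (x = j)) i = (\<Sum>l\<in>UNIV. if l = j then of_real (P i j) else 0)"
          unfolding transition_op_def by (rule sum.cong) auto
        then show ?thesis by simp
      qed
      then show ?thesis by simp
    qed
    also have "\<dots> = (\<integral>z. (\<Sum>j\<in>UNIV. U z * W z j * of_real (P (X ?n z) j)) \<partial>M)"
      by (rule Bochner_Integration.integral_sum[symmetric], rule depends_integrable[OF dj'']) simp
    also have "\<dots> = (\<integral>z. U z * V' z \<partial>M)"
      by (simp add: V'_def transition_op_def sum_distrib_left mult_ac)
    finally show ?thesis using f(2)[OF U] by simp
  qed
  then show ?case using f(1) by blast
qed

text \<open>A decoupling rate in terms of sup norms and the gap \<open>L\<close> only. It is uniform
  in the index sets, so it can be applied to whole Birkhoff sums and to blocks whose length grows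
  with n.\<close>

definition mixing_at :: "nat \<Rightarrow> real \<Rightarrow> bool" where
  "mixing_at L \<delta> \<longleftrightarrow> (\<forall>(U :: 'a \<Rightarrow> complex) (V :: 'a \<Rightarrow> complex) I J A B.
      depends I U \<longrightarrow> depends J V \<longrightarrow> finite I \<longrightarrow> finite J \<longrightarrow> (\<forall>i\<in>I. \<forall>j\<in>J. i + L \<le> j) \<longrightarrow>
      (\<forall>z\<in>space M. cmod (U z) \<le> A) \<longrightarrow> (\<forall>z\<in>space M. cmod (V z) \<le> B) \<longrightarrow>
      cmod ((\<integral>z. U z * V z \<partial>M) - (\<integral>z. U z \<partial>M) * (\<integral>z. V z \<partial>M)) \<le> \<delta> * A * B)"

lemma mixing_atD:
  assumes "mixing_at L \<delta>" "depends I U" "depends J V" "finite I" "finite J" "\<forall>i\<in>I. \<forall>j\<in>J. i + L \<le> j"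
    and "\<forall>z\<in>space M. cmod (U z) \<le> A" "\<forall>z\<in>space M. cmod (V z) \<le> B"
  shows "cmod ((\<integral>z. U z * V z \<partial>M) - (\<integral>z. U z \<partial>M) * (\<integral>z. V z \<partial>M)) \<le> \<delta> * A * B"
  by (rule assms(1)[unfolded mixing_at_def, rule_format, OF assms(2-5)])
    (erule (1) assms(6)[rule_format], erule assms(7)[rule_format], erule assms(8)[rule_format])

lemma mixing_at_nonneg:
  assumes "mixing_at L \<delta>" shows "0 \<le> \<delta>"
proof -
  have "0 \<le> \<delta> * 1 * 1"
    by (rule order_trans[OF norm_ge_zero mixing_atD[OF assms depends_on_const[of _ _ "{}" 1] depends_on_const[of _ _ "{}" 1]]]) simp_all
  then show ?thesis by simp
qed

lemma depends_mult:
  fixes U V :: "'a \<Rightarrow> 'b::times"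
  assumes "depends I U" "depends J V"
  shows "depends (I \<union> J) (\<lambda>z. U z * V z)"
  by (rule depends_on_compose2[OF assms, of "(*)"])

text \<open>With \<open>a\<close> the last index seen by \<open>U\<close>, the future
  \<open>V\<close> is first replaced by a function f(X_(a+L)) and then pulled back over the gap to
  (P^L f)(X_a). This is exponentially close to the constant which is the mean of
  \<open>V\<close>.\<close>

theorem exponential_mixing:
  "\<exists>C \<rho>. 0 \<le> C \<and> 0 < \<rho> \<and> \<rho> < 1 \<and> (\<forall>L. mixing_at L (C * \<rho> ^ L))"
proof -
  obtain C \<rho> where C: "0 \<le> C" "0 < \<rho>" "\<rho> < 1" and erg: "\<And>f b L i. (\<And>j. cmod (f j) \<le> b) \<Longrightarrow>
      cmod ((transition_op P ^^ L) f i - (\<Sum>j\<in>UNIV. of_real (p j) * f j)) \<le> C * \<rho> ^ L * b"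
    using transition_op_ergodic by blast
  have "cmod ((\<integral>z. U z * V z \<partial>M) - (\<integral>z. U z \<partial>M) * (\<integral>z. V z \<partial>M)) \<le> C * \<rho> ^ L * A * B"
    if dU: "depends I U" and dV: "depends J V" and fin: "finite I" "finite J"
      and gap: "\<And>i j. i \<in> I \<Longrightarrow> j \<in> J \<Longrightarrow> i + L \<le> j" 
      and A: "\<And>z. z \<in> space M \<Longrightarrow> cmod (U z) \<le> A" and B: "\<And>z. z \<in> space M \<Longrightarrow> cmod (V z) \<le> B"
    for U V I J L A B
  proof -
    obtain z0 where z0: "z0 \<in> space M" using not_empty by blast
    have AB: "0 \<le> A" "0 \<le> B" using A[OF z0] B[OF z0] norm_ge_zero order_trans by blast+
    \<comment> \<open>An empty index set has no maximum, but the function is then constant and the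
      covariance is 0.\<close>
    have trivial: "?thesis" if "J = {} \<or> I = {}"
    proof -
      have bnd: "0 \<le> C * \<rho> ^ L * A * B" using AB C by simp
      from that show ?thesis
      proof
        assume "J = {}"
        then have "z \<in> space M \<Longrightarrow> V z = V z0" for z using depends_onD[OF dV _ z0, of z] by auto
        then have "(\<integral>z. U z * V z \<partial>M) = (\<integral>z. U z * V z0 \<partial>M)" "(\<integral>z. V z \<partial>M) = (\<integral>z. V z0 \<partial>M)"
          by (simp_all cong: Bochner_Integration.integral_cong)
        then show ?thesis using bnd by (simp add: prob_space)
      next
        assume "I = {}"
        then have "z \<in> space M \<Longrightarrow> U z = U z0" for z using depends_onD[OF dU _ z0, of z] by auto
        then have "(\<integral>z. U z * V z \<partial>M) = (\<integral>z. U z0 * V z \<partial>M)" "(\<integral>z. U z \<partial>M) = (\<integral>z. U z0 \<partial>M)"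
          by (simp_all cong: Bochner_Integration.integral_cong)
        then show ?thesis using bnd by (simp add: prob_space)
      qed
    qed
    show ?thesis
    proof (cases "J = {} \<or> I = {}")
      case True then show ?thesis by (rule trivial)
    next
      case False
      define a where "a = Max I"
      define d where "d = Max J - (a + L)"
      have aI: "a \<in> I" using False fin by (simp add: a_def)
      have "I \<subseteq> {..a}" using fin by (auto simp: a_def)
      then have dU': "depends {..a} U" by (rule depends_on_mono[OF dU])
      have "J \<subseteq> {a + L..a + L + d}"
      proof
        fix j assume j: "j \<in> J"
        then show "j \<in> {a + L..a + L + d}"
          using gap[OF aI j] Max_ge[OF fin(2) j] by (simp add: d_def)
      qed
      then have dV': "depends {a + L..a + L + d} V" by (rule depends_on_mono[OF dV])
      obtain f where f: "\<And>i. cmod (f i) \<le> B" 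
        "\<And>U. depends {..a + L} U \<Longrightarrow> (\<integral>z. U z * V z \<partial>M) = (\<integral>z. U z * f (X (a + L) z) \<partial>M)"
        using future_reduce[OF dV' B AB(2)] by blast
      let ?g = "\<lambda>z. (transition_op P ^^ L) f (X a z)"
      let ?m = "\<Sum>j\<in>UNIV. of_real (p j) * f j"
      have dg: "depends {..a} ?g"
        using depends_on_compose[OF depends_on_coord[of a "{..a}" "space M" X], of "\<lambda>x. (transition_op P ^^ L) f x"] by simp
      have "depends {..a + L} U" by (rule depends_on_mono[OF dU']) auto
      from f(2)[OF this] markov_steps[OF dU', of f L] have UV: "(\<integral>z. U z * V z \<partial>M) = (\<integral>z. U z * ?g z \<partial>M)" by simp
      have const: "depends I (\<lambda>_. 1 :: complex)" for I by (rule depends_on_const)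
      have iU: "integrable M U" by (rule depends_integrable[OF dU fin(1)])
      have iUg: "integrable M (\<lambda>z. U z * ?g z)"
        by (rule depends_integrable[OF depends_on_compose2[OF dU' dg]]) simp
      \<comment> \<open>The mean of \<open>V\<close> is obtained by taking 1 for \<open>U\<close>,
        stepping back from time a + L to time 0, and using stationarity of \<open>p\<close>.\<close>
      have Vm: "(\<integral>z. V z \<partial>M) = ?m"
      proof -
        have st: "(\<integral>z. h (X 0 z) \<partial>M) = (\<Sum>i\<in>UNIV. of_real (p i) * h i)" for h :: "'n \<Rightarrow> complex"
        proof -
          have "(\<integral>z. h (X 0 z) \<partial>M) = (\<integral>z. (\<Sum>i\<in>UNIV. indicator {z \<in> space M. X 0 z = i} z *\<^sub>R h i) \<partial>M)"
          proof (rule Bochner_Integration.integral_cong[OF refl])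
            fix z assume "z \<in> space M"
            then have "(\<Sum>i\<in>UNIV. indicator {z \<in> space M. X 0 z = i} z *\<^sub>R h i) = (\<Sum>i\<in>UNIV. if i = X 0 z then h i else 0)"
              by (intro sum.cong) (auto simp: indicator_def)
            then show "h (X 0 z) = (\<Sum>i\<in>UNIV. indicator {z \<in> space M. X 0 z = i} z *\<^sub>R h i)" by simp
          qed
          also have "\<dots> = (\<Sum>i\<in>UNIV. prob {z \<in> space M. X 0 z = i} *\<^sub>R h i)"
            by (subst Bochner_Integration.integral_sum) 
              (auto intro!: integrable_scaleR_left integrable_real_indicator sum.cong simp: emeasure_finite less_top[symmetric])
          also have "\<dots> = (\<Sum>i\<in>UNIV. of_real (p i) * h i)"
            using cylinder[of 0 "\<lambda>_. _"] by (simp add: scaleR_conv_of_real)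
          finally show ?thesis .
        qed
        have "(\<integral>z. V z \<partial>M) = (\<integral>z. f (X (0 + (a + L)) z) \<partial>M)"
          using f(2)[OF const] by simp
        also have "\<dots> = (\<integral>z. (transition_op P ^^ (a + L)) f (X 0 z) \<partial>M)"
          using markov_steps[OF const[of "{..0}"], of f "a + L"] by simp
        also have "\<dots> = (\<Sum>i\<in>UNIV. of_real (p i) * (transition_op P ^^ (a + L)) f i)" by (rule st)
        also have "\<dots> = ?m"
        proof -
          have "(\<Sum>i\<in>UNIV. of_real (p i) * (transition_op P ^^ n) f i) = ?m" for n
            by (induction n) (simp_all add: transition_op_mean)
          then show ?thesis .
        qed
        finally show ?thesis .
      qed
      have "(\<integral>z. U z * V z \<partial>M) - (\<integral>z. U z \<partial>M) * (\<integral>z. V z \<partial>M) = (\<integral>z. U z * (?g z - ?m) \<partial>M)"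
        unfolding UV Vm using iUg iU by (simp add: right_diff_distrib)
      also have "cmod \<dots> \<le> A * (C * \<rho> ^ L * B)"
      proof (rule norm_expectation_le[OF AE_I2])
        show "cmod (U z * (?g z - ?m)) \<le> A * (C * \<rho> ^ L * B)" if "z \<in> space M" for z
          unfolding norm_mult by (intro mult_mono A that erg f AB) auto
      qed (use AB C in auto)
      finally show ?thesis by (simp add: mult_ac)
    qed
  qed
  note main = this
  have "mixing_at L (C * \<rho> ^ L)" for L
    unfolding mixing_at_def
  proof (intro allI impI)
    fix U V :: "'a \<Rightarrow> complex" and I J A B
    assume *: "depends I U" "depends J V" "finite I" "finite J" "\<forall>i\<in>I. \<forall>j\<in>J. i + L \<le> j"
      "\<forall>z\<in>space M. cmod (U z) \<le> A" "\<forall>z\<in>space M. cmod (V z) \<le> B"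
    show "cmod ((\<integral>z. U z * V z \<partial>M) - (\<integral>z. U z \<partial>M) * (\<integral>z. V z \<partial>M)) \<le> C * \<rho> ^ L * A * B"
      by (rule main[OF *(1-4)]) (erule (1) *(5)[rule_format], erule *(6)[rule_format], erule *(7)[rule_format])
  qed
  with C show ?thesis by (intro exI[where x = C] exI[where x = \<rho>] conjI allI)
qed

end

section \<open>A differential equation for characteristic functions\<close>

text \<open>Integrating factor: the function exp(s u^2 / 2) f(u) has derivative at most exp(s t^2 /
  2) \<epsilon> on the segment from 0 to t. Multiplying back by exp(- s t^2 / 2) cancels the growth,
  so only \<bar>t\<bar> \<epsilon> is left.\<close>

lemma gaussian_ode_bound:
  fixes f f' :: "real \<Rightarrow> complex"
  assumes deriv: "\<And>u. (f has_vector_derivative f' u) (at u)" and "f 0 = 1" "0 \<le> s"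
    and ode: "\<And>u. \<bar>u\<bar> \<le> \<bar>t\<bar> \<Longrightarrow> cmod (f' u + of_real (u * s) * f u) \<le> \<epsilon>"
  shows "cmod (f t - of_real (exp (- s * t\<^sup>2 / 2))) \<le> \<bar>t\<bar> * \<epsilon>"
proof -
  define g where "g u = of_real (exp (s * u\<^sup>2 / 2)) * f u" for u
  have \<epsilon>: "0 \<le> \<epsilon>" by (rule order_trans[OF norm_ge_zero ode[of 0]]) simp
  have g: "(g has_vector_derivative of_real (exp (s * u\<^sup>2 / 2)) * (f' u + of_real (u * s) * f u)) (at u)" for u
  proof -
    have "((\<lambda>u. complex_of_real (exp (s * u\<^sup>2 / 2))) has_vector_derivative of_real (exp (s * u\<^sup>2 / 2) * (s * u))) (at u)"
      by (rule has_vector_derivative_of_real) (auto intro!: derivative_eq_intros simp: has_real_derivative_iff_has_vector_derivative[symmetric])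
    from has_vector_derivative_mult[OF this deriv[of u]] show ?thesis
      unfolding g_def by (simp add: algebra_simps)
  qed
  have "cmod (g t - g 0) \<le> (exp (s * t\<^sup>2 / 2) * \<epsilon>) * norm (t - 0)"
  proof (rule differentiable_bound[of "closed_segment 0 t"])
    show "(g has_derivative (\<lambda>h. h *\<^sub>R (of_real (exp (s * u\<^sup>2 / 2)) * (f' u + of_real (u * s) * f u)))) (at u within closed_segment 0 t)" for u
      using g[of u] unfolding has_vector_derivative_def by (rule has_derivative_at_withinI)
    fix u assume "u \<in> closed_segment 0 t"
    then have u: "\<bar>u\<bar> \<le> \<bar>t\<bar>" by (auto simp: closed_segment_eq_real_ivl split: if_splits)
    then have "u\<^sup>2 \<le> t\<^sup>2" by (simp add: abs_le_square_iff)
    then have e: "exp (s * u\<^sup>2 / 2) \<le> exp (s * t\<^sup>2 / 2)"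
      using assms(3) by (simp add: mult_left_mono divide_right_mono)
    show "onorm (\<lambda>h. h *\<^sub>R (of_real (exp (s * u\<^sup>2 / 2)) * (f' u + of_real (u * s) * f u))) \<le> exp (s * t\<^sup>2 / 2) * \<epsilon>"
    proof (rule onorm_le)
      fix h :: real
      have "cmod (of_real (exp (s * u\<^sup>2 / 2)) * (f' u + of_real (u * s) * f u)) \<le> exp (s * t\<^sup>2 / 2) * \<epsilon>"
        unfolding norm_mult by (intro mult_mono ode u) (use e in auto)
      then show "norm (h *\<^sub>R (of_real (exp (s * u\<^sup>2 / 2)) * (f' u + of_real (u * s) * f u))) \<le> exp (s * t\<^sup>2 / 2) * \<epsilon> * norm h"
        unfolding norm_scaleR real_norm_def mult.commute[of "\<bar>h\<bar>"] by (rule mult_right_mono) simp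
    qed
  qed auto
  then have *: "cmod (g t - 1) \<le> (exp (s * t\<^sup>2 / 2) * \<epsilon>) * \<bar>t\<bar>"
    using assms(2) by (simp add: g_def)
  have "f t - of_real (exp (- s * t\<^sup>2 / 2)) = of_real (exp (- s * t\<^sup>2 / 2)) * (g t - 1)"
  proof -
    have "complex_of_real (exp (- s * t\<^sup>2 / 2)) * of_real (exp (s * t\<^sup>2 / 2)) = 1"
      unfolding of_real_mult[symmetric] exp_add[symmetric] by simp
    then show ?thesis
      unfolding g_def right_diff_distrib mult.assoc[symmetric] by simp
  qed
  then have "cmod (f t - of_real (exp (- s * t\<^sup>2 / 2))) = exp (- s * t\<^sup>2 / 2) * cmod (g t - 1)"
    by (simp only: norm_mult norm_of_real abs_exp_cancel)
  also have "\<dots> \<le> exp (- s * t\<^sup>2 / 2) * ((exp (s * t\<^sup>2 / 2) * \<epsilon>) * \<bar>t\<bar>)"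
    by (rule mult_left_mono[OF *]) simp
  also have "\<dots> = (exp (- s * t\<^sup>2 / 2) * exp (s * t\<^sup>2 / 2)) * (\<bar>t\<bar> * \<epsilon>)" by (simp only: mult_ac)
  also have "\<dots> = \<bar>t\<bar> * \<epsilon>" unfolding exp_add[symmetric] by simp
  finally show ?thesis .
qed

lemma cmod_iexp_diff_le: "cmod (iexp x - iexp y) \<le> \<bar>x - y\<bar>"
proof -
  have "iexp x - iexp y = iexp y * (iexp (x - y) - 1)"
    by (simp add: right_diff_distrib exp_add[symmetric])
  then show ?thesis
    using iexp_approx1[of "x - y" 0] by (simp add: norm_mult)
qed

lemma cmod_iexp_taylor: "cmod (iexp (x + y) - iexp x - \<i> * y * iexp x) \<le> y\<^sup>2 / 2"
proof -
  have "iexp (x + y) - iexp x - \<i> * y * iexp x = iexp x * (iexp y - (1 + \<i> * y))"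
    by (simp add: exp_add ring_distribs)
  then show ?thesis
    using iexp_approx1[of y 1] by (simp add: norm_mult power2_eq_square)
qed

text \<open>For bounded \<open>Z\<close> the pointwise Taylor remainder is at most (h B)^2 / 2,
  uniformly on the space, so the difference quotient converges without a dominated convergence
  argument.\<close>

lemma (in prob_space) char_has_derivative_bounded:
  assumes [measurable]: "Z \<in> borel_measurable M" and Z: "AE z in M. \<bar>Z z\<bar> \<le> B"
  shows "((\<lambda>t. \<integral>z. iexp (t * Z z) \<partial>M) has_vector_derivative (\<integral>z. \<i> * Z z * iexp (t * Z z) \<partial>M)) (at t)"
proof -
  have B: "0 \<le> B" 
    using Z by (auto dest!: eventually_happens' [rotated] simp: ae_filter_eq_bot_iff emeasure_space_1)
  let ?f = "\<lambda>t. \<integral>z. iexp (t * Z z) \<partial>M" and ?D = "\<integral>z. \<i> * Z z * iexp (t * Z z) \<partial>M"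
  have i1: "integrable M (\<lambda>z. iexp (t * Z z))" for t
    by (rule integrable_const_bound[of _ 1]) auto
  have i2: "integrable M (\<lambda>z. \<i> * Z z * iexp (t * Z z))" for t
    by (rule integrable_const_bound[of _ B]) (use Z in \<open>auto simp: norm_mult\<close>)
  have bound: "cmod (?f (t + h) - ?f t - h *\<^sub>R ?D) \<le> h\<^sup>2 * B\<^sup>2 / 2" for h
  proof -
    have "?f (t + h) - ?f t - h *\<^sub>R ?D = 
        (\<integral>z. iexp ((t + h) * Z z) - iexp (t * Z z) - h *\<^sub>R (\<i> * Z z * iexp (t * Z z)) \<partial>M)"
      using i1[of "t + h"] i1[of t] i2[of t] 
      by (simp only: integral_scaleR_right Bochner_Integration.integral_diff 
          Bochner_Integration.integrable_diff integrable_scaleR_right)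
    also have "cmod \<dots> \<le> h\<^sup>2 * B\<^sup>2 / 2"
    proof (rule norm_expectation_le)
      show "AE z in M. cmod (iexp ((t + h) * Z z) - iexp (t * Z z) - h *\<^sub>R (\<i> * Z z * iexp (t * Z z))) \<le> h\<^sup>2 * B\<^sup>2 / 2"
        using Z
      proof eventually_elim
        case (elim z)
        have *: "(h * Z z)\<^sup>2 \<le> h\<^sup>2 * B\<^sup>2"
          using elim B by (simp add: power_mult_distrib mult_left_mono abs_le_square_iff[symmetric])
        have eq: "iexp ((t + h) * Z z) - iexp (t * Z z) - h *\<^sub>R (\<i> * Z z * iexp (t * Z z))
            = iexp (t * Z z + h * Z z) - iexp (t * Z z) - \<i> * (h * Z z) * iexp (t * Z z)"
          by (simp add: algebra_simps scaleR_conv_of_real)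
        show ?case unfolding eq by (rule order_trans[OF cmod_iexp_taylor]) (use * in simp)
      qed
    qed simp
    finally show ?thesis .
  qed
  show ?thesis
    unfolding has_vector_derivative_def
  proof (rule has_derivativeI)
    show "bounded_linear (\<lambda>h. h *\<^sub>R ?D)" by (rule bounded_linear_scaleR_left)
    show "((\<lambda>y. ((?f y - ?f t) - (y - t) *\<^sub>R ?D) /\<^sub>R norm (y - t)) \<longlongrightarrow> 0) (at t)"
    proof (rule tendsto_0_le[where K = 1])
      show "((\<lambda>y. (y - t) * (B\<^sup>2 / 2)) \<longlongrightarrow> 0) (at t)"
        by (rule tendsto_mult_left_zero) (simp add: LIM_zero_iff)
      show "\<forall>\<^sub>F y in at t. norm (((?f y - ?f t) - (y - t) *\<^sub>R ?D) /\<^sub>R norm (y - t)) \<le> norm ((y - t) * (B\<^sup>2 / 2)) * 1"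
        using eventually_neq_at_within[of t]
      proof eventually_elim
        case (elim y)
        then show ?case
          using bound[of "y - t"] by (simp add: divide_simps power2_eq_square abs_mult mult_ac)
      qed
    qed
  qed
qed

section \<open>Decoupling in sums of block functions\<close>

context finite_markov_chain
begin

text \<open>Pulls the middle factor out while the outer two stay together. Three two-factor
  comparisons are chained, E(UVW) to E(UV) E(W) to E(U) E(V) E(W) and from there to E(V) E(UW), each
  at the price \<delta> A B C.\<close>

lemma mixing_triple:
  fixes U V W :: "'a \<Rightarrow> complex"
  assumes mix: "mixing_at r \<delta>"
    and dep: "depends I U" "depends J V" "depends K W" and fin: "finite I" "finite J" "finite K"
    and gap: "\<forall>i\<in>I. \<forall>j\<in>J. i + r \<le> j" "\<forall>j\<in>J. \<forall>k\<in>K. j + r \<le> k" "\<forall>i\<in>I. \<forall>k\<in>K. i + r \<le> k"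
    and bound: "\<And>z. z \<in> space M \<Longrightarrow> cmod (U z) \<le> A" "\<And>z. z \<in> space M \<Longrightarrow> cmod (V z) \<le> B"
      "\<And>z. z \<in> space M \<Longrightarrow> cmod (W z) \<le> C"
  shows "cmod ((\<integral>z. U z * V z * W z \<partial>M) - (\<integral>z. V z \<partial>M) * (\<integral>z. U z * W z \<partial>M)) \<le> 3 * \<delta> * A * B * C"
proof -
  let ?EU = "\<integral>z. U z \<partial>M" and ?EV = "\<integral>z. V z \<partial>M" and ?EW = "\<integral>z. W z \<partial>M"
  obtain z0 where z0: "z0 \<in> space M" using not_empty by blast
  have nn: "0 \<le> A" "0 \<le> B" "0 \<le> C" using bound[OF z0] norm_ge_zero order_trans by blast+
  have EV: "cmod ?EV \<le> B" and EW: "cmod ?EW \<le> C"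
    using bound nn by (auto intro!: norm_expectation_le)
  have UV: "\<forall>z\<in>space M. cmod (U z * V z) \<le> A * B"
    unfolding norm_mult by (intro ballI mult_mono bound nn) auto
  have 1: "cmod ((\<integral>z. U z * V z * W z \<partial>M) - (\<integral>z. U z * V z \<partial>M) * ?EW) \<le> \<delta> * (A * B) * C"
    by (rule mixing_atD[OF mix depends_on_compose2[OF dep(1,2), of "(*)"] dep(3)]) (use fin gap UV bound in auto)
  have UVb: "cmod ((\<integral>z. U z * V z \<partial>M) - ?EU * ?EV) \<le> \<delta> * A * B"
    by (rule mixing_atD[OF mix dep(1,2)]) (use fin gap bound in auto)
  have UWb: "cmod ((\<integral>z. U z * W z \<partial>M) - ?EU * ?EW) \<le> \<delta> * A * C"
    by (rule mixing_atD[OF mix dep(1,3)]) (use fin gap bound in auto)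
  have 2: "cmod ((\<integral>z. U z * V z \<partial>M) * ?EW - ?EU * ?EV * ?EW) \<le> (\<delta> * A * B) * C"
    unfolding left_diff_distrib[symmetric] norm_mult
    by (rule mult_mono[OF UVb EW order_trans[OF norm_ge_zero UVb]]) simp
  have 3: "cmod (?EV * (\<integral>z. U z * W z \<partial>M) - ?EV * (?EU * ?EW)) \<le> B * (\<delta> * A * C)"
    unfolding right_diff_distrib[symmetric] norm_mult
    by (rule mult_mono[OF EV UWb nn(2)]) simp
  have eq: "?EU * ?EV * ?EW = ?EV * (?EU * ?EW)" by simp
  have "cmod (x - w) \<le> cmod (x - y) + cmod (y - v) + cmod (w - v)" for x y v w :: complex
    using norm_triangle_ineq4[of "x - v" "w - v"] norm_triangle_ineq[of "x - y" "y - v"] by simp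
  from order_trans[OF this add_mono[OF add_mono[OF 1 2[unfolded eq]] 3]]
  show ?thesis by (simp add: mult_ac)
qed


text \<open>One summand's share of the differential equation for the characteristic function of
  \<open>Z\<close>. The number \<open>m\<close> bounds how many indices lie within 6 r of
  \<open>j\<close>. The error terms come, in this order, from decoupling \<open>Y j\<close> from
  distant summands, decoupling the near products, restoring the removed window in the exponential,
  adding the far covariances, and the Taylor remainder.\<close>

lemma char_derivative_term:
  fixes Y :: "nat \<Rightarrow> 'a \<Rightarrow> real" and a B \<delta> t :: real and n r j :: nat
  defines "Z \<equiv> \<lambda>z. a * (\<Sum>k<n. Y k z)" and "m \<equiv> real (12 * r + 1)"
  assumes mix: "mixing_at r \<delta>"
    and dep: "\<And>k. k < n \<Longrightarrow> depends {k..k + 2 * r} (Y k)"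
    and bound: "\<And>k z. k < n \<Longrightarrow> z \<in> space M \<Longrightarrow> \<bar>Y k z\<bar> \<le> B"
    and centered: "\<And>k. k < n \<Longrightarrow> (\<integral>z. Y k z \<partial>M) = 0"
    and a: "0 \<le> a" and j: "j < n"
  shows "cmod ((\<integral>z. Y j z * iexp (t * Z z) \<partial>M) - \<i> * (t * a * (\<Sum>k<n. \<integral>z. Y j z * Y k z \<partial>M)) * (\<integral>z. iexp (t * Z z) \<partial>M))
    \<le> 3 * \<delta> * B + \<bar>t\<bar> * a * (m * (4 * \<delta> * B\<^sup>2 + B\<^sup>2 * (\<bar>t\<bar> * (a * m * B))) + n * \<delta> * B\<^sup>2) + B * (\<bar>t\<bar> * (a * m * B))\<^sup>2 / 2"
proof -
  obtain z0 where z0: "z0 \<in> space M" using not_empty by blast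
  have B: "0 \<le> B" using bound[OF j z0] by linarith
  have \<delta>: "0 \<le> \<delta>" by (rule mixing_at_nonneg[OF mix])
  text \<open>The indices within distance \<open>6 r\<close> of \<open>j\<close> are removed from \<open>Z\<close> by a Taylor expansion. Of the products
    \<open>Y\<^sub>j Y\<^sub>k\<close> produced by it, those with \<open>\<bar>k - j\<bar> \<le> 3 r\<close> form one block that is separated from the rest;
    in the others \<open>Y\<^sub>j\<close> alone is separated from everything else and its mean is \<open>0\<close>.\<close>
  define lf nr rt where "lf = {k. k < n \<and> k + 6 * r < j}"
    and "nr = {k. k < n \<and> k \<le> j + 6 * r \<and> j \<le> k + 6 * r}" and "rt = {k. k < n \<and> j + 6 * r < k}"
  have fin: "finite lf" "finite nr" "finite rt" by (simp_all add: lf_def nr_def rt_def)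
  have split: "{..<n} = lf \<union> rt \<union> nr" "(lf \<union> rt) \<inter> nr = {}" "lf \<inter> rt = {}" by (auto simp: lf_def nr_def rt_def)
  have card_nr: "real (card nr) \<le> m"
  proof -
    have "card nr \<le> card {j - 6 * r..j + 6 * r}" by (rule card_mono) (auto simp: nr_def)
    then show ?thesis by (simp add: m_def)
  qed
  define SL SR D where "SL z = a * (\<Sum>k\<in>lf. Y k z)" and "SR z = a * (\<Sum>k\<in>rt. Y k z)" and "D z = a * (\<Sum>k\<in>nr. Y k z)" for z
  have Z: "Z z = (SL z + SR z) + D z" for z
    unfolding Z_def SL_def SR_def D_def split(1) using fin split
    by (simp add: sum.union_disjoint distrib_left)
  have D_bound: "\<bar>D z\<bar> \<le> a * m * B" if "z \<in> space M" for z
  proof -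
    have "\<bar>\<Sum>k\<in>nr. Y k z\<bar> \<le> (\<Sum>k\<in>nr. B)"
      by (rule order_trans[OF sum_abs sum_mono]) (use bound that in \<open>auto simp: nr_def\<close>)
    also have "\<dots> \<le> m * B" using card_nr B by (simp add: mult_right_mono)
    finally show ?thesis using a by (simp add: D_def abs_mult mult_left_mono mult.assoc)
  qed
  define EL ER where "EL z = iexp (t * SL z)" and "ER z = iexp (t * SR z)" for z
  define y where "y k z = complex_of_real (Y k z)" for k z
  define c where "c k = (\<integral>z. Y j z * Y k z \<partial>M)" for k
  \<comment> \<open>The function \<open>Y k\<close> uses the coordinates k, ..., k + 2 r. So the
    left sum stops before j - 4 r and the right one starts after j + 6 r, while a product of
    \<open>Y j\<close> and \<open>Y k\<close> at distance at most 3 r stays within j - 3 r, ..., j +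
    5 r: a gap of r remains on either side.\<close>
  define IL IR where "IL = {i. i + 4 * r < j}" and "IR = {j + 6 * r<..n + 2 * r}"
  have fI: "finite IL" "finite IR" by (auto simp: IL_def IR_def intro: finite_subset[of _ "{..j}"])
  have dy: "depends {k..k + 2 * r} (y k)" if "k < n" for k
    unfolding y_def by (rule depends_on_compose[OF dep[OF that]])
  have dEL: "depends IL EL"
    unfolding EL_def SL_def
    by (rule depends_on_compose[of _ _ _ _ "\<lambda>s. iexp (t * (a * s))"], rule depends_on_sum, rule depends_on_mono[OF dep])
       (auto simp: lf_def IL_def)
  have dER: "depends IR ER"
    unfolding ER_def SR_def
    by (rule depends_on_compose[of _ _ _ _ "\<lambda>s. iexp (t * (a * s))"], rule depends_on_sum, rule depends_on_mono[OF dep])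
       (auto simp: rt_def IR_def)
  let ?N = "{..n + 2 * r}"
  have NEL: "depends ?N EL" by (rule depends_on_mono[OF dEL]) (use j in \<open>auto simp: IL_def\<close>)
  have NER: "depends ?N ER" by (rule depends_on_mono[OF dER]) (auto simp: IR_def)
  have Ny: "depends ?N (y k)" if "k < n" for k by (rule depends_on_mono[OF dy[OF that]]) (use that in auto)
  have NY: "depends ?N (Y k)" if "k < n" for k by (rule depends_on_mono[OF dep[OF that]]) (use that in auto)
  have N2: "depends ?N (\<lambda>z. U z * V z)" if "depends ?N U" "depends ?N V" for U V :: "'a \<Rightarrow> complex"
    using depends_mult[OF that] by simp
  have Nint: "integrable M U" if "depends ?N U" for U :: "'a \<Rightarrow> complex"
    by (rule depends_integrable[OF that]) simp
  have NZ: "depends ?N (\<lambda>z. iexp (t * Z z))"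
    unfolding Z_def by (rule depends_on_compose[of _ _ _ _ "\<lambda>s. iexp (t * (a * s))"], rule depends_on_sum, rule NY) simp
  have nE: "cmod (EL z) = 1" "cmod (ER z) = 1" for z by (simp_all add: EL_def ER_def)
  have ny: "cmod (y k z) \<le> B" if "k < n" "z \<in> space M" for k z using bound[OF that] by (simp add: y_def)
  have Ey: "(\<integral>z. y k z \<partial>M) = 0" if "k < n" for k
    using centered[OF that] unfolding y_def by (simp add: integral_complex_of_real)
  have Ec: "(\<integral>z. y j z * y k z \<partial>M) = c k" for k
    unfolding y_def c_def of_real_mult[symmetric] by (rule integral_complex_of_real)
  have nyy: "cmod (y j z * y k z) \<le> B\<^sup>2" if "k < n" "z \<in> space M" for k z
    unfolding norm_mult power2_eq_square using ny[OF j that(2)] ny[OF that] B by (intro mult_mono) auto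
  have c_bound: "\<bar>c k\<bar> \<le> B\<^sup>2" if "k < n" for k
    using norm_expectation_le[of "\<lambda>z. y j z * y k z" "B\<^sup>2"] nyy[OF that] by (simp add: Ec)
  have c_far: "\<bar>c k\<bar> \<le> \<delta> * B\<^sup>2" if k: "k < n" and far: "j + 3 * r < k \<or> k + 3 * r < j" for k
  proof -
    have "cmod ((\<integral>z. y j z * y k z \<partial>M) - (\<integral>z. y j z \<partial>M) * (\<integral>z. y k z \<partial>M)) \<le> \<delta> * B * B"
      if "j + 3 * r < k" by (rule mixing_atD[OF mix dy[OF j] dy[OF k]]) (use ny that j k in auto)
    moreover have "cmod ((\<integral>z. y k z * y j z \<partial>M) - (\<integral>z. y k z \<partial>M) * (\<integral>z. y j z \<partial>M)) \<le> \<delta> * B * B"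
      if "k + 3 * r < j" by (rule mixing_atD[OF mix dy[OF k] dy[OF j]]) (use ny that j k in auto)
    ultimately show ?thesis
      using far by (auto simp: Ey j Ec power2_eq_square mult.commute[of "y k _"])
  qed
  define F where "F = (\<integral>z. EL z * ER z \<partial>M)"
  define T where "T k = (\<integral>z. EL z * (y j z * y k z) * ER z \<partial>M)" for k
  define f where "f = (\<integral>z. iexp (t * Z z) \<partial>M)"
  have F: "cmod F \<le> 1" unfolding F_def by (rule norm_expectation_le) (auto simp: norm_mult nE)
  have f: "cmod f \<le> 1" unfolding f_def by (rule norm_expectation_le) auto
  have e1: "cmod (\<integral>z. EL z * y j z * ER z \<partial>M) \<le> 3 * \<delta> * B"
    using mixing_triple[OF mix dEL dy[OF j] dER, of 1 B 1] fI nE ny[OF j] Ey[OF j]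
    by (auto simp: IL_def IR_def)
  \<comment> \<open>When \<open>k\<close> is more than 3 r away from \<open>j\<close>,
    \<open>T k\<close> and \<open>c k * F\<close> are not matched but separately small, by 3
    \<delta> and \<delta> times \<open>B\<^sup>2\<close>; this accounts for the 4.\<close>
  have e2: "cmod (T k - c k * F) \<le> 4 * \<delta> * B\<^sup>2" if k: "k \<in> nr" for k
  proof -
    have kn: "k < n" using k by (simp add: nr_def)
    consider "j \<le> k + 3 * r \<and> k \<le> j + 3 * r" | "j + 3 * r < k" | "k + 3 * r < j" by linarith
    then show ?thesis
    proof cases
      case 1
      have "cmod (T k - c k * F) \<le> 3 * \<delta> * 1 * B\<^sup>2 * 1"
        unfolding T_def F_def Ec[symmetric]
        by (rule mixing_triple[OF mix dEL depends_mult[OF dy[OF j] dy[OF kn]] dER])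
           (use fI nE nyy[OF kn] 1 in \<open>auto simp: IL_def IR_def\<close>)
      moreover have "3 * \<delta> * B\<^sup>2 \<le> 4 * \<delta> * B\<^sup>2" using \<delta> by (intro mult_right_mono) auto
      ultimately show ?thesis by linarith
    next
      case 2
      have "cmod ((\<integral>z. EL z * y j z * (y k z * ER z) \<partial>M) - (\<integral>z. y j z \<partial>M) * (\<integral>z. EL z * (y k z * ER z) \<partial>M)) \<le> 3 * \<delta> * 1 * B * B"
        by (rule mixing_triple[OF mix dEL dy[OF j] depends_mult[OF dy[OF kn] dER]])
           (use fI nE ny[OF j] ny[OF kn] 2 kn in \<open>auto simp: IL_def IR_def norm_mult\<close>)
      then have "cmod (T k) \<le> 3 * \<delta> * B\<^sup>2"
        by (simp add: Ey[OF j] T_def power2_eq_square mult_ac)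
      moreover have "cmod (c k * F) \<le> \<delta> * B\<^sup>2 * 1"
        unfolding norm_mult norm_of_real by (intro mult_mono c_far F) (use 2 kn \<delta> in auto)
      ultimately show ?thesis using norm_triangle_ineq4[of "T k" "c k * F"] by linarith
    next
      case 3
      have "cmod ((\<integral>z. (EL z * y k z) * y j z * ER z \<partial>M) - (\<integral>z. y j z \<partial>M) * (\<integral>z. (EL z * y k z) * ER z \<partial>M)) \<le> 3 * \<delta> * B * B * 1"
        by (rule mixing_triple[OF mix depends_mult[OF dEL dy[OF kn]] dy[OF j] dER])
           (use fI nE ny[OF j] ny[OF kn] 3 kn in \<open>auto simp: IL_def IR_def norm_mult\<close>)
      then have "cmod (T k) \<le> 3 * \<delta> * B\<^sup>2"
        by (simp add: Ey[OF j] T_def power2_eq_square mult_ac)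
      moreover have "cmod (c k * F) \<le> \<delta> * B\<^sup>2 * 1"
        unfolding norm_mult norm_of_real by (intro mult_mono c_far F) (use 3 kn \<delta> in auto)
      ultimately show ?thesis using norm_triangle_ineq4[of "T k" "c k * F"] by linarith
    qed
  qed
  have ELER: "EL z * ER z = iexp (t * (SL z + SR z))" for z
    by (simp add: EL_def ER_def exp_add[symmetric] distrib_left)
  have e3: "cmod (F - f) \<le> \<bar>t\<bar> * (a * m * B)"
  proof -
    have "F - f = (\<integral>z. EL z * ER z - iexp (t * Z z) \<partial>M)"
      unfolding F_def f_def using Nint[OF N2[OF NEL NER]] Nint[OF NZ] by simp
    also have "cmod \<dots> \<le> \<bar>t\<bar> * (a * m * B)"
    proof (rule norm_expectation_le[OF AE_I2])
      fix z assume z: "z \<in> space M"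
      have "cmod (EL z * ER z - iexp (t * Z z)) \<le> \<bar>t * (SL z + SR z) - t * Z z\<bar>"
        unfolding ELER by (rule cmod_iexp_diff_le)
      also have "\<dots> = \<bar>t\<bar> * \<bar>D z\<bar>" by (simp add: Z right_diff_distrib[symmetric] abs_mult)
      also have "\<dots> \<le> \<bar>t\<bar> * (a * m * B)" by (intro mult_left_mono D_bound z) auto
      finally show "cmod (EL z * ER z - iexp (t * Z z)) \<le> \<bar>t\<bar> * (a * m * B)" .
    qed (use a B in \<open>simp add: m_def\<close>)
    finally show ?thesis .
  qed
  \<comment> \<open>The remainder when the window sum \<open>D\<close> is expanded to first order.
    Its linear term is what produces the products of \<open>Y j\<close> with the near
    \<open>Y k\<close>.\<close>
  define R where "R z = iexp (t * Z z) - EL z * ER z - \<i> * (t * D z) * (EL z * ER z)" for z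
  have R: "cmod (R z) \<le> (\<bar>t\<bar> * (a * m * B))\<^sup>2 / 2" if z: "z \<in> space M" for z
  proof -
    have "cmod (R z) \<le> (t * D z)\<^sup>2 / 2"
      unfolding R_def ELER using cmod_iexp_taylor[of "t * (SL z + SR z)" "t * D z"] by (simp add: Z distrib_left)
    also have "(t * D z)\<^sup>2 \<le> (\<bar>t\<bar> * (a * m * B))\<^sup>2"
      unfolding power2_abs[of "t * D z", symmetric] abs_mult
      by (intro power_mono mult_left_mono D_bound z) auto
    finally show ?thesis by simp
  qed
  have e5: "cmod (\<integral>z. y j z * R z \<partial>M) \<le> B * ((\<bar>t\<bar> * (a * m * B))\<^sup>2 / 2)"
    by (rule norm_expectation_le[OF AE_I2]) (unfold norm_mult, intro mult_mono ny j R, use B in auto)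
  have iT: "integrable M (\<lambda>z. EL z * (y j z * y k z) * ER z)" if "k \<in> nr" for k
    using that by (intro Nint N2 NEL NER Ny j) (simp add: nr_def)
  have i1: "integrable M (\<lambda>z. EL z * y j z * ER z)"
    by (intro Nint N2 NEL NER Ny j)
  have i2: "integrable M (\<lambda>z. y j z * iexp (t * Z z))"
    by (intro Nint N2 NZ Ny j)
  have pw: "y j z * R z = y j z * iexp (t * Z z) - EL z * y j z * ER z - (\<Sum>k\<in>nr. (\<i> * t * a) * (EL z * (y j z * y k z) * ER z))" for z
    by (simp add: R_def D_def y_def right_diff_distrib sum_distrib_left sum_distrib_right mult_ac)
  have main: "(\<integral>z. y j z * iexp (t * Z z) \<partial>M) = (\<integral>z. EL z * y j z * ER z \<partial>M) + (\<Sum>k\<in>nr. (\<i> * t * a) * T k) + (\<integral>z. y j z * R z \<partial>M)"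
    unfolding pw T_def using iT i1 i2 by simp
  \<comment> \<open>The far covariances do not arise in the expansion but belong to the full second
    moment of \<open>Z\<close>. They are inserted at the cost of \<delta> \<open>B\<^sup>2\<close>
    each.\<close>
  define far where "far = lf \<union> rt"
  have split_c: "(\<Sum>k<n. c k) = (\<Sum>k\<in>far. c k) + (\<Sum>k\<in>nr. c k)"
    unfolding split(1) far_def using fin split by (intro sum.union_disjoint) auto
  have "(\<integral>z. y j z * iexp (t * Z z) \<partial>M) - \<i> * (t * a * (\<Sum>k<n. c k)) * f
    = (\<integral>z. EL z * y j z * ER z \<partial>M) + (\<i> * t * a) * ((\<Sum>k\<in>nr. (T k - c k * F) + c k * (F - f)) - f * (\<Sum>k\<in>far. c k)) + (\<integral>z. y j z * R z \<partial>M)"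
    unfolding main split_c
    by (simp add: algebra_simps sum.distrib sum_subtractf sum_distrib_left sum_distrib_right)
  also have "cmod \<dots> \<le> 3 * \<delta> * B + \<bar>t\<bar> * a * (m * (4 * \<delta> * B\<^sup>2 + B\<^sup>2 * (\<bar>t\<bar> * (a * m * B))) + n * \<delta> * B\<^sup>2) + B * ((\<bar>t\<bar> * (a * m * B))\<^sup>2 / 2)"
  proof (rule order_trans[OF norm_triangle_ineq add_mono[OF order_trans[OF norm_triangle_ineq add_mono[OF e1]] e5]])
    have "cmod (\<Sum>k\<in>nr. (T k - c k * F) + c k * (F - f)) \<le> (\<Sum>k\<in>nr. 4 * \<delta> * B\<^sup>2 + B\<^sup>2 * (\<bar>t\<bar> * (a * m * B)))"
    proof (rule order_trans[OF norm_sum sum_mono])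
      fix k assume k: "k \<in> nr"
      have "cmod (c k * (F - f)) \<le> B\<^sup>2 * (\<bar>t\<bar> * (a * m * B))"
        unfolding norm_mult norm_of_real by (intro mult_mono c_bound e3) (use k in \<open>auto simp: nr_def\<close>)
      then show "cmod ((T k - c k * F) + c k * (F - f)) \<le> 4 * \<delta> * B\<^sup>2 + B\<^sup>2 * (\<bar>t\<bar> * (a * m * B))"
        by (rule order_trans[OF norm_triangle_ineq add_mono[OF e2[OF k]]])
    qed
    also have "\<dots> \<le> m * (4 * \<delta> * B\<^sup>2 + B\<^sup>2 * (\<bar>t\<bar> * (a * m * B)))"
      using mult_right_mono[OF card_nr, of "4 * \<delta> * B\<^sup>2 + B\<^sup>2 * (\<bar>t\<bar> * (a * m * B))"] a B \<delta> by (simp add: m_def)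
    finally have 1: "cmod (\<Sum>k\<in>nr. (T k - c k * F) + c k * (F - f)) \<le> m * (4 * \<delta> * B\<^sup>2 + B\<^sup>2 * (\<bar>t\<bar> * (a * m * B)))" .
    have "\<bar>\<Sum>k\<in>far. c k\<bar> \<le> (\<Sum>k\<in>far. \<delta> * B\<^sup>2)"
      by (rule order_trans[OF sum_abs sum_mono]) (auto intro!: c_far simp: far_def lf_def rt_def)
    also have "\<dots> \<le> n * \<delta> * B\<^sup>2"
    proof -
      have "card far \<le> card {..<n}" by (rule card_mono) (auto simp: far_def lf_def rt_def)
      then show ?thesis using \<delta> by (simp add: mult_right_mono mult.assoc)
    qed
    finally have "cmod (f * (\<Sum>k\<in>far. c k)) \<le> 1 * (n * \<delta> * B\<^sup>2)"
      unfolding norm_mult norm_of_real by (intro mult_mono f) auto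
    then have "cmod ((\<Sum>k\<in>nr. (T k - c k * F) + c k * (F - f)) - f * (\<Sum>k\<in>far. c k)) \<le> m * (4 * \<delta> * B\<^sup>2 + B\<^sup>2 * (\<bar>t\<bar> * (a * m * B))) + n * \<delta> * B\<^sup>2"
      using norm_triangle_ineq4[of "\<Sum>k\<in>nr. (T k - c k * F) + c k * (F - f)" "f * (\<Sum>k\<in>far. c k)"] 1 by linarith
    then show "cmod ((\<i> * t * a) * ((\<Sum>k\<in>nr. (T k - c k * F) + c k * (F - f)) - f * (\<Sum>k\<in>far. c k)))
      \<le> \<bar>t\<bar> * a * (m * (4 * \<delta> * B\<^sup>2 + B\<^sup>2 * (\<bar>t\<bar> * (a * m * B))) + n * \<delta> * B\<^sup>2)"
      unfolding norm_mult using a by (simp add: mult_left_mono)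
  qed
  finally show ?thesis
    by (simp add: y_def c_def f_def)
qed


text \<open>Summing \<open>char_derivative_term\<close> over \<open>j\<close> collects all
  covariances, hence the exact second moment of \<open>Z\<close>, and gives f'(u) = - u E(Z^2) f(u)
  up to an error that \<open>gaussian_ode_bound\<close> integrates. The factor \<open>a * n\<close>
  stands for the n summands, each of weight \<open>a\<close>.\<close>

lemma char_gaussian_bound:
  fixes Y :: "nat \<Rightarrow> 'a \<Rightarrow> real" and a B \<delta> t :: real and n r :: nat
  defines "Z \<equiv> \<lambda>z. a * (\<Sum>k<n. Y k z)" and "m \<equiv> real (12 * r + 1)"
  assumes mix: "mixing_at r \<delta>"
    and dep: "\<And>k. k < n \<Longrightarrow> depends {k..k + 2 * r} (Y k)"
    and bound: "\<And>k z. k < n \<Longrightarrow> z \<in> space M \<Longrightarrow> \<bar>Y k z\<bar> \<le> B"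
    and centered: "\<And>k. k < n \<Longrightarrow> (\<integral>z. Y k z \<partial>M) = 0"
    and a: "0 \<le> a" and B: "0 \<le> B"
  shows "cmod ((\<integral>z. iexp (t * Z z) \<partial>M) - of_real (exp (- (\<integral>z. (Z z)\<^sup>2 \<partial>M) * t\<^sup>2 / 2)))
    \<le> \<bar>t\<bar> * (a * n * (3 * \<delta> * B + \<bar>t\<bar> * a * (m * (4 * \<delta> * B\<^sup>2 + B\<^sup>2 * (\<bar>t\<bar> * (a * m * B))) + n * \<delta> * B\<^sup>2) + B * (\<bar>t\<bar> * (a * m * B))\<^sup>2 / 2))"
proof (rule gaussian_ode_bound)
  have \<delta>: "0 \<le> \<delta>" by (rule mixing_at_nonneg[OF mix])
  let ?N = "{..n + 2 * r}"
  have NY: "depends ?N (Y k)" if "k < n" for k by (rule depends_on_mono[OF dep[OF that]]) (use that in auto)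
  have NZ: "depends ?N Z"
    unfolding Z_def by (rule depends_on_compose, rule depends_on_sum, rule NY) simp
  have Zm: "Z \<in> borel_measurable M" by (rule depends_measurable[OF NZ]) simp
  have Zb: "\<bar>Z z\<bar> \<le> a * (n * B)" if "z \<in> space M" for z
  proof -
    have "\<bar>\<Sum>k<n. Y k z\<bar> \<le> (\<Sum>k<n. B)"
      by (rule order_trans[OF sum_abs sum_mono]) (use bound that in auto)
    then show ?thesis using a by (simp add: Z_def abs_mult mult_left_mono)
  qed
  show "((\<lambda>t. \<integral>z. iexp (t * Z z) \<partial>M) has_vector_derivative (\<integral>z. \<i> * Z z * iexp (u * Z z) \<partial>M)) (at u)" for u
    by (rule char_has_derivative_bounded[OF Zm AE_I2[OF Zb]])
  show "(\<integral>z. iexp (0 * Z z) \<partial>M) = 1" by (simp add: prob_space)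
  show "0 \<le> (\<integral>z. (Z z)\<^sup>2 \<partial>M)" by simp
  define c where "c j k = (\<integral>z. Y j z * Y k z \<partial>M)" for j k
  have "(\<integral>z. (Z z)\<^sup>2 \<partial>M) = (\<integral>z. (\<Sum>j<n. \<Sum>k<n. a\<^sup>2 * (Y j z * Y k z)) \<partial>M)"
    by (simp add: Z_def power_mult_distrib power2_eq_square sum_product sum_distrib_left mult_ac)
  also have "\<dots> = (\<Sum>j<n. \<Sum>k<n. a\<^sup>2 * c j k)"
  proof -
    have "integrable M (\<lambda>z. Y j z * Y k z)" if "j < n" "k < n" for j k
      by (rule depends_integrable[OF depends_mult[OF NY[OF that(1)] NY[OF that(2)]]]) simp
    then have int: "integrable M (\<lambda>z. a\<^sup>2 * (Y j z * Y k z))" if "j < n" "k < n" for j k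
      using that by simp
    have "(\<integral>z. (\<Sum>j<n. \<Sum>k<n. a\<^sup>2 * (Y j z * Y k z)) \<partial>M) = (\<Sum>j<n. \<integral>z. (\<Sum>k<n. a\<^sup>2 * (Y j z * Y k z)) \<partial>M)"
      by (rule Bochner_Integration.integral_sum) (auto intro!: Bochner_Integration.integrable_sum int)
    also have "\<dots> = (\<Sum>j<n. \<Sum>k<n. a\<^sup>2 * c j k)"
    proof (rule sum.cong[OF refl])
      fix j assume "j \<in> {..<n}"
      then have "(\<integral>z. (\<Sum>k<n. a\<^sup>2 * (Y j z * Y k z)) \<partial>M) = (\<Sum>k<n. \<integral>z. a\<^sup>2 * (Y j z * Y k z) \<partial>M)"
        by (intro Bochner_Integration.integral_sum int) auto
      then show "(\<integral>z. (\<Sum>k<n. a\<^sup>2 * (Y j z * Y k z)) \<partial>M) = (\<Sum>k<n. a\<^sup>2 * c j k)"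
        by (simp add: c_def)
    qed
    finally show ?thesis .
  qed
  finally have s: "(\<integral>z. (Z z)\<^sup>2 \<partial>M) = (\<Sum>j<n. \<Sum>k<n. a\<^sup>2 * c j k)" .
  fix u :: real assume u: "\<bar>u\<bar> \<le> \<bar>t\<bar>"
  let ?f = "\<integral>z. iexp (u * Z z) \<partial>M"
  have NE: "depends ?N (\<lambda>z. iexp (u * Z z))"
    by (rule depends_on_compose[OF NZ])
  have iE: "integrable M (\<lambda>z. (\<i> * a) * (Y j z * iexp (u * Z z)))" if "j < n" for j
    by (rule integrable_mult_right)
      (use depends_integrable[OF depends_mult[OF depends_on_compose[OF NY[OF that], of complex_of_real] NE]] in simp)
  \<comment> \<open>Rests on (i a) (- i u a S) = u a^2 S: distributing E(Z^2) over the summands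
    leaves one error of the kind bounded before for each \<open>j\<close>.\<close>
  have alg: "(\<Sum>j<n. (\<i> * a) * E j) + of_real (u * (\<Sum>j<n. \<Sum>k<n. a\<^sup>2 * c j k)) * f
    = (\<Sum>j<n. (\<i> * a) * (E j - \<i> * (u * a * (\<Sum>k<n. c j k)) * f))" for E :: "nat \<Rightarrow> complex" and f
  proof -
    have "(\<i> * a) * (e - \<i> * (u * a * S) * f) = (\<i> * a) * e + of_real (u * (a\<^sup>2 * S)) * f" for e and S :: real
      by (simp add: power2_eq_square algebra_simps)
    moreover have "(\<Sum>j<n. \<Sum>k<n. a\<^sup>2 * c j k) = (\<Sum>j<n. a\<^sup>2 * (\<Sum>k<n. c j k))"
      by (simp add: sum_distrib_left)
    moreover have "complex_of_real (u * (\<Sum>j<n. g j)) * f = (\<Sum>j<n. of_real (u * g j) * f)" for g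
      by (simp add: sum_distrib_left sum_distrib_right)
    ultimately show ?thesis
      by (simp only: sum.distrib)
  qed
  have "(\<integral>z. \<i> * Z z * iexp (u * Z z) \<partial>M) = (\<integral>z. (\<Sum>j<n. (\<i> * a) * (Y j z * iexp (u * Z z))) \<partial>M)"
    by (rule Bochner_Integration.integral_cong[OF refl]) 
       (subst (1) Z_def, simp only: of_real_mult of_real_sum sum_distrib_left sum_distrib_right mult_ac)
  also have "\<dots> = (\<Sum>j<n. (\<i> * a) * (\<integral>z. Y j z * iexp (u * Z z) \<partial>M))"
    using iE by (subst Bochner_Integration.integral_sum) (auto simp del: of_real_mult)
  finally have deriv: "(\<integral>z. \<i> * Z z * iexp (u * Z z) \<partial>M) = (\<Sum>j<n. (\<i> * a) * (\<integral>z. Y j z * iexp (u * Z z) \<partial>M))" .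
  have ode: "(\<integral>z. \<i> * Z z * iexp (u * Z z) \<partial>M) + of_real (u * (\<integral>z. (Z z)\<^sup>2 \<partial>M)) * ?f
    = (\<Sum>j<n. (\<i> * a) * ((\<integral>z. Y j z * iexp (u * Z z) \<partial>M) - \<i> * (u * a * (\<Sum>k<n. c j k)) * ?f))"
    unfolding s deriv by (rule alg)
  have "cmod (\<Sum>j<n. (\<i> * a) * ((\<integral>z. Y j z * iexp (u * Z z) \<partial>M) - \<i> * (u * a * (\<Sum>k<n. c j k)) * ?f))
    \<le> (\<Sum>j<n. a * (3 * \<delta> * B + \<bar>t\<bar> * a * (m * (4 * \<delta> * B\<^sup>2 + B\<^sup>2 * (\<bar>t\<bar> * (a * m * B))) + n * \<delta> * B\<^sup>2) + B * (\<bar>t\<bar> * (a * m * B))\<^sup>2 / 2))"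
  proof (rule order_trans[OF norm_sum sum_mono])
    fix j assume "j \<in> {..<n}"
    then have j: "j < n" by simp
    have "cmod ((\<integral>z. Y j z * iexp (u * Z z) \<partial>M) - \<i> * (u * a * (\<Sum>k<n. c j k)) * ?f)
      \<le> 3 * \<delta> * B + \<bar>u\<bar> * a * (m * (4 * \<delta> * B\<^sup>2 + B\<^sup>2 * (\<bar>u\<bar> * (a * m * B))) + n * \<delta> * B\<^sup>2) + B * (\<bar>u\<bar> * (a * m * B))\<^sup>2 / 2"
      unfolding Z_def c_def m_def by (rule char_derivative_term[OF mix dep bound centered a j])
    also have "\<dots> \<le> 3 * \<delta> * B + \<bar>t\<bar> * a * (m * (4 * \<delta> * B\<^sup>2 + B\<^sup>2 * (\<bar>t\<bar> * (a * m * B))) + n * \<delta> * B\<^sup>2) + B * (\<bar>t\<bar> * (a * m * B))\<^sup>2 / 2"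
      using a B \<delta> u by (intro add_mono mult_mono divide_right_mono power_mono order_refl) (auto simp: m_def)
    finally show "cmod ((\<i> * a) * ((\<integral>z. Y j z * iexp (u * Z z) \<partial>M) - \<i> * (u * a * (\<Sum>k<n. c j k)) * ?f))
      \<le> a * (3 * \<delta> * B + \<bar>t\<bar> * a * (m * (4 * \<delta> * B\<^sup>2 + B\<^sup>2 * (\<bar>t\<bar> * (a * m * B))) + n * \<delta> * B\<^sup>2) + B * (\<bar>t\<bar> * (a * m * B))\<^sup>2 / 2)"
      unfolding norm_mult using a by (simp add: mult_left_mono)
  qed
  then show "cmod ((\<integral>z. \<i> * Z z * iexp (u * Z z) \<partial>M) + of_real (u * (\<integral>z. (Z z)\<^sup>2 \<partial>M)) * ?f)
    \<le> a * n * (3 * \<delta> * B + \<bar>t\<bar> * a * (m * (4 * \<delta> * B\<^sup>2 + B\<^sup>2 * (\<bar>t\<bar> * (a * m * B))) + n * \<delta> * B\<^sup>2) + B * (\<bar>t\<bar> * (a * m * B))\<^sup>2 / 2)"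
    unfolding ode by (simp add: mult_ac)
qed

end

section \<open>Observables approximable by blocks: covariances and variance\<close>

lemma geometric_tail:
  fixes a :: "nat \<Rightarrow> real"
  assumes "\<And>j. \<bar>a j\<bar> \<le> C * \<rho> ^ j" "0 < \<rho>" "\<rho> < 1"
  shows "summable a" "\<bar>(\<Sum>j<n. a j) - suminf a\<bar> \<le> C / (1 - \<rho>) * \<rho> ^ n"
proof -
  have g: "summable (\<lambda>j. C * \<rho> ^ j)" using assms by (intro summable_mult summable_geometric) auto
  show sa: "summable a" by (rule summable_comparison_test'[OF g]) (use assms in auto)
  have sa': "summable (\<lambda>j. \<bar>a (j + n)\<bar>)"
    using summable_comparison_test'[OF g, of 0 "\<lambda>j. \<bar>a j\<bar>"] assms(1) summable_iff_shift[of "\<lambda>j. \<bar>a j\<bar>" n] by simp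
  have "suminf a - (\<Sum>j<n. a j) = (\<Sum>j. a (j + n))"
    using suminf_split_initial_segment[OF sa, of n] by simp
  also have "\<bar>\<dots>\<bar> \<le> (\<Sum>j. \<bar>a (j + n)\<bar>)" by (rule summable_rabs[OF sa'])
  also have "\<dots> \<le> (\<Sum>j. (C * \<rho> ^ n) * \<rho> ^ j)"
    using assms by (intro suminf_le sa' summable_mult summable_geometric)
      (auto intro: order_trans[OF assms(1)] simp: power_add mult_ac)
  also have "\<dots> = C / (1 - \<rho>) * \<rho> ^ n"
    using assms by (simp add: suminf_mult summable_geometric suminf_geometric)
  finally show "\<bar>(\<Sum>j<n. a j) - suminf a\<bar> \<le> C / (1 - \<rho>) * \<rho> ^ n" by (simp add: abs_minus_commute)
qed

lemma (in finite_markov_chain) mixing_at_mono: "mixing_at L \<delta> \<Longrightarrow> \<delta> \<le> \<delta>' \<Longrightarrow> mixing_at L \<delta>'"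
proof -
  assume mix: "mixing_at L \<delta>" and le: "\<delta> \<le> \<delta>'"
  show "mixing_at L \<delta>'"
    unfolding mixing_at_def
  proof (intro allI impI)
    fix U V :: "'a \<Rightarrow> complex" and I J A B
    assume *: "depends I U" "depends J V" "finite I" "finite J" "\<forall>i\<in>I. \<forall>j\<in>J. i + L \<le> j"
      "\<forall>z\<in>space M. cmod (U z) \<le> A" "\<forall>z\<in>space M. cmod (V z) \<le> B"
    obtain z0 where z0: "z0 \<in> space M" using not_empty by blast
    have "0 \<le> A" "0 \<le> B" using *(6,7)[rule_format, OF z0] norm_ge_zero order_trans by blast+
    then have "\<delta> * A * B \<le> \<delta>' * A * B" using le by (intro mult_right_mono)
    then show "cmod ((\<integral>z. U z * V z \<partial>M) - (\<integral>z. U z \<partial>M) * (\<integral>z. V z \<partial>M)) \<le> \<delta>' * A * B"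
      by (rule order_trans[OF mixing_atD[OF mix *]])
  qed
qed

lemma (in finite_markov_chain) mixing_at_real:
  fixes U V :: "'a \<Rightarrow> real"
  assumes "mixing_at L \<delta>" "depends I U" "depends J V" "finite I" "finite J" "\<forall>i\<in>I. \<forall>j\<in>J. i + L \<le> j"
    and "\<forall>z\<in>space M. \<bar>U z\<bar> \<le> A" "\<forall>z\<in>space M. \<bar>V z\<bar> \<le> B"
  shows "\<bar>(\<integral>z. U z * V z \<partial>M) - (\<integral>z. U z \<partial>M) * (\<integral>z. V z \<partial>M)\<bar> \<le> \<delta> * A * B"
proof -
  have "cmod ((\<integral>z. complex_of_real (U z) * complex_of_real (V z) \<partial>M) - (\<integral>z. complex_of_real (U z) \<partial>M) * (\<integral>z. complex_of_real (V z) \<partial>M)) \<le> \<delta> * A * B"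
    by (rule mixing_atD[OF assms(1) depends_on_compose[OF assms(2)] depends_on_compose[OF assms(3)] assms(4-6)])
       (use assms(7,8) in auto)
  then show ?thesis
    by (simp only: of_real_mult[symmetric] of_real_diff[symmetric] integral_complex_of_real norm_of_real)
qed

text \<open>A measure preserving map that shifts the coordinates of a chain, with an observable that
  need not be a function of them. The assumption \<open>approximable\<close> concerns \<phi> \<circ>
  T^r because in a skew product the unknown fiber coordinate loses its influence only after
  iteration.\<close>

locale markov_approximable = finite_markov_chain M X P p
  for M :: "'a measure" and X :: "nat \<Rightarrow> 'a \<Rightarrow> 'n::finite" and P p +
  fixes T :: "'a \<Rightarrow> 'a" and \<phi> :: "'a \<Rightarrow> real" and B :: real
  assumes T_measurable [measurable]: "T \<in> measurable M M" and T_invariant: "distr M M T = M"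
    and X_shift: "\<And>i z. z \<in> space M \<Longrightarrow> X i (T z) = X (Suc i) z"
    and \<phi>_measurable [measurable]: "\<phi> \<in> borel_measurable M"
    and \<phi>_bound: "\<And>z. z \<in> space M \<Longrightarrow> \<bar>\<phi> z\<bar> \<le> B"
    and \<phi>_mean: "(\<integral>z. \<phi> z \<partial>M) = 0"
    and approximable: "\<exists>K \<rho>. 0 \<le> K \<and> 0 < \<rho> \<and> \<rho> < 1 \<and>
      (\<forall>r. \<exists>h. depends_on (space M) X {..2 * r} h \<and> (AE z in M. \<bar>\<phi> ((T ^^ r) z) - h z\<bar> \<le> K * \<rho> ^ r))"
begin

lemma T_pow_measurable [measurable]: "T ^^ n \<in> measurable M M"
  by (induction n) (auto intro: measurable_comp)

lemma T_pow_invariant: "distr M M (T ^^ n) = M"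
proof (induction n)
  case (Suc n)
  have "distr M M (T ^^ Suc n) = distr (distr M M (T ^^ n)) M T"
    by (simp add: distr_distr)
  then show ?case by (simp only: Suc T_invariant)
qed (simp add: distr_id2)

lemma T_pow_space: "z \<in> space M \<Longrightarrow> (T ^^ n) z \<in> space M"
  using measurable_space[OF T_pow_measurable] .

lemma X_shift_pow: "z \<in> space M \<Longrightarrow> X i ((T ^^ k) z) = X (i + k) z"
  by (induction k arbitrary: i) (auto simp: X_shift T_pow_space)

lemma integral_T_pow:
  fixes g :: "'a \<Rightarrow> 'b::{banach, second_countable_topology}"
  assumes "g \<in> borel_measurable M"
  shows "(\<integral>z. g ((T ^^ n) z) \<partial>M) = (\<integral>z. g z \<partial>M)"
  using integral_distr[OF T_pow_measurable assms, of n] by (simp add: T_pow_invariant)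

lemma AE_T_pow:
  assumes "AE z in M. Q z" shows "AE z in M. Q ((T ^^ n) z)"
  by (rule AE_distrD[OF T_pow_measurable]) (simp only: T_pow_invariant assms)

lemma depends_T_pow:
  assumes "depends {..d} h" shows "depends {k..k + d} (\<lambda>z. h ((T ^^ k) z))"
proof (rule depends_onI)
  fix z z' assume *: "z \<in> space M" "z' \<in> space M" "\<And>i. i \<in> {k..k + d} \<Longrightarrow> X i z = X i z'"
  show "h ((T ^^ k) z) = h ((T ^^ k) z')"
    by (rule depends_onD[OF assms T_pow_space[OF *(1)] T_pow_space[OF *(2)]]) (use * in \<open>auto simp: X_shift_pow\<close>)
qed

lemma B_nonneg: "0 \<le> B"
proof -
  obtain z0 where "z0 \<in> space M" using not_empty by blast
  then show ?thesis using \<phi>_bound[of z0] by linarith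
qed

lemma bounded_integrable:
  fixes g :: "'a \<Rightarrow> real"
  assumes "g \<in> borel_measurable M" "\<And>z. z \<in> space M \<Longrightarrow> \<bar>g z\<bar> \<le> b"
  shows "integrable M g"
  by (rule integrable_const_bound[of _ b]) (use assms in auto)

text \<open>The given approximants are truncated to [-B, B], which does not move them away from
  \<phi>, and then centred. As \<phi> has mean 0, centring shifts them by no more than the
  approximation error; hence the bound 2 B and the constant 2 K. One pair \<open>C\<close>, \<rho>
  serves for both mixing and approximation.\<close>

lemma block_approximation:
  obtains C \<rho> h where "0 \<le> C" "0 < \<rho>" "\<rho> < 1" "\<And>L. mixing_at L (C * \<rho> ^ L)"
    "\<And>r. depends {..2 * r} (h r)" "\<And>r z. \<bar>h r z\<bar> \<le> 2 * B" "\<And>r. (\<integral>z. h r z \<partial>M) = (0 :: real)"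
    "\<And>r. AE z in M. \<bar>\<phi> ((T ^^ r) z) - h r z\<bar> \<le> C * \<rho> ^ r"
proof -
  obtain C1 \<rho>1 where 1: "0 \<le> C1" "0 < \<rho>1" "\<rho>1 < 1" "\<And>L. mixing_at L (C1 * \<rho>1 ^ L)"
    using exponential_mixing by blast
  obtain K \<rho>2 where 2: "0 \<le> K" "0 < \<rho>2" "\<rho>2 < 1" and
    "\<And>r. \<exists>h. depends {..2 * r} h \<and> (AE z in M. \<bar>\<phi> ((T ^^ r) z) - h z\<bar> \<le> K * \<rho>2 ^ r)"
    using approximable by blast
  then obtain g where g: "\<And>r. depends {..2 * r} (g r)" "\<And>r. AE z in M. \<bar>\<phi> ((T ^^ r) z) - g r z\<bar> \<le> K * \<rho>2 ^ r"
    by metis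
  define g' where "g' r z = max (- B) (min B (g r z))" for r z
  define h where "h r z = g' r z - (\<integral>z. g' r z \<partial>M)" for r z
  define C \<rho> where "C = C1 + 2 * K" and "\<rho> = max \<rho>1 \<rho>2"
  have C: "0 \<le> C" "0 < \<rho>" "\<rho> < 1" using 1 2 by (auto simp: C_def \<rho>_def)
  have g'_bound: "\<bar>g' r z\<bar> \<le> B" for r z using B_nonneg by (auto simp: g'_def)
  have g'_dep: "depends {..2 * r} (g' r)" for r
    unfolding g'_def by (rule depends_on_compose[OF g(1)])
  have h_dep: "depends {..2 * r} (h r)" for r
    unfolding h_def by (rule depends_on_compose[OF g'_dep])
  have g'_int: "integrable M (g' r)" for r
    by (rule depends_integrable[OF g'_dep]) simp
  have g'_AE: "AE z in M. \<bar>\<phi> ((T ^^ r) z) - g' r z\<bar> \<le> K * \<rho>2 ^ r" for r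
    using g(2)[of r]
  proof (rule AE_mp, intro AE_I2 impI)
    fix z assume "z \<in> space M" "\<bar>\<phi> ((T ^^ r) z) - g r z\<bar> \<le> K * \<rho>2 ^ r"
    then show "\<bar>\<phi> ((T ^^ r) z) - g' r z\<bar> \<le> K * \<rho>2 ^ r"
      using \<phi>_bound[OF T_pow_space, of z r] by (auto simp: g'_def)
  qed
  have mean: "\<bar>\<integral>z. g' r z \<partial>M\<bar> \<le> K * \<rho>2 ^ r" for r
  proof -
    have "norm ((\<integral>z. \<phi> ((T ^^ r) z) \<partial>M) - (\<integral>z. g' r z \<partial>M)) \<le> K * \<rho>2 ^ r"
      by (rule expectation_diff_le[OF bounded_integrable[of _ B] g'_int])
         (use g'_AE 2 \<phi>_bound T_pow_space in auto)
    then show ?thesis by (simp add: integral_T_pow \<phi>_mean)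
  qed
  show ?thesis
  proof (rule that[OF C _ h_dep])
    show "mixing_at L (C * \<rho> ^ L)" for L
    proof (rule mixing_at_mono[OF 1(4)])
      have "C1 * \<rho>1 ^ L \<le> C * \<rho> ^ L"
        using 1 2 by (intro mult_mono power_mono) (auto simp: C_def \<rho>_def)
      then show "C1 * \<rho>1 ^ L \<le> C * \<rho> ^ L" .
    qed
    show "\<bar>h r z\<bar> \<le> 2 * B" for r z
    proof -
      have "\<bar>\<integral>z. g' r z \<partial>M\<bar> \<le> B"
        using norm_expectation_le[of "g' r" B] g'_bound B_nonneg by simp
      then show ?thesis using g'_bound[of r z] by (simp add: h_def)
    qed
    show "(\<integral>z. h r z \<partial>M) = 0" for r
      using g'_int[of r] by (simp add: h_def prob_space)
    show "AE z in M. \<bar>\<phi> ((T ^^ r) z) - h r z\<bar> \<le> C * \<rho> ^ r" for r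
      using g'_AE[of r]
    proof eventually_elim
      case (elim z)
      have "\<bar>\<phi> ((T ^^ r) z) - h r z\<bar> \<le> 2 * K * \<rho>2 ^ r"
        using elim mean[of r] by (simp add: h_def)
      also have "\<dots> \<le> C * \<rho> ^ r"
        using 1 2 by (intro mult_mono power_mono) (auto simp: C_def \<rho>_def)
      finally show ?case .
    qed
  qed
qed

section \<open>Covariances and second moments of Birkhoff sums\<close>

definition cov :: "nat \<Rightarrow> real" where "cov j = (\<integral>z. \<phi> z * \<phi> ((T ^^ j) z) \<partial>M)"

definition birkhoff :: "nat \<Rightarrow> 'a \<Rightarrow> real" where "birkhoff n z = (\<Sum>k<n. \<phi> ((T ^^ k) z))"

definition second_moment :: "nat \<Rightarrow> real" where "second_moment n = (\<integral>z. (birkhoff n z)\<^sup>2 \<partial>M)"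

definition variance_limit :: real where "variance_limit = cov 0 + 2 * (\<Sum>j. cov (Suc j))"

lemma \<phi>_T_bound: "z \<in> space M \<Longrightarrow> \<bar>\<phi> ((T ^^ k) z)\<bar> \<le> B"
  using \<phi>_bound T_pow_space by blast

lemma \<phi>_T_measurable [measurable]: "(\<lambda>z. \<phi> ((T ^^ k) z)) \<in> borel_measurable M"
  by measurable

lemma birkhoff_measurable [measurable]: "birkhoff n \<in> borel_measurable M"
  unfolding birkhoff_def by measurable

lemma birkhoff_bound: "z \<in> space M \<Longrightarrow> \<bar>birkhoff n z\<bar> \<le> n * B"
  unfolding birkhoff_def
  by (rule order_trans[OF sum_abs order_trans[OF sum_bounded_above[of _ _ B]]]) (auto simp: \<phi>_T_bound)

lemma integrable_\<phi>_product: "integrable M (\<lambda>z. \<phi> ((T ^^ j) z) * \<phi> ((T ^^ k) z))"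
proof (rule bounded_integrable)
  show "\<bar>\<phi> ((T ^^ j) z) * \<phi> ((T ^^ k) z)\<bar> \<le> B * B" if "z \<in> space M" for z
    unfolding abs_mult by (intro mult_mono \<phi>_T_bound that B_nonneg) auto
qed simp

lemma birkhoff_sq_integrable: "integrable M (\<lambda>z. (birkhoff n z)\<^sup>2)"
proof (rule bounded_integrable)
  show "\<bar>(birkhoff n z)\<^sup>2\<bar> \<le> (n * B)\<^sup>2" if "z \<in> space M" for z
    using power_mono[OF birkhoff_bound[OF that, of n] abs_ge_zero, of 2] by simp
qed simp

lemma cov_shift: "(\<integral>z. \<phi> ((T ^^ k) z) * \<phi> ((T ^^ (k + j)) z) \<partial>M) = cov j"
  using integral_T_pow[of "\<lambda>z. \<phi> z * \<phi> ((T ^^ j) z)" k]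
  by (simp add: cov_def funpow_add add.commute[of k])

text \<open>By invariance both factors may be shifted by r steps and then replaced by block
  functions, which are centred and decouple. Replacement costs B + 2 B times the approximation
  error; mixing costs the square of the sup bound 2 B.\<close>

lemma cov_geometric: "\<exists>C \<rho>. 0 \<le> C \<and> 0 < \<rho> \<and> \<rho> < 1 \<and> (\<forall>j. \<bar>cov j\<bar> \<le> C * \<rho> ^ j)"
proof -
  obtain C \<rho> h where C: "0 \<le> C" "0 < \<rho>" "\<rho> < 1" and mix: "\<And>L. mixing_at L (C * \<rho> ^ L)"
    and h: "\<And>r. depends {..2 * r} (h r)" "\<And>r z. \<bar>h r z\<bar> \<le> 2 * B" "\<And>r. (\<integral>z. h r z \<partial>M) = (0 :: real)"
    "\<And>r. AE z in M. \<bar>\<phi> ((T ^^ r) z) - h r z\<bar> \<le> C * \<rho> ^ r"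
    using block_approximation by blast
  have bound: "\<bar>cov j\<bar> \<le> (3 * B * C + 4 * B\<^sup>2 * C) * \<rho> ^ (j div 4)" for j
  proof -
    \<comment> \<open>The blocks use the coordinates 0, ..., 2 r and j, ..., j + 2 r. Since 3 r
      \<le> j, a gap of at least r lies between them.\<close>
    define r where "r = j div 4"
    have hm: "h r \<in> borel_measurable M" by (rule depends_measurable[OF h(1)]) simp
    have "(T ^^ r) ((T ^^ j) z) = (T ^^ (r + j)) z" for z by (simp add: funpow_add)
    then have cov: "cov j = (\<integral>z. \<phi> ((T ^^ r) z) * \<phi> ((T ^^ r) ((T ^^ j) z)) \<partial>M)"
      using cov_shift[of r j] by simp
    have "norm ((\<integral>z. \<phi> ((T ^^ r) z) * \<phi> ((T ^^ r) ((T ^^ j) z)) \<partial>M) - (\<integral>z. h r z * h r ((T ^^ j) z) \<partial>M)) \<le> 3 * B * (C * \<rho> ^ r)"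
    proof (rule expectation_diff_le)
      show "integrable M (\<lambda>z. \<phi> ((T ^^ r) z) * \<phi> ((T ^^ r) ((T ^^ j) z)))"
        using integrable_\<phi>_product[of r "r + j"] by (simp add: funpow_add)
      show "integrable M (\<lambda>z. h r z * h r ((T ^^ j) z))"
      proof (rule bounded_integrable)
        show "(\<lambda>z. h r z * h r ((T ^^ j) z)) \<in> borel_measurable M"
          using hm by measurable
        show "\<bar>h r z * h r ((T ^^ j) z)\<bar> \<le> (2 * B) * (2 * B)" for z
          unfolding abs_mult using B_nonneg by (intro mult_mono h) auto
      qed
      show "AE z in M. norm (\<phi> ((T ^^ r) z) * \<phi> ((T ^^ r) ((T ^^ j) z)) - h r z * h r ((T ^^ j) z)) \<le> 3 * B * (C * \<rho> ^ r)"
        using h(4)[of r] AE_T_pow[OF h(4)[of r], of j] AE_space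
      proof eventually_elim
        case (elim z)
        let ?a = "\<phi> ((T ^^ r) z)" and ?b = "\<phi> ((T ^^ r) ((T ^^ j) z))" and ?a' = "h r z" and ?b' = "h r ((T ^^ j) z)"
        have "?a * ?b - ?a' * ?b' = ?a * (?b - ?b') + (?a - ?a') * ?b'" by (simp add: algebra_simps)
        moreover have "\<bar>?a * (?b - ?b')\<bar> \<le> B * (C * \<rho> ^ r)"
          unfolding abs_mult using elim B_nonneg by (intro mult_mono \<phi>_T_bound) auto
        moreover have "\<bar>(?a - ?a') * ?b'\<bar> \<le> (C * \<rho> ^ r) * (2 * B)"
          unfolding abs_mult using elim C by (intro mult_mono h) auto
        moreover have "\<bar>x + y\<bar> \<le> 3 * B * (C * \<rho> ^ r)" if "\<bar>x\<bar> \<le> B * (C * \<rho> ^ r)" "\<bar>y\<bar> \<le> (C * \<rho> ^ r) * (2 * B)" for x y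
        proof -
          have "\<bar>x + y\<bar> \<le> B * (C * \<rho> ^ r) + (C * \<rho> ^ r) * (2 * B)"
            by (rule order_trans[OF abs_triangle_ineq add_mono[OF that]])
          then show ?thesis by (simp add: algebra_simps)
        qed
        ultimately show ?case by (simp only: real_norm_def)
      qed
    qed (use C B_nonneg in auto)
    moreover have "\<bar>(\<integral>z. h r z * h r ((T ^^ j) z) \<partial>M) - (\<integral>z. h r z \<partial>M) * (\<integral>z. h r ((T ^^ j) z) \<partial>M)\<bar> \<le> C * \<rho> ^ r * (2 * B) * (2 * B)"
      by (rule mixing_at_real[OF mix h(1) depends_T_pow[OF h(1)]]) (use h(2) in \<open>auto simp: r_def\<close>)
    ultimately show ?thesis
      unfolding cov[symmetric] by (simp add: h(3) r_def[symmetric] power2_eq_square algebra_simps abs_le_iff)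
  qed
  have "\<bar>cov j\<bar> \<le> (3 * B * C + 4 * B\<^sup>2 * C) * ((1 / \<rho>) * root 4 \<rho> ^ j)" for j
    by (rule order_trans[OF bound mult_left_mono[OF power_div_le_geometric(1)]]) (use C B_nonneg in auto)
  moreover have "0 < root 4 \<rho>" "root 4 \<rho> < 1" using power_div_le_geometric[of \<rho> 4] C by auto
  ultimately show ?thesis
    using C B_nonneg by (intro exI[of _ "(3 * B * C + 4 * B\<^sup>2 * C) * (1 / \<rho>)"] exI[of _ "root 4 \<rho>"]) (auto simp: mult.assoc)
qed

text \<open>Expanding the square shows that the increments of the second moment are the partial sums
  of the series for the limit variance. The growth of the second moment is controlled through these
  increments.\<close>

lemma second_moment_Suc: "second_moment (Suc n) = second_moment n + (cov 0 + 2 * (\<Sum>j<n. cov (Suc j)))"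
proof -
  have 1: "(birkhoff (Suc n) z)\<^sup>2 = (birkhoff n z)\<^sup>2 + (2 * (\<Sum>k<n. \<phi> ((T ^^ k) z) * \<phi> ((T ^^ n) z)) + \<phi> ((T ^^ n) z) * \<phi> ((T ^^ n) z))" for z
    by (simp add: birkhoff_def power2_eq_square algebra_simps sum_distrib_left)
  have "second_moment (Suc n) = second_moment n + (2 * (\<Sum>k<n. \<integral>z. \<phi> ((T ^^ k) z) * \<phi> ((T ^^ n) z) \<partial>M) + (\<integral>z. \<phi> ((T ^^ n) z) * \<phi> ((T ^^ n) z) \<partial>M))"
    unfolding second_moment_def 1
    by (simp add: birkhoff_sq_integrable integrable_\<phi>_product Bochner_Integration.integrable_sum
        Bochner_Integration.integral_add Bochner_Integration.integral_sum)
  moreover have "(\<integral>z. \<phi> ((T ^^ n) z) * \<phi> ((T ^^ n) z) \<partial>M) = cov 0"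
    using cov_shift[of n 0] by simp
  moreover have "(\<Sum>k<n. \<integral>z. \<phi> ((T ^^ k) z) * \<phi> ((T ^^ n) z) \<partial>M) = (\<Sum>k<n. cov (Suc (n - Suc k)))"
  proof (rule sum.cong[OF refl])
    fix k assume "k \<in> {..<n}"
    then show "(\<integral>z. \<phi> ((T ^^ k) z) * \<phi> ((T ^^ n) z) \<partial>M) = cov (Suc (n - Suc k))"
      using cov_shift[of k "n - k"] by (simp add: Suc_diff_Suc)
  qed
  moreover have "(\<Sum>k<n. cov (Suc (n - Suc k))) = (\<Sum>j<n. cov (Suc j))"
    by (rule sum.nat_diff_reindex)
  ultimately show ?thesis by simp
qed

lemma cov_summable: "summable (\<lambda>j. cov (Suc j))"
proof -
  obtain C \<rho> where "0 < \<rho>" "\<rho> < 1" "\<And>j. \<bar>cov j\<bar> \<le> C * \<rho> ^ j"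
    using cov_geometric by blast
  then show ?thesis using geometric_tail(1)[of cov C \<rho>] by (simp add: summable_Suc_iff)
qed

lemma increment_geometric:
  "\<exists>C \<rho>. 0 \<le> C \<and> 0 < \<rho> \<and> \<rho> < 1 \<and> (\<forall>n. \<bar>cov 0 + 2 * (\<Sum>j<n. cov (Suc j)) - variance_limit\<bar> \<le> C * \<rho> ^ n)"
proof -
  obtain C \<rho> where C: "0 \<le> C" "0 < \<rho>" "\<rho> < 1" "\<And>j. \<bar>cov j\<bar> \<le> C * \<rho> ^ j"
    using cov_geometric by blast
  have "\<bar>cov (Suc j)\<bar> \<le> (C * \<rho>) * \<rho> ^ j" for j using C(4)[of "Suc j"] by (simp add: mult_ac)
  note tail = geometric_tail(2)[OF this C(2,3)]
  have lin: "\<bar>x - y\<bar> \<le> d \<Longrightarrow> \<bar>c + 2 * x - (c + 2 * y)\<bar> \<le> 2 * d" for x y c d :: real by linarith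
  have "\<bar>cov 0 + 2 * (\<Sum>j<n. cov (Suc j)) - variance_limit\<bar> \<le> 2 * (C * \<rho> / (1 - \<rho>) * \<rho> ^ n)" for n
    unfolding variance_limit_def by (rule lin[OF tail])
  then have "\<bar>cov 0 + 2 * (\<Sum>j<n. cov (Suc j)) - variance_limit\<bar> \<le> 2 * (C * \<rho> / (1 - \<rho>)) * \<rho> ^ n" for n
    by (simp only: mult.assoc)
  then show ?thesis using C by (intro exI[where x = "2 * (C * \<rho> / (1 - \<rho>))"] exI[where x = \<rho>] conjI allI) auto
qed

lemma second_moment_sum: "second_moment n = (\<Sum>i<n. cov 0 + 2 * (\<Sum>j<i. cov (Suc j)))"
proof (induction n)
  case 0 then show ?case by (simp add: second_moment_def birkhoff_def)
qed (simp add: second_moment_Suc)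

text \<open>The increments differ from the limit variance by summable errors, so the deviation from
  linear growth is bounded and not merely o(n).\<close>

lemma second_moment_linear: "\<exists>D. \<forall>n. \<bar>second_moment n - n * variance_limit\<bar> \<le> D"
proof -
  obtain C \<rho> where C: "0 \<le> C" "0 < \<rho>" "\<rho> < 1"
    "\<And>n. \<bar>cov 0 + 2 * (\<Sum>j<n. cov (Suc j)) - variance_limit\<bar> \<le> C * \<rho> ^ n"
    using increment_geometric by blast
  have "\<bar>second_moment n - n * variance_limit\<bar> \<le> C / (1 - \<rho>)" for n
  proof -
    have "second_moment n - n * variance_limit = (\<Sum>i<n. cov 0 + 2 * (\<Sum>j<i. cov (Suc j)) - variance_limit)"
      by (simp add: second_moment_sum sum_subtractf)
    also have "\<bar>\<dots>\<bar> \<le> (\<Sum>i<n. C * \<rho> ^ i)" by (rule order_trans[OF sum_abs sum_mono[OF C(4)]])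
    also have "\<dots> \<le> C * (\<Sum>i. \<rho> ^ i)"
      unfolding sum_distrib_left[symmetric] using C
      by (intro mult_left_mono sum_le_suminf summable_geometric) auto
    also have "\<dots> = C / (1 - \<rho>)" using C by (simp add: suminf_geometric)
    finally show ?thesis .
  qed
  then show ?thesis by blast
qed

text \<open>When the limit variance is 0 the increments themselves decay geometrically, and the
  second moments are their partial sums.\<close>

lemma second_moment_converges:
  assumes "variance_limit = 0"
  shows "\<exists>v C \<rho>. 0 \<le> C \<and> 0 < \<rho> \<and> \<rho> < 1 \<and> (\<forall>n. \<bar>second_moment n - v\<bar> \<le> C * \<rho> ^ n)"
proof -
  obtain C \<rho> where C: "0 \<le> C" "0 < \<rho>" "\<rho> < 1"
    "\<And>n. \<bar>cov 0 + 2 * (\<Sum>j<n. cov (Suc j))\<bar> \<le> C * \<rho> ^ n"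
    using increment_geometric assms by auto
  from geometric_tail(2)[OF C(4,2,3)] C show ?thesis
    unfolding second_moment_sum
    by (intro exI[of _ "\<Sum>n. cov 0 + 2 * (\<Sum>j<n. cov (Suc j))"] exI[of _ "C / (1 - \<rho>)"] exI[of _ \<rho>]) auto
qed

end

section \<open>Convergence of the characteristic functions\<close>

text \<open>The radius must grow faster than \<open>ln n\<close>, to make the mixing errors \<open>n \<rho>\<^sup>r\<close> vanish, and slower than \<open>n\<^bsup>1/4\<^esup>\<close>,
  to make the Taylor remainders \<open>r\<^sup>2 / sqrt n\<close> vanish.\<close>
definition block_radius :: "nat \<Rightarrow> nat" where
  "block_radius n = nat \<lfloor>real n powr (1/8)\<rfloor>"

lemma block_radius_le: "real (block_radius n) \<le> real n powr (1/8)"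
  and block_radius_ge: "real n powr (1/8) - 1 \<le> real (block_radius n)"
proof -
  have "real (block_radius n) = of_int \<lfloor>real n powr (1/8)\<rfloor>"
    unfolding block_radius_def by (intro of_nat_nat) simp
  then show "real (block_radius n) \<le> real n powr (1/8)" "real n powr (1/8) - 1 \<le> real (block_radius n)"
    by linarith+
qed

lemma geometric_block_radius_tendsto_0:
  fixes \<rho> :: real
  assumes "0 < \<rho>" "\<rho> < 1"
  shows "(\<lambda>n. real n * \<rho> ^ block_radius n) \<longlonglongrightarrow> 0"
proof -
  define \<kappa> where "\<kappa> = - ln \<rho>"
  have \<kappa>: "\<kappa> > 0" using assms by (simp add: \<kappa>_def)
  show ?thesis
  proof (rule tendsto_sandwich[OF _ _ tendsto_const])
    show "(\<lambda>n. real n * exp (- \<kappa> * (real n powr (1/8) - 1))) \<longlonglongrightarrow> 0"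
      using \<kappa> by real_asymp
    have "\<rho> ^ block_radius n \<le> exp (- \<kappa> * (real n powr (1/8) - 1))" for n
    proof -
      have "\<rho> ^ block_radius n = exp (- \<kappa> * real (block_radius n))"
        using assms by (simp add: \<kappa>_def exp_of_nat2_mult)
      then show ?thesis using \<kappa> block_radius_ge[of n] by simp
    qed
    then show "\<forall>\<^sub>F n in sequentially. real n * \<rho> ^ block_radius n \<le> real n * exp (- \<kappa> * (real n powr (1/8) - 1))"
      by (intro always_eventually allI mult_left_mono) auto
  qed (use assms in \<open>auto intro!: always_eventually\<close>)
qed

lemma block_length_tendsto_0:
  "(\<lambda>n. (real (12 * block_radius n + 1))\<^sup>2 / sqrt (real n)) \<longlonglongrightarrow> 0"
proof (rule tendsto_sandwich[OF _ _ tendsto_const])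
  show "(\<lambda>n. (12 * real n powr (1/8) + 1)\<^sup>2 / sqrt (real n)) \<longlonglongrightarrow> 0"
    by real_asymp
  have "(real (12 * block_radius n + 1))\<^sup>2 \<le> (12 * real n powr (1/8) + 1)\<^sup>2" for n
    using block_radius_le[of n] by (intro power_mono) auto
  then show "\<forall>\<^sub>F n in sequentially. (real (12 * block_radius n + 1))\<^sup>2 / sqrt (real n) \<le> (12 * real n powr (1/8) + 1)\<^sup>2 / sqrt (real n)"
    by (intro always_eventually allI divide_right_mono) auto
qed (auto intro!: always_eventually)

context markov_approximable
begin

text \<open>The normalised sum has the same law as its composition with T^r, which is almost
  everywhere close to the block sum \<open>Z n\<close>. It remains to compare \<open>Z n\<close>
  with the Gaussian of variance E((Z n)^2) and to let this variance converge.\<close>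

lemma birkhoff_char_tendsto:
  "(\<lambda>n. \<integral>z. iexp (t * (birkhoff n z / sqrt (real n))) \<partial>M) \<longlonglongrightarrow> of_real (exp (- variance_limit * t\<^sup>2 / 2))"
proof -
  obtain C \<rho> h where C: "0 \<le> C" "0 < \<rho>" "\<rho> < 1" and mix: "\<And>L. mixing_at L (C * \<rho> ^ L)"
    and h: "\<And>r. depends {..2 * r} (h r)" "\<And>r z. \<bar>h r z\<bar> \<le> 2 * B" "\<And>r. (\<integral>z. h r z \<partial>M) = (0 :: real)"
    "\<And>r. AE z in M. \<bar>\<phi> ((T ^^ r) z) - h r z\<bar> \<le> C * \<rho> ^ r"
    using block_approximation by blast
  define r where "r = block_radius"
  define a where "a n = 1 / sqrt (real n)" for n
  define \<delta> where "\<delta> n = C * \<rho> ^ r n" for n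
  define m where "m n = real (12 * r n + 1)" for n
  define Z where "Z n z = a n * (\<Sum>k<n. h (r n) ((T ^^ k) z))" for n z
  have a: "0 \<le> a n" for n by (simp add: a_def)
  have an: "a n * (real n * x) = sqrt (real n) * x" for n x
  proof -
    have "a n * (real n * x) = (real n / sqrt (real n)) * x" by (simp add: a_def)
    also have "\<dots> = sqrt (real n) * x" by (simp only: real_div_sqrt of_nat_0_le_iff)
    finally show ?thesis .
  qed
  have \<delta>: "0 \<le> \<delta> n" for n using C by (simp add: \<delta>_def)
  have hm [measurable]: "h r \<in> borel_measurable M" for r by (rule depends_measurable[OF h(1)]) simp
  have Zm [measurable]: "Z n \<in> borel_measurable M" for n unfolding Z_def by measurable

  have lim1: "(\<lambda>n. real n * \<delta> n) \<longlonglongrightarrow> 0"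
    using tendsto_mult_right_zero[OF geometric_block_radius_tendsto_0[OF C(2,3)], of C]
    by (simp add: \<delta>_def r_def mult_ac)
  have lim2: "(\<lambda>n. (m n)\<^sup>2 * a n) \<longlonglongrightarrow> 0"
    using block_length_tendsto_0 by (simp add: m_def r_def a_def)
  have lim3: "(\<lambda>n. sqrt (real n) * \<delta> n) \<longlonglongrightarrow> 0"
  proof (rule tendsto_sandwich[OF _ _ tendsto_const lim1])
    have "sqrt (real n) \<le> real n" for n
      by (cases "n = 0") (auto intro!: real_le_lsqrt simp: power2_eq_square)
    then show "\<forall>\<^sub>F n in sequentially. sqrt (real n) * \<delta> n \<le> real n * \<delta> n"
      using \<delta> by (intro always_eventually allI mult_right_mono)
  qed (use \<delta> in \<open>auto intro!: always_eventually\<close>)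
  have lim4: "(\<lambda>n. m n * \<delta> n) \<longlonglongrightarrow> 0"
  proof (rule tendsto_sandwich[OF _ _ tendsto_const tendsto_mult_zero[OF lim2 lim3]])
    \<comment> \<open>Here \<open>m n \<le> (m n)\<^sup>2\<close> and
      \<open>a n * sqrt n = 1\<close>, so a product of two known null sequences dominates.\<close>
    have "m n * \<delta> n \<le> ((m n)\<^sup>2 * a n) * (sqrt (real n) * \<delta> n)" if "n > 0" for n
    proof -
      have "m n * 1 \<le> m n * m n" by (rule mult_left_mono) (auto simp: m_def)
      from mult_right_mono[OF this \<delta>[of n]] show ?thesis
        using that by (simp add: a_def power2_eq_square)
    qed
    then show "\<forall>\<^sub>F n in sequentially. m n * \<delta> n \<le> ((m n)\<^sup>2 * a n) * (sqrt (real n) * \<delta> n)"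
      by (intro eventually_sequentiallyI[of 1]) auto
  qed (use \<delta> in \<open>auto intro!: always_eventually simp: m_def\<close>)

  have gauss: "(\<lambda>n. (\<integral>z. iexp (t * Z n z) \<partial>M) - of_real (exp (- (\<integral>z. (Z n z)\<^sup>2 \<partial>M) * t\<^sup>2 / 2))) \<longlonglongrightarrow> 0"
  proof (rule tendsto_0_le[where K = 1])
    \<comment> \<open>The error of \<open>char_gaussian_bound\<close> with 2 B in place of B. The
      factor a n * n = sqrt n cancels one further a n, and what is left are the null sequences
      above.\<close>
    let ?e = "\<lambda>n. \<bar>t\<bar> * (6 * B * (sqrt (real n) * \<delta> n) + 16 * B\<^sup>2 * \<bar>t\<bar> * (m n * \<delta> n) + 8 * B ^ 3 * t\<^sup>2 * ((m n)\<^sup>2 * a n)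
        + 4 * B\<^sup>2 * \<bar>t\<bar> * (real n * \<delta> n) + 4 * B ^ 3 * t\<^sup>2 * ((m n)\<^sup>2 * a n))"
    have "?e \<longlonglongrightarrow> \<bar>t\<bar> * (6 * B * 0 + 16 * B\<^sup>2 * \<bar>t\<bar> * 0 + 8 * B ^ 3 * t\<^sup>2 * 0 + 4 * B\<^sup>2 * \<bar>t\<bar> * 0 + 4 * B ^ 3 * t\<^sup>2 * 0)"
      by (intro tendsto_intros lim1 lim2 lim3 lim4)
    then show "?e \<longlonglongrightarrow> 0" by simp
    have "cmod ((\<integral>z. iexp (t * Z n z) \<partial>M) - of_real (exp (- (\<integral>z. (Z n z)\<^sup>2 \<partial>M) * t\<^sup>2 / 2))) \<le> ?e n" if n: "n > 0" for n
    proof -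
      have "cmod ((\<integral>z. iexp (t * Z n z) \<partial>M) - of_real (exp (- (\<integral>z. (Z n z)\<^sup>2 \<partial>M) * t\<^sup>2 / 2)))
        \<le> \<bar>t\<bar> * (a n * n * (3 * \<delta> n * (2 * B) + \<bar>t\<bar> * a n * (m n * (4 * \<delta> n * (2 * B)\<^sup>2 + (2 * B)\<^sup>2 * (\<bar>t\<bar> * (a n * m n * (2 * B)))) + n * \<delta> n * (2 * B)\<^sup>2)
          + (2 * B) * (\<bar>t\<bar> * (a n * m n * (2 * B)))\<^sup>2 / 2))"
        unfolding Z_def m_def
      proof (rule char_gaussian_bound)
        show "mixing_at (r n) (\<delta> n)" unfolding \<delta>_def by (rule mix)
        show "depends {k..k + 2 * r n} (\<lambda>z. h (r n) ((T ^^ k) z))" for k by (rule depends_T_pow[OF h(1)])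
        show "(\<integral>z. h (r n) ((T ^^ k) z) \<partial>M) = 0" for k using integral_T_pow[OF hm, of "r n" k] h(3) by simp
      qed (use h(2) a B_nonneg in auto)
      also have "\<dots> = ?e n"
      proof -
        have an: "a n * n = sqrt (real n)" "sqrt (real n) * a n = 1"
          using n by (auto simp: a_def real_div_sqrt)
        have "\<bar>t\<bar> * (s * (3 * d * (2 * B) + \<bar>t\<bar> * x * (w * (4 * d * (2 * B)\<^sup>2 + (2 * B)\<^sup>2 * (\<bar>t\<bar> * (x * w * (2 * B)))) + N * d * (2 * B)\<^sup>2)
          + (2 * B) * (\<bar>t\<bar> * (x * w * (2 * B)))\<^sup>2 / 2))
          = \<bar>t\<bar> * (6 * B * (s * d) + 16 * B\<^sup>2 * \<bar>t\<bar> * (w * d) + 8 * B ^ 3 * t\<^sup>2 * (w\<^sup>2 * x)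
        + 4 * B\<^sup>2 * \<bar>t\<bar> * (N * d) + 4 * B ^ 3 * t\<^sup>2 * (w\<^sup>2 * x))" if sx: "s * x = 1" for s x d w N :: real
        proof -
          have "s * (3 * d * (2 * B) + \<bar>t\<bar> * x * (w * (4 * d * (2 * B)\<^sup>2 + (2 * B)\<^sup>2 * (\<bar>t\<bar> * (x * w * (2 * B)))) + N * d * (2 * B)\<^sup>2)
          + (2 * B) * (\<bar>t\<bar> * (x * w * (2 * B)))\<^sup>2 / 2)
            = 6 * B * (s * d) + (s * x) * (16 * B\<^sup>2 * \<bar>t\<bar> * (w * d) + 8 * B ^ 3 * \<bar>t\<bar>\<^sup>2 * (w\<^sup>2 * x) + 4 * B\<^sup>2 * \<bar>t\<bar> * (N * d) + 4 * B ^ 3 * \<bar>t\<bar>\<^sup>2 * (w\<^sup>2 * x))"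
            by (simp add: power2_eq_square power3_eq_cube algebra_simps)
          then show ?thesis using sx by simp
        qed
        from this[OF an(2)] show ?thesis unfolding an(1) .
      qed
      finally show ?thesis .
    qed
    then show "\<forall>\<^sub>F n in sequentially. norm ((\<integral>z. iexp (t * Z n z) \<partial>M) - of_real (exp (- (\<integral>z. (Z n z)\<^sup>2 \<partial>M) * t\<^sup>2 / 2))) \<le> norm (?e n) * 1"
      by (intro eventually_sequentiallyI[of 1]) (fastforce intro: order_trans[OF _ abs_ge_self])
  qed

  \<comment> \<open>Each of the n summands is off by at most \<delta> n, and the normalisation
    divides by sqrt n.\<close>
  have close: "AE z in M. \<bar>birkhoff n ((T ^^ r n) z) / sqrt (real n) - Z n z\<bar> \<le> sqrt (real n) * \<delta> n" for n
  proof -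
    have "AE z in M. \<forall>k\<in>{..<n}. \<bar>\<phi> ((T ^^ r n) ((T ^^ k) z)) - h (r n) ((T ^^ k) z)\<bar> \<le> \<delta> n"
      unfolding \<delta>_def by (intro AE_finite_allI AE_T_pow[OF h(4)]) simp
    then show ?thesis
    proof eventually_elim
      case (elim z)
      have "(T ^^ k) ((T ^^ r n) z) = (T ^^ r n) ((T ^^ k) z)" for k
        by (simp only: funpow_add[unfolded fun_eq_iff o_apply, rule_format, symmetric] add.commute)
      then have "birkhoff n ((T ^^ r n) z) / sqrt (real n) - Z n z
          = a n * (\<Sum>k<n. \<phi> ((T ^^ r n) ((T ^^ k) z)) - h (r n) ((T ^^ k) z))"
        by (simp add: birkhoff_def Z_def a_def sum_subtractf right_diff_distrib)
      also have "\<bar>\<dots>\<bar> \<le> a n * (\<Sum>k<n. \<delta> n)"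
        unfolding abs_mult using a elim by (intro mult_mono order_trans[OF sum_abs] sum_mono) auto
      also have "\<dots> = sqrt (real n) * \<delta> n" by (simp add: an)
      finally show ?case .
    qed
  qed
  have Sb: "\<bar>birkhoff n z / sqrt (real n)\<bar> \<le> sqrt (real n) * B" if "z \<in> space M" for n z
  proof -
    have "\<bar>birkhoff n z / sqrt (real n)\<bar> = a n * \<bar>birkhoff n z\<bar>" by (simp add: a_def abs_divide)
    also have "\<dots> \<le> a n * (n * B)" by (intro mult_left_mono birkhoff_bound that a)
    finally show ?thesis by (simp only: an)
  qed
  have Zb: "\<bar>Z n z\<bar> \<le> sqrt (real n) * (2 * B)" for n z
  proof -
    have "\<bar>Z n z\<bar> \<le> a n * (\<Sum>k<n. 2 * B)"
      unfolding Z_def abs_mult using a h(2) by (intro mult_mono order_trans[OF sum_abs] sum_mono) auto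
    also have "\<dots> = sqrt (real n) * (2 * B)" by (simp only: sum_constant card_lessThan an)
    finally show ?thesis .
  qed

  have char_close: "(\<lambda>n. (\<integral>z. iexp (t * (birkhoff n z / sqrt (real n))) \<partial>M) - (\<integral>z. iexp (t * Z n z) \<partial>M)) \<longlonglongrightarrow> 0"
  proof (rule tendsto_0_le[where K = 1])
    show "(\<lambda>n. \<bar>t\<bar> * (sqrt (real n) * \<delta> n)) \<longlonglongrightarrow> 0"
      using tendsto_mult_right_zero[OF lim3] by simp
    have "cmod ((\<integral>z. iexp (t * (birkhoff n z / sqrt (real n))) \<partial>M) - (\<integral>z. iexp (t * Z n z) \<partial>M)) \<le> \<bar>t\<bar> * (sqrt (real n) * \<delta> n)" for n
    proof -
      \<comment> \<open>Invariance inserts the r iterations after which the summands become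
        functions of blocks.\<close>
      have inv: "(\<integral>z. iexp (t * (birkhoff n ((T ^^ r n) z) / sqrt (real n))) \<partial>M) = (\<integral>z. iexp (t * (birkhoff n z / sqrt (real n))) \<partial>M)"
        by (rule integral_T_pow) measurable
      show ?thesis unfolding inv[symmetric]
      proof (rule expectation_diff_le)
        show "AE z in M. cmod (iexp (t * (birkhoff n ((T ^^ r n) z) / sqrt (real n))) - iexp (t * Z n z)) \<le> \<bar>t\<bar> * (sqrt (real n) * \<delta> n)"
          using close[of n]
        proof eventually_elim
          case (elim z)
          have "\<bar>t * (birkhoff n ((T ^^ r n) z) / sqrt (real n)) - t * Z n z\<bar> \<le> \<bar>t\<bar> * (sqrt (real n) * \<delta> n)"
            unfolding right_diff_distrib[symmetric] abs_mult by (intro mult_left_mono elim) auto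
          then show ?case by (rule order_trans[OF cmod_iexp_diff_le])
        qed
      qed (use \<delta> in \<open>auto intro!: integrable_const_bound[of _ 1]\<close>)
    qed
    then show "\<forall>\<^sub>F n in sequentially. norm ((\<integral>z. iexp (t * (birkhoff n z / sqrt (real n))) \<partial>M) - (\<integral>z. iexp (t * Z n z) \<partial>M)) \<le> norm (\<bar>t\<bar> * (sqrt (real n) * \<delta> n)) * 1"
      using \<delta> by (intro always_eventually allI) simp
  qed

  \<comment> \<open>A difference of squares: one factor is at most sqrt n * \<delta> n, the other
    only at most 3 B sqrt n, so the error is of order n * \<delta> n.\<close>
  have var_close: "(\<lambda>n. second_moment n / n - (\<integral>z. (Z n z)\<^sup>2 \<partial>M)) \<longlonglongrightarrow> 0"
  proof (rule tendsto_0_le[where K = 1])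
    show "(\<lambda>n. 3 * B * (real n * \<delta> n)) \<longlonglongrightarrow> 0"
      using tendsto_mult_right_zero[OF lim1] by simp
    have "\<bar>second_moment n / n - (\<integral>z. (Z n z)\<^sup>2 \<partial>M)\<bar> \<le> 3 * B * (real n * \<delta> n)" for n
    proof -
      have "(\<integral>z. (birkhoff n ((T ^^ r n) z) / sqrt (real n))\<^sup>2 \<partial>M) = (\<integral>z. (birkhoff n z / sqrt (real n))\<^sup>2 \<partial>M)"
        by (rule integral_T_pow) measurable
      also have "\<dots> = second_moment n / n" by (simp add: second_moment_def power_divide)
      finally have inv: "second_moment n / n = (\<integral>z. (birkhoff n ((T ^^ r n) z) / sqrt (real n))\<^sup>2 \<partial>M)" ..
      have "norm ((\<integral>z. (birkhoff n ((T ^^ r n) z) / sqrt (real n))\<^sup>2 \<partial>M) - (\<integral>z. (Z n z)\<^sup>2 \<partial>M)) \<le> 3 * B * (real n * \<delta> n)"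
      proof (rule expectation_diff_le)
        show "integrable M (\<lambda>z. (birkhoff n ((T ^^ r n) z) / sqrt (real n))\<^sup>2)"
          by (rule bounded_integrable[of _ "(sqrt (real n) * B)\<^sup>2"])
             (use Sb T_pow_space in \<open>auto simp del: power_divide intro!: abs_le_square_iff[THEN iffD1] intro: order_trans[OF _ abs_ge_self]\<close>)
        show "integrable M (\<lambda>z. (Z n z)\<^sup>2)"
          by (rule bounded_integrable[of _ "(sqrt (real n) * (2 * B))\<^sup>2"])
             (use Zb in \<open>auto intro!: abs_le_square_iff[THEN iffD1] intro: order_trans[OF _ abs_ge_self]\<close>)
        show "AE z in M. norm ((birkhoff n ((T ^^ r n) z) / sqrt (real n))\<^sup>2 - (Z n z)\<^sup>2) \<le> 3 * B * (real n * \<delta> n)"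
          using close[of n] AE_space
        proof eventually_elim
          case (elim z)
          let ?x = "birkhoff n ((T ^^ r n) z) / sqrt (real n)" and ?y = "Z n z"
          have sum: "\<bar>?x + ?y\<bar> \<le> sqrt (real n) * B + sqrt (real n) * (2 * B)"
            by (rule order_trans[OF abs_triangle_ineq add_mono[OF Sb[OF T_pow_space[OF elim(2)]] Zb]])
          have "norm (?x\<^sup>2 - ?y\<^sup>2) = \<bar>?x - ?y\<bar> * \<bar>?x + ?y\<bar>"
            unfolding real_norm_def abs_mult[symmetric] by (simp only: power2_eq_square square_diff_square_factored mult.commute)
          also have "\<dots> \<le> (sqrt (real n) * \<delta> n) * (sqrt (real n) * B + sqrt (real n) * (2 * B))"
            using \<delta> by (intro mult_mono elim sum) auto
          also have "\<dots> = (sqrt (real n) * sqrt (real n)) * (3 * B * \<delta> n)" by (simp only: algebra_simps)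
          finally show ?case by (simp add: mult_ac)
        qed
      qed (use \<delta> B_nonneg in auto)
      then show ?thesis unfolding inv by simp
    qed
    then show "\<forall>\<^sub>F n in sequentially. norm (second_moment n / n - (\<integral>z. (Z n z)\<^sup>2 \<partial>M)) \<le> norm (3 * B * (real n * \<delta> n)) * 1"
      using \<delta> B_nonneg by (intro always_eventually allI) simp
  qed

  have var_lim: "(\<lambda>n. second_moment n / n) \<longlonglongrightarrow> variance_limit"
  proof -
    obtain D where D: "\<And>n. \<bar>second_moment n - n * variance_limit\<bar> \<le> D" using second_moment_linear by blast
    have "(\<lambda>n. second_moment n / n - variance_limit) \<longlonglongrightarrow> 0"
    proof (rule tendsto_0_le[where K = 1])
      show "(\<lambda>n. D / real n) \<longlonglongrightarrow> 0" by (rule lim_const_over_n)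
      have "\<bar>second_moment n / n - variance_limit\<bar> \<le> \<bar>D / real n\<bar>" if "n > 0" for n
      proof -
        have "second_moment n / n - variance_limit = (second_moment n - n * variance_limit) / n"
          using that by (simp add: diff_divide_distrib)
        then show ?thesis using D[of n] that by (simp add: divide_right_mono)
      qed
      then show "\<forall>\<^sub>F n in sequentially. norm (second_moment n / n - variance_limit) \<le> norm (D / real n) * 1"
        by (intro eventually_sequentiallyI[of 1]) auto
    qed
    then show ?thesis by (simp add: LIM_zero_iff)
  qed
  have "(\<lambda>n. \<integral>z. (Z n z)\<^sup>2 \<partial>M) \<longlonglongrightarrow> variance_limit"
    using tendsto_diff[OF var_lim var_close] by simp
  then have "(\<lambda>n. of_real (exp (- (\<integral>z. (Z n z)\<^sup>2 \<partial>M) * t\<^sup>2 / 2)) :: complex) \<longlonglongrightarrow> of_real (exp (- variance_limit * t\<^sup>2 / 2))"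
    by (intro tendsto_intros) auto
  from tendsto_add[OF tendsto_add[OF char_close gauss] this] show ?thesis by simp
qed

end

section \<open>Vanishing variance and coboundaries\<close>

text \<open>Stands in for completeness of the space of square integrable functions and also yields
  pointwise limits: the expectations of the absolute values form a convergent series, so the series
  of absolute values is finite almost everywhere.\<close>

lemma (in prob_space) AE_summable_of_geometric_L2:
  fixes f :: "nat \<Rightarrow> 'a \<Rightarrow> real"
  assumes [measurable]: "\<And>k. f k \<in> borel_measurable M"
    and int: "\<And>k. integrable M (\<lambda>z. (f k z)\<^sup>2)" and bound: "\<And>k. (\<integral>z. (f k z)\<^sup>2 \<partial>M) \<le> K * (1/2) ^ k"
  shows "AE z in M. summable (\<lambda>k. f k z)"
proof -
  have K: "0 \<le> K" using order_trans[OF _ bound[of 0]] by simp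
  have "(\<integral>\<^sup>+z. (\<Sum>k. ennreal \<bar>f k z\<bar>) \<partial>M) = (\<Sum>k. \<integral>\<^sup>+z. ennreal \<bar>f k z\<bar> \<partial>M)"
    by (rule nn_integral_suminf) measurable
  also have "\<dots> \<le> (\<Sum>k. ennreal ((K + 1) / 2 * (3/4) ^ k))"
  proof (rule suminf_le)
    fix k
    \<comment> \<open>The weight in \<open>\<bar>f\<bar> \<le> f\<^sup>2 / (2 * c) + c / 2\<close>.
      A ratio strictly between 1/2 and 1 makes both terms summable, here with ratios 2/3 and
      3/4.\<close>
    define c :: real where "c = (3/4) ^ k"
    have c: "0 < c" by (simp add: c_def)
    have "(\<integral>\<^sup>+z. ennreal \<bar>f k z\<bar> \<partial>M) \<le> (\<integral>\<^sup>+z. ennreal ((f k z)\<^sup>2 / (2 * c) + c / 2) \<partial>M)"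
    proof (rule nn_integral_mono, rule ennreal_leI)
      fix z
      have "0 \<le> (\<bar>f k z\<bar> - c)\<^sup>2" by simp
      also have "\<dots> = (f k z)\<^sup>2 + c * c - 2 * c * \<bar>f k z\<bar>" by (simp add: power2_eq_square algebra_simps)
      finally have "2 * c * \<bar>f k z\<bar> \<le> (f k z)\<^sup>2 + c * c" by simp
      then show "\<bar>f k z\<bar> \<le> (f k z)\<^sup>2 / (2 * c) + c / 2" using c by (simp add: field_simps)
    qed
    also have "\<dots> = ennreal (\<integral>z. (f k z)\<^sup>2 / (2 * c) + c / 2 \<partial>M)"
      using int[of k] c by (intro nn_integral_eq_integral) auto
    also have "\<dots> \<le> ennreal ((K + 1) / 2 * (3/4) ^ k)"
    proof (rule ennreal_leI)
      have "(\<integral>z. (f k z)\<^sup>2 / (2 * c) + c / 2 \<partial>M) = (\<integral>z. (f k z)\<^sup>2 \<partial>M) / (2 * c) + c / 2"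
        using int[of k] by (simp add: prob_space)
      also have "\<dots> \<le> (K * (1/2) ^ k) / (2 * c) + c / 2"
        using bound[of k] c by (intro add_mono divide_right_mono) auto
      also have "(K * (1/2) ^ k) / (2 * c) = K / 2 * (2/3) ^ k"
        by (simp add: c_def power_divide field_simps flip: power_mult_distrib)
      also have "\<dots> \<le> K / 2 * c" unfolding c_def using K by (intro mult_left_mono power_mono) auto
      finally show "(\<integral>z. (f k z)\<^sup>2 / (2 * c) + c / 2 \<partial>M) \<le> (K + 1) / 2 * (3/4) ^ k"
        by (simp add: c_def algebra_simps)
    qed
    finally show "(\<integral>\<^sup>+z. ennreal \<bar>f k z\<bar> \<partial>M) \<le> ennreal ((K + 1) / 2 * (3/4) ^ k)" .
  qed auto
  also have "\<dots> = ennreal (\<Sum>k. (K + 1) / 2 * (3/4) ^ k)"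
    using K by (intro suminf_ennreal2 summable_mult summable_geometric) auto
  finally have "(\<integral>\<^sup>+z. (\<Sum>k. ennreal \<bar>f k z\<bar>) \<partial>M) \<noteq> \<infinity>" by (auto simp: top_unique)
  then have "AE z in M. (\<Sum>k. ennreal \<bar>f k z\<bar>) \<noteq> \<infinity>"
    by (intro nn_integral_PInf_AE) measurable
  then show ?thesis
  proof eventually_elim
    case (elim z)
    then have "summable (\<lambda>k. \<bar>f k z\<bar>)" by (intro summable_suminf_not_top) auto
    then show ?case by (rule summable_rabs_cancel)
  qed
qed

text \<open>Every distance from \<open>n\<close> is attained at most once on each side.\<close>

lemma sum_distance_le:
  fixes f :: "nat \<Rightarrow> real"
  assumes "\<And>d. 0 \<le> f d" "n < N"
  shows "(\<Sum>m<N. f (if m \<le> n then n - m else m - n)) \<le> 2 * (\<Sum>d<N. f d)"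
proof -
  have "(\<Sum>m<N. f (if m \<le> n then n - m else m - n))
      = (\<Sum>m\<in>{..n}. f (if m \<le> n then n - m else m - n)) + (\<Sum>m\<in>{n<..<N}. f (if m \<le> n then n - m else m - n))"
    by (subst sum.union_disjoint[symmetric]) (use assms(2) in \<open>auto intro!: sum.cong\<close>)
  also have "(\<Sum>m\<in>{..n}. f (if m \<le> n then n - m else m - n)) = sum f ((\<lambda>m. n - m) ` {..n})"
    by (subst sum.reindex) (auto simp: inj_on_def)
  also have "\<dots> \<le> (\<Sum>d<N. f d)" using assms by (intro sum_mono2) auto
  also have "(\<Sum>m\<in>{n<..<N}. f (if m \<le> n then n - m else m - n)) = sum f ((\<lambda>m. m - n) ` {n<..<N})"
    by (subst sum.reindex) (auto simp: inj_on_def)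
  also have "\<dots> \<le> (\<Sum>d<N. f d)" using assms by (intro sum_mono2) auto
  finally show ?thesis by simp
qed

context markov_approximable
begin

lemma birkhoff_add: "birkhoff (m + n) z = birkhoff m z + birkhoff n ((T ^^ m) z)"
proof (induction n)
  case (Suc n)
  have "(T ^^ (m + n)) z = (T ^^ n) ((T ^^ m) z)"
    by (simp only: add.commute[of m] funpow_add o_apply)
  with Suc show ?case by (simp add: birkhoff_def)
qed (simp add: birkhoff_def)

lemma birkhoff_T_bound: "z \<in> space M \<Longrightarrow> \<bar>birkhoff n ((T ^^ k) z)\<bar> \<le> n * B"
  using birkhoff_bound T_pow_space by blast

lemma second_moment_T: "(\<integral>z. (birkhoff n ((T ^^ k) z))\<^sup>2 \<partial>M) = second_moment n"
  unfolding second_moment_def by (rule integral_T_pow) measurable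

lemma integrable_birkhoff_product:
  "integrable M (\<lambda>z. birkhoff n ((T ^^ j) z) * birkhoff m ((T ^^ k) z))"
proof (rule bounded_integrable)
  show "\<bar>birkhoff n ((T ^^ j) z) * birkhoff m ((T ^^ k) z)\<bar> \<le> (n * B) * (m * B)" if "z \<in> space M" for z
    unfolding abs_mult by (intro mult_mono birkhoff_T_bound that) (auto simp: B_nonneg)
qed measurable

text \<open>Polarisation: with \<open>a = S\<^sub>d\<close>, \<open>b = S\<^sub>N\<^sub>-\<^sub>d \<circ> T\<^sup>d\<close>, \<open>c = S\<^sub>d \<circ> T\<^sup>N\<close> this is
  \<open>2 (a + b) (b + c) = (a + b + c)\<^sup>2 + b\<^sup>2 - a\<^sup>2 - c\<^sup>2\<close>.\<close>
lemma birkhoff_correlation: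
  assumes "d \<le> N"
  shows "(\<integral>z. birkhoff N ((T ^^ j) z) * birkhoff N ((T ^^ (j + d)) z) \<partial>M)
    = (second_moment (N + d) + second_moment (N - d) - 2 * second_moment d) / 2"
proof -
  have i: "integrable M (\<lambda>z. (birkhoff n ((T ^^ k) z))\<^sup>2)" for n k
    using integrable_birkhoff_product[of n k n k] by (simp add: power2_eq_square)
  have "birkhoff N z * birkhoff N ((T ^^ d) z) 
     = ((birkhoff (N + d) ((T ^^ 0) z))\<^sup>2 + (birkhoff (N - d) ((T ^^ d) z))\<^sup>2 - (birkhoff d ((T ^^ 0) z))\<^sup>2 - (birkhoff d ((T ^^ N) z))\<^sup>2) / 2" for z
  proof -
    have "(T ^^ (N - d)) ((T ^^ d) z) = (T ^^ N) z"
      using assms by (simp add: funpow_add[symmetric, unfolded o_def fun_eq_iff, rule_format])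
    then have "birkhoff N ((T ^^ d) z) = birkhoff (N - d) ((T ^^ d) z) + birkhoff d ((T ^^ N) z)"
      using birkhoff_add[of "N - d" d "(T ^^ d) z"] assms by simp
    moreover have "birkhoff N z = birkhoff d z + birkhoff (N - d) ((T ^^ d) z)"
      using birkhoff_add[of d "N - d" z] assms by simp
    moreover have "birkhoff (N + d) z = birkhoff N z + birkhoff d ((T ^^ N) z)"
      by (rule birkhoff_add)
    ultimately show ?thesis by (simp add: power2_eq_square algebra_simps)
  qed
  then have "(\<integral>z. birkhoff N z * birkhoff N ((T ^^ d) z) \<partial>M) 
    = (second_moment (N + d) + second_moment (N - d) - second_moment d - second_moment d) / 2"
    using i by (simp only: Bochner_Integration.integral_diff Bochner_Integration.integral_add Bochner_Integration.integral_divide_zero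
        Bochner_Integration.integrable_add Bochner_Integration.integrable_diff second_moment_T)
  moreover have "(\<integral>z. birkhoff N ((T ^^ j) z) * birkhoff N ((T ^^ d) ((T ^^ j) z)) \<partial>M) = (\<integral>z. birkhoff N z * birkhoff N ((T ^^ d) z) \<partial>M)"
    by (rule integral_T_pow) measurable
  ultimately show ?thesis by (simp add: funpow_add add.commute[of j])
qed

text \<open>If the limit variance vanishes, \<open>\<integral> S\<^sub>n\<^sup>2\<close> converges exponentially fast, which makes the Cesaro means of
  \<open>S\<^sub>0, S\<^sub>1, \<dots>\<close> along \<open>N = 2\<^sup>k\<close> a Cauchy sequence in \<open>L\<^sup>2\<close>; its limit is \<open>-u\<close>.\<close>
lemma variance_limit_zero_imp_coboundary:
  assumes "variance_limit = 0"
  shows "L2_coboundary M T \<phi>"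
proof -
  obtain v C \<rho> where C: "0 \<le> C" "0 < \<rho>" "\<rho> < 1" and sm: "\<And>n. \<bar>second_moment n - v\<bar> \<le> C * \<rho> ^ n"
    using second_moment_converges[OF assms] by blast
  define avg where "avg N z = (\<Sum>n<N. birkhoff n z) / real N" for N z
  define D where "D k z = avg (2 ^ Suc k) z - avg (2 ^ k) z" for k z
  have avg_m [measurable]: "avg N \<in> borel_measurable M" for N unfolding avg_def by measurable
  have D_m [measurable]: "D k \<in> borel_measurable M" for k unfolding D_def by measurable
  define W where "W N z = (\<Sum>n<N. birkhoff N ((T ^^ n) z))" for N z
  define g where "g N d = (second_moment (N + d) + second_moment (N - d) - 2 * second_moment d) / 2" for N d
  have corr: "(\<integral>z. birkhoff N ((T ^^ n) z) * birkhoff N ((T ^^ m) z) \<partial>M) = g N (if m \<le> n then n - m else m - n)"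
    if "n < N" "m < N" for n m N
  proof (cases "m \<le> n")
    case True
    then show ?thesis using birkhoff_correlation[of "n - m" N m] that by (simp add: g_def mult.commute)
  next
    case False
    then show ?thesis using birkhoff_correlation[of "m - n" N n] that by (simp add: g_def)
  qed
  define K where "K = 4 * (C / (1 - \<rho>))"
  \<comment> \<open>Linear in \<open>N\<close>, where boundedness of the second moments alone would
    give \<open>N\<^sup>2\<close>. This saving makes the increments \<open>D k\<close> of the
    averages decay geometrically in mean square.\<close>
  have W_sq: "(\<integral>z. (W N z)\<^sup>2 \<partial>M) \<le> N * K" for N
  proof -
    have "(\<integral>z. (W N z)\<^sup>2 \<partial>M) = (\<Sum>n<N. \<Sum>m<N. \<integral>z. birkhoff N ((T ^^ n) z) * birkhoff N ((T ^^ m) z) \<partial>M)"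
      unfolding W_def power2_eq_square sum_product
      by (simp add: integrable_birkhoff_product Bochner_Integration.integral_sum Bochner_Integration.integrable_sum)
    also have "\<dots> = (\<Sum>n<N. \<Sum>m<N. g N (if m \<le> n then n - m else m - n))"
      by (intro sum.cong refl corr) auto
    also have "\<dots> \<le> (\<Sum>n<N. \<Sum>m<N. \<bar>g N (if m \<le> n then n - m else m - n)\<bar>)"
      by (intro sum_mono) auto
    also have "\<dots> \<le> (\<Sum>n<N. 2 * (\<Sum>d<N. \<bar>g N d\<bar>))"
      by (intro sum_mono sum_distance_le) auto
    also have "\<dots> \<le> (\<Sum>n<N. 2 * (2 * (C / (1 - \<rho>))))"
    proof (intro sum_mono mult_left_mono)
      have geom: "(\<Sum>d<N. \<rho> ^ d) \<le> 1 / (1 - \<rho>)"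
        using sum_le_suminf[of "\<lambda>d. \<rho> ^ d" "{..<N}"] C by (simp add: summable_geometric suminf_geometric)
      \<comment> \<open>The coefficients 1, 1 and -2 of the three second moments add up to 0, so
        their common limit \<open>v\<close> cancels. The exponent \<open>N - Suc d\<close> in place
        of \<open>N - d\<close> lets the second sum be reversed into the first.\<close>
      have "\<bar>g N d\<bar> \<le> C * (3 / 2 * \<rho> ^ d + 1 / 2 * \<rho> ^ (N - Suc d))" if "d \<in> {..<N}" for d
      proof -
        have "\<rho> ^ (N + d) \<le> \<rho> ^ d" "\<rho> ^ (N - d) \<le> \<rho> ^ (N - Suc d)" using C by (auto intro: power_decreasing)
        then have "C * \<rho> ^ (N + d) \<le> C * \<rho> ^ d" "C * \<rho> ^ (N - d) \<le> C * \<rho> ^ (N - Suc d)"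
          using C by (auto intro: mult_left_mono)
        then have "\<bar>2 * g N d\<bar> \<le> 3 * (C * \<rho> ^ d) + C * \<rho> ^ (N - Suc d)"
        proof -
          have lin: "\<bar>x + y - 2 * s\<bar> \<le> 3 * A + B" 
            if "\<bar>x - v\<bar> \<le> A'" "\<bar>y - v\<bar> \<le> B'" "\<bar>s - v\<bar> \<le> A" "A' \<le> A" "B' \<le> B" for x y s A A' B B' :: real
            using that by linarith
          have g2: "2 * g N d = second_moment (N + d) + second_moment (N - d) - 2 * second_moment d"
            by (simp add: g_def)
          show ?thesis unfolding g2 by (rule lin[OF sm sm sm]) fact+
        qed
        then show ?thesis by (simp add: algebra_simps abs_le_iff)
      qed
      then have "(\<Sum>d<N. \<bar>g N d\<bar>) \<le> (\<Sum>d<N. C * (3 / 2 * \<rho> ^ d + 1 / 2 * \<rho> ^ (N - Suc d)))" by (rule sum_mono)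
      also have "\<dots> = C * (2 * (\<Sum>d<N. \<rho> ^ d))"
      proof -
        have "(\<Sum>d<N. C * (3 / 2 * \<rho> ^ d + 1 / 2 * \<rho> ^ (N - Suc d)))
            = C * (3 / 2 * (\<Sum>d<N. \<rho> ^ d) + 1 / 2 * (\<Sum>d<N. \<rho> ^ (N - Suc d)))"
          by (simp only: sum_distrib_left[symmetric] sum.distrib)
        also have "(\<Sum>d<N. \<rho> ^ (N - Suc d)) = (\<Sum>d<N. \<rho> ^ d)"
          by (rule sum.nat_diff_reindex)
        finally show ?thesis by simp
      qed
      also have "\<dots> \<le> C * (2 * (1 / (1 - \<rho>)))" using geom C by (intro mult_left_mono) auto
      finally show "(\<Sum>d<N. \<bar>g N d\<bar>) \<le> 2 * (C / (1 - \<rho>))" by (simp add: mult.commute)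
    qed auto
    finally show ?thesis by (simp add: K_def)
  qed
  \<comment> \<open>From S_(n+N) = S_n + S_N \<circ> T^n: doubling the length changes the average by
    W_N / (2 N).\<close>
  have D_W: "D k z = W (2 ^ k) z / (2 * 2 ^ k)" for k z
  proof -
    let ?N = "2 ^ k :: nat"
    have "(\<Sum>n<2 * ?N. birkhoff n z) = (\<Sum>n<?N. birkhoff n z) + (\<Sum>n<?N. birkhoff (n + ?N) z)"
    proof -
      have "(\<Sum>n<L + L'. birkhoff n z) = (\<Sum>n<L. birkhoff n z) + (\<Sum>n<L'. birkhoff (n + L) z)" for L L'
        by (induction L') (auto simp: add.commute)
      from this[of ?N ?N] show ?thesis by (simp add: mult_2)
    qed
    also have "(\<Sum>n<?N. birkhoff (n + ?N) z) = (\<Sum>n<?N. birkhoff n z) + W ?N z"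
      by (simp add: W_def birkhoff_add sum.distrib)
    finally show ?thesis by (simp add: D_def avg_def field_simps)
  qed
  have W_int: "integrable M (\<lambda>z. (W N z)\<^sup>2)" for N
    unfolding W_def power2_eq_square sum_product
    by (intro Bochner_Integration.integrable_sum integrable_birkhoff_product)
  have D_sq: "(\<integral>z. (D k z)\<^sup>2 \<partial>M) \<le> K / 4 * (1/2) ^ k" for k
  proof -
    have "(\<integral>z. (D k z)\<^sup>2 \<partial>M) = (\<integral>z. (W (2 ^ k) z)\<^sup>2 \<partial>M) / (2 * 2 ^ k)\<^sup>2"
      by (simp add: D_W power_divide)
    also have "\<dots> \<le> (2 ^ k * K) / (2 * 2 ^ k)\<^sup>2" using W_sq[of "2 ^ k"] by (intro divide_right_mono) auto
    also have "\<dots> = K / 4 * (1/2) ^ k" by (simp add: power2_eq_square power_one_over field_simps)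
    finally show ?thesis .
  qed
  have D_int: "integrable M (\<lambda>z. (D k z)\<^sup>2)" for k
    using W_int[of "2 ^ k"] by (simp add: D_W power_divide)
  have D_sum: "AE z in M. summable (\<lambda>k. D k z)"
    by (rule AE_summable_of_geometric_L2[OF D_m D_int D_sq])
  have sm_le: "second_moment n \<le> v + C" for n
  proof -
    have "C * \<rho> ^ n \<le> C * 1" using C by (intro mult_left_mono power_le_one) auto
    then show ?thesis using sm[of n] by linarith
  qed
  have vC: "0 \<le> v + C" using order_trans[OF _ sm_le[of 0]] by (simp add: second_moment_def)
  \<comment> \<open>Only the consequence that S_N / N tends to 0 along N = 2^k is needed: it is the
    boundary term in \<open>avg_T\<close>.\<close>
  have S_sum: "AE z in M. summable (\<lambda>k. birkhoff (2 ^ k) z / 2 ^ k)"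
  proof (rule AE_summable_of_geometric_L2)
    show "integrable M (\<lambda>z. (birkhoff (2 ^ k) z / 2 ^ k)\<^sup>2)" for k
      using birkhoff_sq_integrable[of "2 ^ k"] by (simp add: power_divide)
    show "(\<integral>z. (birkhoff (2 ^ k) z / 2 ^ k)\<^sup>2 \<partial>M) \<le> (v + C) * (1/2) ^ k" for k
    proof -
      have "(\<integral>z. (birkhoff (2 ^ k) z / 2 ^ k)\<^sup>2 \<partial>M) = second_moment (2 ^ k) / (2 ^ k)\<^sup>2"
        by (simp add: second_moment_def power_divide)
      also have "\<dots> \<le> (v + C) / 2 ^ k"
      proof (rule frac_le[OF vC sm_le])
        show "2 ^ k \<le> ((2 ^ k)\<^sup>2 :: real)" unfolding power2_eq_square by (simp add: mult_le_cancel_left1)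
      qed simp
      finally show ?thesis by (simp add: power_one_over)
    qed
  qed measurable
  define w where "w z = (\<Sum>k. D k z)" for z
  have w_m [measurable]: "w \<in> borel_measurable M" unfolding w_def by measurable
  \<comment> \<open>The telescoping has no initial term because the average of length 1 is the empty
    Birkhoff sum.\<close>
  have avg_D: "avg (2 ^ k) z = (\<Sum>j<k. D j z)" for k z
    by (induction k) (auto simp: D_def avg_def[of "Suc 0"] birkhoff_def[of 0])
  have lim: "AE z in M. (\<lambda>k. avg (2 ^ k) z) \<longlonglongrightarrow> w z"
    using D_sum by eventually_elim (simp add: avg_D w_def summable_LIMSEQ)
  have avg_T: "avg N (T z) - avg N z = birkhoff N z / N - \<phi> z" if "N > 0" for N z
  proof -
    have "birkhoff n (T z) = birkhoff (Suc n) z - \<phi> z" for n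
      using birkhoff_add[of 1 n z] by (simp add: birkhoff_def)
    then have "(\<Sum>n<N. birkhoff n (T z)) - (\<Sum>n<N. birkhoff n z) = (\<Sum>n<N. birkhoff (Suc n) z - birkhoff n z) - N * \<phi> z"
      by (simp add: sum_subtractf)
    also have "\<dots> = birkhoff N z - N * \<phi> z" by (simp add: sum_lessThan_telescope birkhoff_def)
    finally show ?thesis using that by (simp add: avg_def diff_divide_distrib[symmetric]) (simp add: diff_divide_distrib)
  qed
  have eq: "AE z in M. \<phi> z = - w (T z) - - w z"
    using lim AE_T_pow[OF lim, of 1] S_sum
  proof eventually_elim
    case (elim z)
    have "(\<lambda>k. avg (2 ^ k) (T z) - avg (2 ^ k) z) \<longlonglongrightarrow> w (T z) - w z"
      using elim by (intro tendsto_diff) auto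
    moreover have "(\<lambda>k. birkhoff (2 ^ k) z / 2 ^ k - \<phi> z) \<longlonglongrightarrow> 0 - \<phi> z"
      using elim by (intro tendsto_diff tendsto_const summable_LIMSEQ_zero)
    ultimately show ?case using LIMSEQ_unique by (fastforce simp: avg_T)
  qed
  have avg_sq: "(\<integral>z. (avg N z)\<^sup>2 \<partial>M) \<le> v + C" "integrable M (\<lambda>z. (avg N z)\<^sup>2)" for N
  proof -
    have b: "\<bar>avg N z\<bar> \<le> (\<Sum>n<N. n * B) / N" if "z \<in> space M" for z
      unfolding avg_def abs_divide abs_of_nat
      by (intro divide_right_mono order_trans[OF sum_abs] sum_mono birkhoff_bound that) auto
    show int: "integrable M (\<lambda>z. (avg N z)\<^sup>2)"
    proof (rule bounded_integrable)
      show "\<bar>(avg N z)\<^sup>2\<bar> \<le> ((\<Sum>n<N. n * B) / N)\<^sup>2" if "z \<in> space M" for z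
        using power_mono[OF b[OF that] abs_ge_zero, of 2] by simp
    qed measurable
    show "(\<integral>z. (avg N z)\<^sup>2 \<partial>M) \<le> v + C"
    proof (cases "N = 0")
      case False
      have le: "(avg N z)\<^sup>2 \<le> (\<Sum>n<N. (birkhoff n z)\<^sup>2) / N" for z
      proof -
        have "(\<Sum>n<N. birkhoff n z)\<^sup>2 \<le> (\<Sum>n<N. (birkhoff n z)\<^sup>2) * N"
          using sum_squared_le_sum_of_squares[of "\<lambda>n. birkhoff n z" "{..<N}"] by simp
        then show ?thesis using False by (simp add: avg_def power_divide power2_eq_square field_simps)
      qed
      have "(\<integral>z. (avg N z)\<^sup>2 \<partial>M) \<le> (\<integral>z. (\<Sum>n<N. (birkhoff n z)\<^sup>2) / N \<partial>M)"
        by (intro integral_mono int le) (auto intro!: Bochner_Integration.integrable_sum birkhoff_sq_integrable)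
      also have "\<dots> = (\<Sum>n<N. second_moment n) / N"
        by (simp add: second_moment_def birkhoff_sq_integrable Bochner_Integration.integral_sum)
      also have "\<dots> \<le> (N * (v + C)) / N"
        using sum_bounded_above[of "{..<N}" second_moment "v + C"] sm_le by (intro divide_right_mono) auto
      finally show ?thesis using False by simp
    qed (use vC in \<open>simp add: avg_def\<close>)
  qed
  \<comment> \<open>Fatou's lemma. By the Cauchy-Schwarz inequality the averages inherit the bound v
    + C on the second moments, so \<open>w\<close> is square integrable.\<close>
  have "(\<integral>\<^sup>+z. ennreal ((w z)\<^sup>2) \<partial>M) = (\<integral>\<^sup>+z. liminf (\<lambda>k. ennreal ((avg (2 ^ k) z)\<^sup>2)) \<partial>M)"
  proof (rule nn_integral_cong_AE)
    show "AE z in M. ennreal ((w z)\<^sup>2) = liminf (\<lambda>k. ennreal ((avg (2 ^ k) z)\<^sup>2))"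
      using lim
    proof eventually_elim
      case (elim z)
      then have "(\<lambda>k. ennreal ((avg (2 ^ k) z)\<^sup>2)) \<longlonglongrightarrow> ennreal ((w z)\<^sup>2)"
        by (intro tendsto_ennrealI tendsto_power)
      then show ?case by (intro lim_imp_Liminf[symmetric]) auto
    qed
  qed
  also have "\<dots> \<le> liminf (\<lambda>k. \<integral>\<^sup>+z. ennreal ((avg (2 ^ k) z)\<^sup>2) \<partial>M)"
    by (rule nn_integral_liminf) measurable
  also have "\<dots> \<le> liminf (\<lambda>k::nat. ennreal (v + C))"
  proof (rule Liminf_mono, rule always_eventually, rule allI)
    fix k
    have "(\<integral>\<^sup>+z. ennreal ((avg (2 ^ k) z)\<^sup>2) \<partial>M) = ennreal (\<integral>z. (avg (2 ^ k) z)\<^sup>2 \<partial>M)"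
      by (rule nn_integral_eq_integral[OF avg_sq(2)]) auto
    also have "\<dots> \<le> ennreal (v + C)" by (rule ennreal_leI[OF avg_sq(1)])
    finally show "(\<integral>\<^sup>+z. ennreal ((avg (2 ^ k) z)\<^sup>2) \<partial>M) \<le> ennreal (v + C)" .
  qed
  also have "\<dots> = ennreal (v + C)" by (simp add: Liminf_const)
  finally have "integrable M (\<lambda>z. (w z)\<^sup>2)"
    by (intro integrableI_bounded) (auto simp: less_top[symmetric] top_unique)
  then have "integrable M (\<lambda>z. (- w z)\<^sup>2)" by simp
  then show ?thesis
    unfolding L2_coboundary_def using eq by (intro bexI[of _ "\<lambda>z. - w z"]) auto
qed

text \<open>For a coboundary the Birkhoff sums telescope, so their second moments are at most 4
  E(u^2). Growth linear in n up to a bounded error then forces the slope to be 0.\<close>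

lemma coboundary_imp_variance_limit_zero:
  assumes "L2_coboundary M T \<phi>"
  shows "variance_limit = 0"
proof -
  obtain u where [measurable]: "u \<in> borel_measurable M" and u: "integrable M (\<lambda>z. (u z)\<^sup>2)" "AE z in M. \<phi> z = u (T z) - u z"
    using assms unfolding L2_coboundary_def by blast
  let ?U = "\<integral>z. (u z)\<^sup>2 \<partial>M"
  have sm: "second_moment n \<le> 4 * ?U" for n
  proof -
    have uT: "integrable M (\<lambda>z. (u ((T ^^ n) z))\<^sup>2)"
      using integrable_distr[OF T_pow_measurable, of n "\<lambda>z. (u z)\<^sup>2"] u(1) by (simp add: T_pow_invariant)
    have "AE z in M. \<forall>k\<in>{..<n}. \<phi> ((T ^^ k) z) = u (T ((T ^^ k) z)) - u ((T ^^ k) z)"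
      by (intro AE_finite_allI AE_T_pow[OF u(2)]) simp
    then have "AE z in M. (birkhoff n z)\<^sup>2 \<le> 2 * (u ((T ^^ n) z))\<^sup>2 + 2 * (u z)\<^sup>2"
    proof eventually_elim
      case (elim z)
      then have "birkhoff n z = (\<Sum>k<n. u ((T ^^ Suc k) z) - u ((T ^^ k) z))" by (simp add: birkhoff_def)
      also have "\<dots> = u ((T ^^ n) z) - u z" by (subst sum_lessThan_telescope) simp
      finally have eq: "birkhoff n z = u ((T ^^ n) z) - u z" .
      have "0 \<le> (u ((T ^^ n) z) + u z)\<^sup>2" by simp
      then show ?case unfolding eq by (simp add: power2_diff power2_sum)
    qed
    then have "second_moment n \<le> (\<integral>z. 2 * (u ((T ^^ n) z))\<^sup>2 + 2 * (u z)\<^sup>2 \<partial>M)"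
      unfolding second_moment_def by (intro integral_mono_AE birkhoff_sq_integrable) (use u uT in auto)
    also have "\<dots> = 4 * ?U"
      using u uT integral_T_pow[of "\<lambda>z. (u z)\<^sup>2" n] by simp
    finally show ?thesis .
  qed
  obtain D where D: "\<And>n. \<bar>second_moment n - n * variance_limit\<bar> \<le> D" using second_moment_linear by blast
  have le: "real n * \<bar>variance_limit\<bar> \<le> D + 4 * ?U" for n
  proof -
    have "0 \<le> second_moment n" by (simp add: second_moment_def)
    then have "\<bar>n * variance_limit\<bar> \<le> D + 4 * ?U" using D[of n] sm[of n] by linarith
    then show ?thesis by (simp add: abs_mult)
  qed
  show ?thesis
  proof (rule ccontr)
    assume "variance_limit \<noteq> 0"
    then obtain n where "D + 4 * ?U < real n * \<bar>variance_limit\<bar>"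
      using ex_less_of_nat_mult[of "\<bar>variance_limit\<bar>" "D + 4 * ?U"] by auto
    then show False using le[of n] by linarith
  qed
qed

end

section \<open>The normal limit on intervals\<close>

lemma null_sets_frontier_interval:
  fixes I :: "real set"
  assumes "is_interval I"
  shows "frontier I \<in> null_sets lborel"
proof -
  have "negligible (frontier I)"
    using assms by (intro negligible_convex_frontier is_interval_convex)
  then show ?thesis
    by (simp add: negligible_iff_null_sets null_sets_completion_iff)
qed

lemma std_normal_measure_interval:
  fixes I :: "real set" and v :: real
  assumes I: "I \<in> sets borel" and v: "0 < v"
  shows "measure std_normal_distribution {x. sqrt v * x \<in> I}
    = 1 / (sqrt v * sqrt (2 * pi)) * (LINT t:I|lborel. exp (- t\<^sup>2 / (2 * v)))"
proof -
  let ?A = "{x. sqrt v * x \<in> I}"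
  interpret real_distribution std_normal_distribution by (rule real_dist_normal_dist)
  have A [measurable]: "?A \<in> sets borel"
  proof -
    have "(\<lambda>x. sqrt v * x) -` I \<inter> space borel \<in> sets borel" by (rule measurable_sets[OF _ I]) measurable
    then show ?thesis by (simp add: vimage_def)
  qed
  have "measure std_normal_distribution ?A = (\<integral>x. indicator ?A x \<partial>std_normal_distribution)"
    by simp
  also have "\<dots> = (\<integral>x. std_normal_density x * indicator ?A x \<partial>lborel)"
    by (subst integral_density) auto
  also have "\<dots> = 1 / sqrt (2 * pi) * (\<integral>x. indicator I (sqrt v * x) * exp (- (sqrt v * x)\<^sup>2 / (2 * v)) \<partial>lborel)"
    unfolding integral_mult_right_zero[symmetric]
  proof (rule Bochner_Integration.integral_cong[OF refl])
    fix x
    have "(sqrt v * x)\<^sup>2 / (2 * v) = x\<^sup>2 / 2" using v by (simp add: power_mult_distrib)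
    then show "std_normal_density x * indicator ?A x = 1 / sqrt (2 * pi) * (indicator I (sqrt v * x) * exp (- (sqrt v * x)\<^sup>2 / (2 * v)))"
      by (simp add: std_normal_density_def indicator_def)
  qed
  also have "(\<integral>x. indicator I (sqrt v * x) * exp (- (sqrt v * x)\<^sup>2 / (2 * v)) \<partial>lborel)
      = 1 / sqrt v * (\<integral>t. indicator I t * exp (- t\<^sup>2 / (2 * v)) \<partial>lborel)"
    using lborel_integral_real_affine[of "sqrt v" "\<lambda>t. indicator I t * exp (- t\<^sup>2 / (2 * v))" 0] v by simp
  finally show ?thesis by (simp add: set_lebesgue_integral_def)
qed

context markov_approximable
begin

text \<open>Levy's theorem is applied to the sums normalised to variance 1. Weak convergence passes
  to the probability of an interval because its frontier is a null set for the normal law; rescaling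
  returns to the original interval.\<close>

theorem birkhoff_clt:
  assumes v: "0 < variance_limit" and I: "is_interval (I :: real set)"
  shows "(\<lambda>n. prob {z \<in> space M. birkhoff n z / sqrt (real n) \<in> I}) \<longlonglongrightarrow>
    1 / (sqrt variance_limit * sqrt (2 * pi)) * (LINT t:I|lborel. exp (- t\<^sup>2 / (2 * variance_limit)))"
proof -
  let ?s = "sqrt variance_limit"
  define f where "f n z = birkhoff n z / sqrt (real n) / ?s" for n z
  have f [measurable]: "f n \<in> borel_measurable M" for n unfolding f_def by measurable
  let ?\<mu> = "\<lambda>n. distr M borel (f n)"
  have s: "0 < ?s" using v by simp
  have "(\<lambda>n. char (?\<mu> n) t) \<longlonglongrightarrow> char std_normal_distribution t" for t
  proof -
    have "char (?\<mu> n) t = (\<integral>z. iexp ((t / ?s) * (birkhoff n z / sqrt (real n))) \<partial>M)" for n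
      unfolding char_def by (subst integral_distr) (auto simp: f_def mult.commute)
    moreover have "exp (- variance_limit * (t / ?s)\<^sup>2 / 2) = exp (- (t\<^sup>2) / 2)"
      using v by (simp add: power_divide)
    ultimately show ?thesis
      using birkhoff_char_tendsto[of "t / ?s"] by (simp only: char_std_normal_distribution)
  qed
  then have conv: "weak_conv_m ?\<mu> std_normal_distribution"
    by (intro levy_continuity real_dist_normal_dist real_distribution_distr f)
  let ?A = "{x. ?s * x \<in> I}"
  have A: "is_interval ?A"
    unfolding is_interval_1
  proof (intro ballI allI impI)
    fix a b x assume "a \<in> ?A" "b \<in> ?A" "a \<le> x \<and> x \<le> b"
    then show "x \<in> ?A"
      using I[unfolded is_interval_1, rule_format, of "?s * a" "?s * b" "?s * x"] s by simp
  qed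
  have "(\<lambda>n. measure (?\<mu> n) ?A) \<longlonglongrightarrow> measure std_normal_distribution ?A"
  proof (rule weak_conv_imp_continuity_set_conv[OF _ _ conv real_interval_borel_measurable[OF A]])
    have "frontier ?A \<in> null_sets std_normal_distribution"
      using null_sets_frontier_interval[OF A] AE_not_in[OF null_sets_frontier_interval[OF A]]
      by (subst null_sets_density_iff) (auto elim: eventually_mono)
    then show "emeasure std_normal_distribution (frontier ?A) = 0" by auto
  qed (use real_dist_normal_dist in auto)
  moreover have "measure (?\<mu> n) ?A = prob {z \<in> space M. birkhoff n z / sqrt (real n) \<in> I}" for n
    using real_interval_borel_measurable[OF A] s
    by (subst measure_distr) (auto simp: f_def intro!: arg_cong[of _ _ prob])
  ultimately show ?thesis
    by (simp only: std_normal_measure_interval[OF real_interval_borel_measurable[OF I] v])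
qed

end

section \<open>The marginal of the invariant measure\<close>

lemma openin_subset_mspace: "openin (mtopology_of X) U \<Longrightarrow> U \<subseteq> mspace X"
  using openin_subset[of "mtopology_of X" U] by simp

lemma space_borel_metric [simp]: "space (borel_metric X) = mspace X"
  unfolding borel_metric_def by (rule space_measure_of) (use openin_subset_mspace in blast)

lemma openin_sets_borel_metric: "openin (mtopology_of X) U \<Longrightarrow> U \<in> sets (borel_metric X)"
  unfolding borel_metric_def
  by (subst sets_measure_of) (use openin_subset_mspace in \<open>auto intro: sigma_sets.Basic\<close>)

lemma Lipschitz_measurable_real:
  assumes "Lipschitz_continuous_map X euclidean_metric (f :: 'a \<Rightarrow> real)"
  shows "f \<in> borel_measurable (borel_metric X)"
proof (rule borel_measurableI)
  fix S :: "real set" assume "open S"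
  then have "openin (mtopology_of X) {x \<in> topspace (mtopology_of X). f x \<in> S}"
    using Lipschitz_continuous_imp_continuous_map[OF assms] by (intro openin_continuous_map_preimage) auto
  then show "f -` S \<inter> space (borel_metric X) \<in> sets (borel_metric X)"
    using openin_sets_borel_metric by (simp add: vimage_def Int_def conj_commute topspace_mtopology_of)
qed

lemma Lipschitz_measurable:
  assumes "Lipschitz_continuous_map X Y f"
  shows "f \<in> measurable (borel_metric X) (borel_metric Y)"
  unfolding borel_metric_def[of Y]
proof (rule measurable_measure_of)
  fix U assume "U \<in> {U. openin (mtopology_of Y) U}"
  then have "openin (mtopology_of X) {x \<in> topspace (mtopology_of X). f x \<in> U}"
    using Lipschitz_continuous_imp_continuous_map[OF assms] by (intro openin_continuous_map_preimage) auto
  then show "f -` U \<inter> space (borel_metric X) \<in> sets (borel_metric X)"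
    using openin_sets_borel_metric by (simp add: vimage_def Int_def conj_commute topspace_mtopology_of)
qed (use Lipschitz_continuous_map_image[OF assms] openin_subset_mspace in auto)

section \<open>The metric on sequences and the orbits of a skew product\<close>

lemma d_theta_ge:
  assumes "0 < \<theta>" "\<theta> < 1" "x i \<noteq> y i"
  shows "\<theta> ^ i \<le> d_theta \<theta> x y"
  unfolding d_theta_def
  using sum_le_suminf[OF d_theta_summable[OF assms(1,2), of x y], of "{i}"] assms by simp

lemma d_theta_agree:
  assumes "0 < \<theta>" "\<theta> < 1" "\<And>i. i < k \<Longrightarrow> x i = y i"
  shows "d_theta \<theta> x y \<le> \<theta> ^ k / (1 - \<theta>)"
proof -
  let ?f = "\<lambda>i. \<theta> ^ i * (1 - of_bool (x i = y i)) :: real"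
  have s: "summable ?f" by (rule d_theta_summable[OF assms(1,2)])
  have "d_theta \<theta> x y = (\<Sum>i. ?f (i + k))"
    unfolding d_theta_def using suminf_split_initial_segment[OF s, of k] assms(3) by simp
  also have "\<dots> \<le> (\<Sum>i. \<theta> ^ k * \<theta> ^ i)"
  proof (rule suminf_le)
    show "summable (\<lambda>i. ?f (i + k))" using s by (simp add: summable_iff_shift[of ?f])
    show "summable (\<lambda>i. \<theta> ^ k * \<theta> ^ i)" using assms by (intro summable_mult summable_geometric) auto
  qed (use assms in \<open>auto simp: power_add mult_ac\<close>)
  also have "\<dots> = \<theta> ^ k / (1 - \<theta>)" using assms by (simp add: suminf_mult summable_geometric suminf_geometric)
  finally show ?thesis .
qed

lemma d_theta_le:
  assumes "0 < \<theta>" "\<theta> < 1" shows "d_theta \<theta> x y \<le> 1 / (1 - \<theta>)"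
  using d_theta_agree[OF assms, of 0 x y] by simp

lemma left_shift_pow: "(left_shift ^^ k) x = (\<lambda>i. x (i + k))"
  by (induction k) (auto simp: left_shift_def)

lemma left_shift_pow_SFT: "x \<in> SFT A \<Longrightarrow> (left_shift ^^ k) x \<in> SFT A"
  by (simp add: left_shift_pow SFT_def)

lemma fst_skew_product: "fst (skew_product G z) = left_shift (fst z)"
  by (simp add: skew_product_def split: prod.split)

lemma fst_skew_product_pow: "fst ((skew_product G ^^ k) z) = (left_shift ^^ k) (fst z)"
  by (induction k) (simp_all add: fst_skew_product)

lemma snd_skew_product: "snd (skew_product G z) = G (fst z, snd z)"
  by (simp add: skew_product_def split: prod.split)

text \<open>Positivity of an entry of a power of a nonnegative matrix only says that a path of that
  length exists, so it carries over from \<open>A\<close> to any kernel that is positive wherever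
  \<open>A\<close> is.\<close>

lemma kernel_pow_pos_of_mat_pow:
  fixes A :: "nat^'n^'n"
  assumes "\<And>i j. 0 \<le> P i j" "\<And>i j. 0 < A $ i $ j \<Longrightarrow> 0 < P i j" "0 < mat_pow A k $ i $ j"
  shows "0 < kernel_pow P k i j"
  using assms(3)
proof (induction k arbitrary: i)
  case 0 then show ?case by (simp add: mat_def split: if_splits)
next
  case (Suc k)
  have nn: "0 \<le> kernel_pow P k l j" for k l j
    by (induction k arbitrary: l) (auto intro!: sum_nonneg mult_nonneg_nonneg assms(1))
  from Suc.prems have "0 < (\<Sum>l\<in>UNIV. A $ i $ l * mat_pow A k $ l $ j)"
    by (simp add: matrix_matrix_mult_def)
  then obtain l where "0 < A $ i $ l * mat_pow A k $ l $ j"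
    by (metis (no_types, lifting) gr0I sum.neutral)
  then have "0 < P i l * kernel_pow P k l j"
    using assms(2) Suc.IH by auto
  then show ?case
    using nn assms(1) by (auto intro!: sum_pos2[of UNIV l])
qed

lemma measure_coordinates_shift:
  assumes T: "T \<in> measurable M M" "distr M M T = M"
    and X: "\<And>i. X i \<in> measurable M (count_space UNIV)" "\<And>i z. z \<in> space M \<Longrightarrow> X i (T z) = X (Suc i) z"
  shows "measure M {z \<in> space M. \<forall>i\<le>n. X (i + q) z = w i} = measure M {z \<in> space M. \<forall>i\<le>n. X i z = w i}"
proof (induction q)
  case (Suc q)
  note X(1)[measurable] T(1)[measurable]
  let ?S = "{z \<in> space M. \<forall>i\<le>n. X (i + q) z = w i}"
  have "measure M ?S = measure (distr M M T) ?S" by (simp add: T)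
  also have "\<dots> = measure M (T -` ?S \<inter> space M)"
    by (rule measure_distr) measurable
  also have "T -` ?S \<inter> space M = {z \<in> space M. \<forall>i\<le>n. X (i + Suc q) z = w i}"
    using X(2) measurable_space[OF T(1)] by auto
  finally show ?case using Suc by simp
qed simp

locale skew_system =
  fixes A :: "nat^'n^'n" and \<theta> :: real and m :: "(nat \<Rightarrow> 'n) measure"
    and G :: "(nat \<Rightarrow> 'n) \<times> 'k::metric_space \<Rightarrow> 'k" and \<mu>0 :: "((nat \<Rightarrow> 'n) \<times> 'k) measure"
    and \<phi> :: "(nat \<Rightarrow> 'n) \<times> 'k \<Rightarrow> real"
  assumes A01: "\<And>i j. A $ i $ j \<in> {0, 1}" and aperiodic: "aperiodic A"
    and \<theta>: "0 < \<theta>" "\<theta> < 1"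
    and Markov: "Markov_measure \<theta> A m" and m_invariant: "invariant_measure left_shift m"
    and dist_le_1: "\<And>y1 y2 :: 'k. dist y1 y2 \<le> 1"
    and G1: "G1 m G" and G2: "G2 \<theta> A G"
    and \<mu>0_prob: "prob_space \<mu>0" and \<mu>0_sets: "sets \<mu>0 = sets (borel_metric (skew_metric \<theta> A))"
    and \<mu>0_invariant: "invariant_measure (skew_product G) \<mu>0"
    and \<mu>0_S_inf: "measure \<mu>0 \<in> S_inf \<theta> A m"
    and \<phi>_Lipschitz: "Lipschitz_continuous_map (skew_metric \<theta> A) euclidean_metric \<phi>"
begin

sublocale prob_space \<mu>0 by (rule \<mu>0_prob)

sublocale m: prob_space m using Markov by (simp add: Markov_measure_def)

abbreviation "F \<equiv> skew_product G"

lemma m_sets: "sets m = sets (borel_metric (sft_metric \<theta> A))"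
  using Markov by (simp add: Markov_measure_def)

lemma space_m: "space m = SFT A"
  using sets_eq_imp_space_eq[OF m_sets] by (simp add: sft_metric_simps[OF \<theta>])

lemma space_\<mu>0: "space \<mu>0 = SFT A \<times> UNIV"
  using sets_eq_imp_space_eq[OF \<mu>0_sets] by (simp add: skew_metric_simps[OF \<theta>])

lemma d_theta_nonneg: "0 \<le> d_theta \<theta> x y"
proof -
  interpret Metric_space UNIV "d_theta \<theta>" by (rule Metric_space_d_theta[OF \<theta>])
  show ?thesis by (rule nonneg)
qed

text \<open>Sequences that differ at \<open>i\<close> are at least \<theta>^i apart. The indicator
  of a symbol at place \<open>i\<close> is therefore Lipschitz, hence measurable for the Borel sets
  of the metric.\<close>

lemma coordinate_Lipschitz: "\<bar>of_bool (x i = s) - of_bool (y i = s)\<bar> \<le> (1 / \<theta> ^ i) * d_theta \<theta> x y"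
proof (cases "x i = y i")
  case True then show ?thesis using d_theta_nonneg[of x y] \<theta> by simp
next
  case False
  have "1 \<le> (1 / \<theta> ^ i) * d_theta \<theta> x y"
    using d_theta_ge[OF \<theta>, of x i y] False \<theta> by (simp add: field_simps)
  then show ?thesis by (auto simp: of_bool_def)
qed

lemma m_coordinate_measurable [measurable]: "(\<lambda>x. x i) \<in> measurable m (count_space UNIV)"
proof (rule measurableI)
  fix S :: "'n set"
  have "Lipschitz_continuous_map (sft_metric \<theta> A) euclidean_metric (\<lambda>x. of_bool (x i = s) :: real)" for s
    unfolding Lipschitz_continuous_map_def sft_metric_simps[OF \<theta>] mdist_euclidean_metric dist_real_def
    by (intro conjI exI[of _ "1 / \<theta> ^ i"] ballI coordinate_Lipschitz) simp
  from Lipschitz_measurable_real[OF this] have "(\<lambda>x. of_bool (x i = s) :: real) \<in> borel_measurable m" for s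
    by (simp add: measurable_cong_sets[OF m_sets refl])
  then have "{x \<in> space m. of_bool (x i = s) = (1 :: real)} \<in> sets m" for s by measurable
  then have "(\<Union>s\<in>S. {x \<in> space m. of_bool (x i = s) = (1 :: real)}) \<in> sets m" by (intro sets.finite_UN) auto
  also have "(\<Union>s\<in>S. {x \<in> space m. of_bool (x i = s) = (1 :: real)}) = (\<lambda>x. x i) -` S \<inter> space m" by auto
  finally show "(\<lambda>x. x i) -` S \<inter> space m \<in> sets m" .
qed auto

lemma fst_measurable [measurable]: "fst \<in> measurable \<mu>0 m"
proof -
  have "Lipschitz_continuous_map (skew_metric \<theta> A) (sft_metric \<theta> A) fst"
    unfolding Lipschitz_continuous_map_def
    by (auto simp: sft_metric_simps[OF \<theta>] skew_metric_simps[OF \<theta>] skew_dist_def intro!: exI[of _ 1])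
  then show ?thesis using Lipschitz_measurable by (simp add: measurable_cong_sets[OF \<mu>0_sets m_sets])
qed

lemma coordinate_measurable [measurable]: "(\<lambda>z. fst z i) \<in> measurable \<mu>0 (count_space UNIV)"
  using measurable_compose[OF fst_measurable m_coordinate_measurable] .

lemma F_measurable [measurable]: "F \<in> measurable \<mu>0 \<mu>0" and F_distr: "distr \<mu>0 \<mu>0 F = \<mu>0"
  using \<mu>0_invariant by (auto simp: invariant_measure_def)

lemma m_chain: "\<exists>P p. finite_markov_chain m (\<lambda>i x. x i) P p"
proof -
  obtain P :: "real^'n^'n" and p :: "real^'n" where P: "\<And>i j. 0 \<le> P $ i $ j" "\<And>i. (\<Sum>j\<in>UNIV. P $ i $ j) = 1"
    "\<And>i j. 0 < P $ i $ j \<longleftrightarrow> A $ i $ j = 1" "\<And>i. 0 \<le> p $ i" "(\<Sum>i\<in>UNIV. p $ i) = 1"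
    and cyl: "\<And>n w. measure m {x \<in> SFT A. \<forall>i\<le>n. x i = w i} = p $ w 0 * (\<Prod>i<n. P $ w i $ w (Suc i))"
    using Markov unfolding Markov_measure_def by auto
  have shift: "left_shift \<in> measurable m m" "distr m m left_shift = m"
    using m_invariant by (auto simp: invariant_measure_def)
  \<comment> \<open>Stationarity of \<open>p\<close> is not built into
    \<open>Markov_measure\<close>. It follows from shift invariance by comparing the symbol
    \<open>j\<close> at times 0 and 1.\<close>
  have "(\<Sum>i\<in>UNIV. p $ i * P $ i $ j) = p $ j" for j
  proof -
    let ?S = "\<lambda>i. {x \<in> space m. x 0 = i \<and> x (Suc 0) = j}"
    have "p $ j = measure m {x \<in> space m. \<forall>i\<le>0. x i = j}"
      using cyl[of 0 "\<lambda>_. j"] by (simp add: space_m)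
    also have "\<dots> = measure m {x \<in> space m. \<forall>i\<le>0. x (i + 1) = j}"
      by (rule measure_coordinates_shift[OF shift, where X = "\<lambda>i x. x i" and w = "\<lambda>_. j", symmetric])
        (auto simp: left_shift_def)
    also have "{x \<in> space m. \<forall>i\<le>0. x (i + 1) = j} = (\<Union>i\<in>UNIV. ?S i)" by auto
    also have "measure m (\<Union>i\<in>UNIV. ?S i) = (\<Sum>i\<in>UNIV. measure m (?S i))"
      by (rule m.finite_measure_finite_Union) (auto simp: disjoint_family_on_def)
    also have "\<dots> = (\<Sum>i\<in>UNIV. p $ i * P $ i $ j)"
    proof (rule sum.cong[OF refl])
      fix i
      have "?S i = {x \<in> SFT A. \<forall>l\<le>1. x l = (if l = 0 then i else j)}"
        by (auto simp: space_m le_Suc_eq)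
      then show "measure m (?S i) = p $ i * P $ i $ j"
        using cyl[of 1 "\<lambda>l. if l = 0 then i else j"] by simp
    qed
    finally show ?thesis ..
  qed
  moreover have "\<exists>k>0. \<forall>i j. kernel_pow (\<lambda>i j. P $ i $ j) k i j > 0"
  proof -
    obtain k where k: "k \<ge> 1" "\<And>i j. mat_pow A k $ i $ j > 0" using aperiodic unfolding aperiodic_def by blast
    have "A $ i $ j > 0 \<Longrightarrow> P $ i $ j > 0" for i j using A01[of i j] P(3) by auto
    then have "kernel_pow (\<lambda>i j. P $ i $ j) k i j > 0" for i j
      by (intro kernel_pow_pos_of_mat_pow[of _ A] P k)
    then show ?thesis using k by (intro exI[of _ k]) auto
  qed
  ultimately have "finite_markov_chain m (\<lambda>i x. x i) (\<lambda>i j. P $ i $ j) (\<lambda>i. p $ i)"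
    using P cyl by unfold_locales (auto simp: space_m)
  then show ?thesis by blast
qed

section \<open>The density of the marginal\<close>

lemma jordan_parts:
  "jordan_pos (borel_metric (skew_metric \<theta> A)) (measure \<mu>0) = \<mu>0"
  "jordan_neg (borel_metric (skew_metric \<theta> A)) (measure \<mu>0) = null_measure (borel_metric (skew_metric \<theta> A))"
  using jordan_pos_measure[OF _ \<mu>0_sets] jordan_neg_measure[of _ \<mu>0] by (auto simp: finite_measure_axioms)

lemma marginal_absolutely_continuous: "absolutely_continuous m (distr \<mu>0 m fst)"
  using \<mu>0_S_inf by (simp add: S_inf_def AB_def Let_def jordan_parts)

text \<open>Membership in \<open>S_inf\<close> speaks of a difference of two densities converted to
  reals. The one of the negative part vanishes almost everywhere because that part is the null
  measure.\<close>

lemma marginal_has_Lipschitz_density: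
  obtains f where "Lipschitz_continuous_map (sft_metric \<theta> A) euclidean_metric f"
    "AE x in m. RN_deriv m (distr \<mu>0 m fst) x = ennreal (f x) \<and> 0 \<le> f x"
proof -
  let ?N = "distr (null_measure (borel_metric (skew_metric \<theta> A :: ((nat \<Rightarrow> 'n) \<times> 'k) metric))) m fst"
  have "density m (\<lambda>_. 0) = ?N"
  proof (rule measure_eqI)
    fix S assume "S \<in> sets (density m (\<lambda>_. 0))"
    moreover have "fst \<in> measurable (null_measure (borel_metric (skew_metric \<theta> A :: ((nat \<Rightarrow> 'n) \<times> 'k) metric))) m"
      using fst_measurable by (simp add: measurable_def \<mu>0_sets space_\<mu>0 skew_metric_simps[OF \<theta>])
    ultimately show "emeasure (density m (\<lambda>_. 0)) S = emeasure ?N S"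
      by (simp add: emeasure_density emeasure_distr)
  qed simp
  from m.RN_deriv_unique[OF _ this] have neg: "AE x in m. RN_deriv m ?N x = 0" by auto
  from \<mu>0_S_inf obtain f where f: "Lipschitz_continuous_map (sft_metric \<theta> A) euclidean_metric f"
    "AE x in m. enn2real (RN_deriv m (distr \<mu>0 m fst) x) - enn2real (RN_deriv m ?N x) = f x"
    by (auto simp: S_inf_def Let_def jordan_parts marginal_density_def)
  \<comment> \<open>\<open>enn2real\<close> sends infinity to 0, so finiteness of the density is
    needed to recover it from its real value.\<close>
  have "sigma_finite_measure (distr \<mu>0 m fst)"
    by (intro prob_space_imp_sigma_finite prob_space_distr fst_measurable)
  from m.RN_deriv_finite[OF this marginal_absolutely_continuous]
  have "AE x in m. RN_deriv m (distr \<mu>0 m fst) x \<noteq> \<infinity>" by simp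
  with f(2) neg have "AE x in m. RN_deriv m (distr \<mu>0 m fst) x = ennreal (f x) \<and> 0 \<le> f x"
  proof eventually_elim
    case (elim x)
    let ?r = "RN_deriv m (distr \<mu>0 m fst) x"
    have "enn2real ?r = f x" using elim by simp
    then show ?case using elim(3) ennreal_enn2real[of ?r] enn2real_nonneg[of ?r] by (simp add: less_top)
  qed
  with f(1) show ?thesis by (rule that)
qed

text \<open>The marginal of \<open>\<mu>0\<close> is shift invariant with a density \<open>f\<close> that is well approximated by
  functions of finitely many coordinates, so mixing of \<open>m\<close> forces it to agree with \<open>m\<close>.\<close>
lemma marginal_cylinder:
  "measure \<mu>0 {z \<in> space \<mu>0. \<forall>i\<le>n. fst z i = w i} = measure m {x \<in> space m. \<forall>i\<le>n. x i = w i}"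
proof -
  obtain P p where "finite_markov_chain m (\<lambda>i x. x i) P p" using m_chain by blast
  then interpret M: finite_markov_chain m "\<lambda>i x. x i" P p .
  obtain C \<rho> where C: "0 \<le> C" "0 < \<rho>" "\<rho> < 1" and mix: "\<And>L. M.mixing_at L (C * \<rho> ^ L)"
    using M.exponential_mixing by blast
  obtain f where f: "Lipschitz_continuous_map (sft_metric \<theta> A) euclidean_metric f"
    "AE x in m. RN_deriv m (distr \<mu>0 m fst) x = ennreal (f x) \<and> 0 \<le> f x"
    using marginal_has_Lipschitz_density by blast
  obtain L where L: "0 < L" "\<And>x y. x \<in> SFT A \<Longrightarrow> y \<in> SFT A \<Longrightarrow> \<bar>f x - f y\<bar> \<le> L * d_theta \<theta> x y"
    using f(1) unfolding Lipschitz_continuous_map_pos by (auto simp: sft_metric_simps[OF \<theta>] dist_real_def)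
  have fm [measurable]: "f \<in> borel_measurable m"
    using Lipschitz_measurable_real[OF f(1)] by (simp add: measurable_cong_sets[OF m_sets refl])
  obtain x0 where x0: "x0 \<in> SFT A" using m.not_empty by (auto simp: space_m)
  define b where "b = \<bar>f x0\<bar> + L * (1 / (1 - \<theta>))"
  have b: "\<bar>f x\<bar> \<le> b" if "x \<in> SFT A" for x
    using L(2)[OF that x0] mult_left_mono[OF d_theta_le[OF \<theta>, of x x0], of L] L(1) by (simp add: b_def)
  have f_int: "integrable m (\<lambda>x. f x * indicator S x)" if "S \<in> sets m" for S
    by (rule m.integrable_const_bound[of _ b]) (use that b b[OF x0] in \<open>auto simp: space_m indicator_def\<close>)
  have density: "measure \<mu>0 {z \<in> space \<mu>0. fst z \<in> S} = (\<integral>x. f x * indicator S x \<partial>m)" if S: "S \<in> sets m" for S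
  proof -
    have "emeasure \<mu>0 {z \<in> space \<mu>0. fst z \<in> S} = emeasure (distr \<mu>0 m fst) S"
      using S by (subst emeasure_distr) (auto intro!: arg_cong[of _ _ "emeasure \<mu>0"])
    also have "\<dots> = emeasure (density m (RN_deriv m (distr \<mu>0 m fst))) S"
      by (simp add: m.density_RN_deriv marginal_absolutely_continuous)
    also have "\<dots> = (\<integral>\<^sup>+x. RN_deriv m (distr \<mu>0 m fst) x * indicator S x \<partial>m)"
      using S by (intro emeasure_density) auto
    also have "\<dots> = (\<integral>\<^sup>+x. ennreal (f x * indicator S x) \<partial>m)"
    proof (rule nn_integral_cong_AE)
      show "AE x in m. RN_deriv m (distr \<mu>0 m fst) x * indicator S x = ennreal (f x * indicator S x)"
        using f(2) by eventually_elim (auto simp: indicator_def)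
    qed
    also have "\<dots> = ennreal (\<integral>x. f x * indicator S x \<partial>m)"
    proof (rule nn_integral_eq_integral[OF f_int[OF S]])
      show "AE x in m. 0 \<le> f x * indicator S x" using f(2) by eventually_elim auto
    qed
    finally have "ennreal (measure \<mu>0 {z \<in> space \<mu>0. fst z \<in> S}) = ennreal (\<integral>x. f x * indicator S x \<partial>m)"
      by (simp only: emeasure_eq_measure)
    moreover have "0 \<le> (\<integral>x. f x * indicator S x \<partial>m)"
    proof (rule integral_nonneg_AE)
      show "AE x in m. 0 \<le> f x * indicator S x" using f(2) by eventually_elim auto
    qed
    ultimately show ?thesis by simp
  qed
  define S where "S q = {x \<in> space m. \<forall>i\<le>n. x (i + q) = w i}" for q
  have S [measurable]: "S q \<in> sets m" for q unfolding S_def by measurable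
  define l where "l = measure \<mu>0 {z \<in> space \<mu>0. \<forall>i\<le>n. fst z i = w i}"
  define u where "u = measure m {x \<in> space m. \<forall>i\<le>n. x i = w i}"
  \<comment> \<open>Invariance of \<mu>0 moves the cylinder to any later time \<open>q\<close>, and
    hence beyond the coordinates that determine the density approximately.\<close>
  have l: "l = (\<integral>x. f x * indicator (S q) x \<partial>m)" for q
  proof -
    have "l = measure \<mu>0 {z \<in> space \<mu>0. \<forall>i\<le>n. fst z (i + q) = w i}"
      unfolding l_def
      by (rule measure_coordinates_shift[OF F_measurable F_distr, where X = "\<lambda>i z. fst z i", symmetric])
         (auto simp: fst_skew_product left_shift_def)
    also have "{z \<in> space \<mu>0. \<forall>i\<le>n. fst z (i + q) = w i} = {z \<in> space \<mu>0. fst z \<in> S q}"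
      using measurable_space[OF fst_measurable] by (auto simp: S_def)
    finally show ?thesis by (simp add: density[OF S])
  qed
  have u: "u = measure m (S q)" for q
    unfolding u_def S_def
    by (rule measure_coordinates_shift[where T = left_shift and X = "\<lambda>i x. x i", symmetric])
       (use m_invariant in \<open>auto simp: invariant_measure_def left_shift_def\<close>)
  have u1: "0 \<le> u" "u \<le> 1" by (auto simp: u_def)
  have f1: "(\<integral>x. f x \<partial>m) = 1"
  proof -
    have "(\<integral>x. f x \<partial>m) = (\<integral>x. f x * indicator (space m) x \<partial>m)"
      by (rule Bochner_Integration.integral_cong) auto
    also have "\<dots> = measure \<mu>0 {z \<in> space \<mu>0. fst z \<in> space m}" by (rule density[symmetric]) simp
    also have "{z \<in> space \<mu>0. fst z \<in> space m} = space \<mu>0" using measurable_space[OF fst_measurable] by auto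
    finally show ?thesis by (simp add: prob_space)
  qed
  \<comment> \<open>The error e of replacing \<open>f\<close> by \<open>g\<close> enters twice: in
    the integral over \<open>S q\<close>, and in comparing the mean of \<open>g\<close> with 1. The
    last term is the mixing error.\<close>
  have "\<bar>l - u\<bar> \<le> 2 * (L * (\<theta> ^ r / (1 - \<theta>))) + C * \<rho> ^ r * b * 1" for r
  proof -
    define e where "e = L * (\<theta> ^ r / (1 - \<theta>))"
    have e: "0 \<le> e" using L(1) \<theta> by (simp add: e_def)
    \<comment> \<open>A representative of all sequences with the same first r + 1 coordinates;
      \<open>f\<close> evaluated there depends on these coordinates only.\<close>
    define sel where "sel x = (SOME x'. x' \<in> SFT A \<and> (\<forall>i\<in>{..r}. x' i = x i))" for x
    define g where "g x = f (sel x)" for x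
    have sel: "sel x \<in> SFT A \<and> (\<forall>i\<in>{..r}. sel x i = x i)" if "x \<in> SFT A" for x
      unfolding sel_def by (rule someI[of _ x]) (use that in auto)
    have close: "\<bar>f x - g x\<bar> \<le> e" if x: "x \<in> SFT A" for x
    proof -
      have "\<bar>f x - g x\<bar> \<le> L * d_theta \<theta> x (sel x)" unfolding g_def using L(2) x sel by blast
      also have "\<dots> \<le> e"
        unfolding e_def using L(1) sel[OF x] by (intro mult_left_mono d_theta_agree \<theta>) auto
      finally show ?thesis .
    qed
    have gb: "\<bar>g x\<bar> \<le> b" if "x \<in> SFT A" for x unfolding g_def using b sel[OF that] by blast
    have dg: "M.depends {..r} g"
    proof (rule depends_onI)
      fix x x' :: "nat \<Rightarrow> 'n" assume *: "\<And>i. i \<in> {..r} \<Longrightarrow> x i = x' i"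
      have "(\<lambda>x''. x'' \<in> SFT A \<and> (\<forall>i\<in>{..r}. x'' i = x i)) = (\<lambda>x''. x'' \<in> SFT A \<and> (\<forall>i\<in>{..r}. x'' i = x' i))"
        using * by (intro ext conj_cong ball_cong refl) auto
      then show "g x = g x'" unfolding g_def sel_def by (rule arg_cong)
    qed
    \<comment> \<open>The cylinder starts at 2 r and \<open>g\<close> ends at r, which leaves a gap
      of r.\<close>
    let ?q = "2 * r"
    have dS: "M.depends {?q..?q + n} (indicat_real (S ?q))"
    proof (rule depends_onI)
      fix x x' :: "nat \<Rightarrow> 'n" assume x: "x \<in> space m" "x' \<in> space m" and *: "\<And>i. i \<in> {?q..?q + n} \<Longrightarrow> x i = x' i"
      have "x (i + ?q) = x' (i + ?q)" if "i \<le> n" for i by (rule *) (use that in auto)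
      then show "indicat_real (S ?q) x = indicat_real (S ?q) x'"
        using x by (auto simp: S_def indicator_def)
    qed
    have gi: "integrable m g" by (rule M.depends_integrable[OF dg]) simp
    have gSi: "integrable m (\<lambda>x. g x * indicator (S ?q) x)"
      by (rule M.depends_integrable[OF M.depends_mult[OF dg dS]]) simp
    have fi: "integrable m f"
      by (rule m.integrable_const_bound[of _ b]) (use b in \<open>auto simp: space_m\<close>)
    have 1: "\<bar>l - (\<integral>x. g x * indicator (S ?q) x \<partial>m)\<bar> \<le> e"
      unfolding l[of ?q] real_norm_def[symmetric]
      by (rule m.expectation_diff_le[OF f_int[OF S] gSi]) (use close e in \<open>auto simp: space_m indicator_def\<close>)
    have 2: "\<bar>1 - (\<integral>x. g x \<partial>m)\<bar> \<le> e"
      unfolding f1[symmetric] real_norm_def[symmetric]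
      by (rule m.expectation_diff_le[OF fi gi]) (use close e in \<open>auto simp: space_m\<close>)
    have 3: "\<bar>(\<integral>x. g x * indicator (S ?q) x \<partial>m) - (\<integral>x. g x \<partial>m) * (\<integral>x. indicator (S ?q) x \<partial>m)\<bar> \<le> C * \<rho> ^ r * b * 1"
      by (rule M.mixing_at_real[OF mix dg dS]) (use gb in \<open>auto simp: space_m indicator_def\<close>)
    have ind: "(\<integral>x. indicator (S ?q) x \<partial>m) = u" using S[of ?q] by (simp add: u[of ?q])
    have "\<bar>(1 - (\<integral>x. g x \<partial>m)) * u\<bar> \<le> e * 1"
      unfolding abs_mult using 2 u1 by (intro mult_mono) auto
    then have "\<bar>(\<integral>x. g x \<partial>m) * u - u\<bar> \<le> e" by (simp add: left_diff_distrib abs_minus_commute)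
    with 1 3 show ?thesis unfolding ind e_def[symmetric] by linarith
  qed
  moreover have "(\<lambda>r. 2 * (L * (\<theta> ^ r / (1 - \<theta>))) + C * \<rho> ^ r * b * 1) \<longlonglongrightarrow> 2 * (L * (0 / (1 - \<theta>))) + C * 0 * b * 1"
    using C \<theta> by (intro tendsto_intros LIMSEQ_realpow_zero) auto
  ultimately have "\<bar>l - u\<bar> \<le> 2 * (L * (0 / (1 - \<theta>))) + C * 0 * b * 1"
    by (intro LIMSEQ_le_const) auto
  then show ?thesis by (simp add: l_def u_def)
qed

end

section \<open>Skew products\<close>

context skew_system
begin

lemma F_pow_space: "z \<in> SFT A \<times> UNIV \<Longrightarrow> (F ^^ k) z \<in> SFT A \<times> UNIV"
  using fst_skew_product_pow[of k G z] left_shift_pow_SFT[of "fst z" A k] by (simp add: mem_Times_iff)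

lemma \<phi>_Lipschitz_bound:
  obtains L where "0 < L" "\<And>z z'. z \<in> SFT A \<times> UNIV \<Longrightarrow> z' \<in> SFT A \<times> UNIV \<Longrightarrow>
    \<bar>\<phi> z - \<phi> z'\<bar> \<le> L * (d_theta \<theta> (fst z) (fst z') + dist (snd z) (snd z'))"
proof -
  obtain L where "0 < L" and L: "\<forall>z\<in>SFT A \<times> UNIV. \<forall>z'\<in>SFT A \<times> UNIV. dist (\<phi> z) (\<phi> z') \<le> L * skew_dist \<theta> z z'"
    using \<phi>_Lipschitz[unfolded Lipschitz_continuous_map_pos skew_metric_simps[OF \<theta>] mdist_euclidean_metric] by blast
  show ?thesis
  proof (rule that[OF \<open>0 < L\<close>])
    fix z z' assume "z \<in> SFT A \<times> (UNIV :: 'k set)" "z' \<in> SFT A \<times> (UNIV :: 'k set)"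
    from L[rule_format, OF this] show "\<bar>\<phi> z - \<phi> z'\<bar> \<le> L * (d_theta \<theta> (fst z) (fst z') + dist (snd z) (snd z'))"
      by (simp only: dist_real_def skew_dist_def)
  qed
qed

lemma \<phi>_bounded: obtains b where "\<And>z. z \<in> space \<mu>0 \<Longrightarrow> \<bar>\<phi> z\<bar> \<le> b"
proof -
  obtain L where L: "0 < L" "\<And>z z'. z \<in> SFT A \<times> UNIV \<Longrightarrow> z' \<in> SFT A \<times> UNIV \<Longrightarrow>
    \<bar>\<phi> z - \<phi> z'\<bar> \<le> L * (d_theta \<theta> (fst z) (fst z') + dist (snd z) (snd z'))"
    using \<phi>_Lipschitz_bound by blast
  obtain z0 where z0: "z0 \<in> space \<mu>0" using not_empty by blast
  have "\<bar>\<phi> z\<bar> \<le> \<bar>\<phi> z0\<bar> + L * (1 / (1 - \<theta>) + 1)" if "z \<in> space \<mu>0" for z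
  proof -
    have "\<bar>\<phi> z - \<phi> z0\<bar> \<le> L * (d_theta \<theta> (fst z) (fst z0) + dist (snd z) (snd z0))"
      using L(2) that z0 unfolding space_\<mu>0 by blast
    also have "\<dots> \<le> L * (1 / (1 - \<theta>) + 1)"
      using L(1) by (intro mult_left_mono add_mono d_theta_le[OF \<theta>] dist_le_1) auto
    finally show ?thesis by linarith
  qed
  then show ?thesis by (rule that)
qed

lemma \<phi>_measurable [measurable]: "\<phi> \<in> borel_measurable \<mu>0"
  using Lipschitz_measurable_real[OF \<phi>_Lipschitz] by (simp add: measurable_cong_sets[OF \<mu>0_sets refl])

lemma AE_F_pow:
  assumes "AE z in \<mu>0. Q z" shows "AE z in \<mu>0. Q ((F ^^ n) z)"
proof (induction n)
  case (Suc n)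
  have "AE z in distr \<mu>0 \<mu>0 F. Q ((F ^^ n) z)" using Suc by (simp only: F_distr)
  from AE_distrD[OF F_measurable this] show ?case by (simp add: funpow_swap1)
qed (simp add: assms)

text \<open>Absolute continuity of the marginal transfers (G1) from \<open>m\<close> to \<mu>0, and
  invariance transfers it to every iterate. Countably many null sets are discarded, after which the
  contraction holds along the whole orbit.\<close>

lemma contraction_along_orbits:
  obtains \<alpha> where "0 < \<alpha>" "\<alpha> < 1"
    "AE z in \<mu>0. \<forall>j y1 y2. dist (G ((left_shift ^^ j) (fst z), y1)) (G ((left_shift ^^ j) (fst z), y2)) \<le> \<alpha> * dist y1 y2"
proof -
  obtain \<alpha> where \<alpha>: "0 < \<alpha>" "\<alpha> < 1"
    and m: "AE x in m. \<forall>y1 y2. dist (G (x, y1)) (G (x, y2)) \<le> \<alpha> * dist y1 y2"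
    using G1 unfolding G1_def by blast
  have "AE x in distr \<mu>0 m fst. \<forall>y1 y2. dist (G (x, y1)) (G (x, y2)) \<le> \<alpha> * dist y1 y2"
    by (rule absolutely_continuous_AE[OF _ marginal_absolutely_continuous m]) simp
  from AE_distrD[OF fst_measurable this]
  have base: "AE z in \<mu>0. \<forall>y1 y2. dist (G (fst z, y1)) (G (fst z, y2)) \<le> \<alpha> * dist y1 y2" .
  have "AE z in \<mu>0. \<forall>j. \<forall>y1 y2. dist (G (fst ((F ^^ j) z), y1)) (G (fst ((F ^^ j) z), y2)) \<le> \<alpha> * dist y1 y2"
    unfolding AE_all_countable by (intro allI AE_F_pow[OF base])
  then show ?thesis by (intro that[OF \<alpha>]) (simp add: fst_skew_product_pow)
qed

text \<open>The fiber distances satisfy d_(j+1) \<le> \<alpha> d_j + E, where E bounds the effect of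
  changing the base point, and d_0 \<le> 1. Contraction is assumed only over the base orbit of
  \<open>z\<close>: the comparison point z' is chosen by hand and may lie in the exceptional null
  set. The triangle inequality is therefore taken through the map over the orbit of
  \<open>z\<close>.\<close>

lemma orbit_distance:
  assumes \<alpha>: "0 < \<alpha>" "\<alpha> < 1"
    and contr: "\<And>j y1 y2. dist (G ((left_shift ^^ j) (fst z), y1)) (G ((left_shift ^^ j) (fst z), y2)) \<le> \<alpha> * dist y1 y2"
    and H: "0 \<le> H" "\<And>x1 x2 y. x1 \<in> SFT A \<Longrightarrow> x2 \<in> SFT A \<Longrightarrow> dist (G (x1, y)) (G (x2, y)) \<le> H * d_theta \<theta> x1 x2"
    and z: "z \<in> SFT A \<times> UNIV" "z' \<in> SFT A \<times> UNIV" and agree: "\<And>i. i \<le> 2 * r \<Longrightarrow> fst z i = fst z' i" and "j \<le> r"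
  shows "dist (snd ((F ^^ j) z)) (snd ((F ^^ j) z')) \<le> \<alpha> ^ j + H * (\<theta> ^ r / (1 - \<theta>)) / (1 - \<alpha>)"
  using \<open>j \<le> r\<close>
proof (induction j)
  case 0
  have "0 \<le> H * (\<theta> ^ r / (1 - \<theta>)) / (1 - \<alpha>)" using H(1) \<alpha> \<theta> by simp
  then show ?case using dist_le_1[of "snd z" "snd z'"] by simp
next
  case (Suc j)
  define E where "E = H * (\<theta> ^ r / (1 - \<theta>))"
  let ?x = "(left_shift ^^ j) (fst z)" and ?x' = "(left_shift ^^ j) (fst z')"
  let ?y = "snd ((F ^^ j) z)" and ?y' = "snd ((F ^^ j) z')"
  have x: "?x \<in> SFT A" "?x' \<in> SFT A" using z left_shift_pow_SFT by (auto simp: mem_Times_iff)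
  have "d_theta \<theta> ?x ?x' \<le> \<theta> ^ r / (1 - \<theta>)"
    by (rule d_theta_agree[OF \<theta>]) (use agree Suc.prems in \<open>auto simp: left_shift_pow\<close>)
  then have "H * d_theta \<theta> ?x ?x' \<le> E" unfolding E_def by (intro mult_left_mono H)
  then have 1: "dist (G (?x, ?y')) (G (?x', ?y')) \<le> E" using H(2)[OF x, of ?y'] by linarith
  have "dist (G (?x, ?y)) (G (?x, ?y')) \<le> \<alpha> * dist ?y ?y'" by (rule contr)
  also have "\<dots> \<le> \<alpha> * (\<alpha> ^ j + E / (1 - \<alpha>))"
    using Suc \<alpha> by (intro mult_left_mono) (auto simp: E_def)
  finally have "dist (G (?x, ?y)) (G (?x', ?y')) \<le> \<alpha> * (\<alpha> ^ j + E / (1 - \<alpha>)) + E"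
    using 1 dist_triangle[of "G (?x, ?y)" "G (?x', ?y')" "G (?x, ?y')"] by linarith
  also have "\<dots> = \<alpha> ^ Suc j + E / (1 - \<alpha>)" using \<alpha> by (simp add: field_simps)
  finally show ?case by (simp add: snd_skew_product fst_skew_product_pow E_def)
qed

text \<open>The observable is evaluated along the orbit of a reference point that shares the
  coordinates 0, ..., 2 r. After r steps the base points still agree in r coordinates, and by
  \<open>orbit_distance\<close> the fiber points are exponentially close.\<close>

lemma block_approximable:
  "\<exists>K \<rho>. 0 \<le> K \<and> 0 < \<rho> \<and> \<rho> < 1 \<and>
    (\<forall>r. \<exists>h. depends_on (space \<mu>0) (\<lambda>i z. fst z i) {..2 * r} h \<and>
      (AE z in \<mu>0. \<bar>centered \<mu>0 \<phi> ((F ^^ r) z) - h z\<bar> \<le> K * \<rho> ^ r))"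
proof -
  obtain L where L: "0 < L" "\<And>z z'. z \<in> SFT A \<times> UNIV \<Longrightarrow> z' \<in> SFT A \<times> UNIV \<Longrightarrow>
    \<bar>\<phi> z - \<phi> z'\<bar> \<le> L * (d_theta \<theta> (fst z) (fst z') + dist (snd z) (snd z'))"
    using \<phi>_Lipschitz_bound by blast
  obtain \<alpha> where \<alpha>: "0 < \<alpha>" "\<alpha> < 1" and contr:
    "AE z in \<mu>0. \<forall>j y1 y2. dist (G ((left_shift ^^ j) (fst z), y1)) (G ((left_shift ^^ j) (fst z), y2)) \<le> \<alpha> * dist y1 y2"
    using contraction_along_orbits by blast
  obtain k where k: "\<And>y. 0 \<le> k y" "bdd_above (range k)"
    "\<And>x1 x2 y. x1 \<in> SFT A \<Longrightarrow> x2 \<in> SFT A \<Longrightarrow> dist (G (x1, y)) (G (x2, y)) \<le> k y * d_theta \<theta> x1 x2"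
    using G2 unfolding G2_def by blast
  obtain H where kH: "\<And>y. k y \<le> H" using k(2) unfolding bdd_above_def by auto
  have H: "0 \<le> H" by (rule order_trans[OF k(1) kH])
  have H': "dist (G (x1, y)) (G (x2, y)) \<le> H * d_theta \<theta> x1 x2" if "x1 \<in> SFT A" "x2 \<in> SFT A" for x1 x2 y
    by (rule order_trans[OF k(3)[OF that] mult_right_mono[OF kH d_theta_nonneg]])
  define \<rho> where "\<rho> = max \<theta> \<alpha>"
  define K where "K = L * (1 / (1 - \<theta>) + (1 + H / (1 - \<theta>) / (1 - \<alpha>)))"
  have "\<exists>h. depends_on (space \<mu>0) (\<lambda>i z. fst z i) {..2 * r} h \<and>
      (AE z in \<mu>0. \<bar>centered \<mu>0 \<phi> ((F ^^ r) z) - h z\<bar> \<le> K * \<rho> ^ r)" for r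
  proof -
    define sel where "sel z = (SOME x. x \<in> SFT A \<and> (\<forall>i\<in>{..2 * r}. x i = fst z i))" for z :: "(nat \<Rightarrow> 'n) \<times> 'k"
    \<comment> \<open>Any fixed fiber point serves as \<open>undefined\<close> here, since r
      contractions forget it.\<close>
    define h where "h z = centered \<mu>0 \<phi> ((F ^^ r) (sel z, undefined))" for z
    have sel: "sel z \<in> SFT A \<and> (\<forall>i\<in>{..2 * r}. sel z i = fst z i)" if "z \<in> SFT A \<times> UNIV" for z
      unfolding sel_def by (rule someI[of _ "fst z"]) (use that in \<open>auto simp: mem_Times_iff\<close>)
    have "depends_on (space \<mu>0) (\<lambda>i z. fst z i) {..2 * r} h"
    proof (rule depends_onI)
      fix z z' :: "(nat \<Rightarrow> 'n) \<times> 'k" assume *: "\<And>i. i \<in> {..2 * r} \<Longrightarrow> fst z i = fst z' i"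
      have "(\<lambda>x. x \<in> SFT A \<and> (\<forall>i\<in>{..2 * r}. x i = fst z i)) = (\<lambda>x. x \<in> SFT A \<and> (\<forall>i\<in>{..2 * r}. x i = fst z' i))"
        using * by (intro ext conj_cong ball_cong refl) auto
      then have "sel z = sel z'" unfolding sel_def by (rule arg_cong)
      then show "h z = h z'" by (simp add: h_def)
    qed
    moreover have "AE z in \<mu>0. \<bar>centered \<mu>0 \<phi> ((F ^^ r) z) - h z\<bar> \<le> K * \<rho> ^ r"
      using contr AE_space
    proof eventually_elim
      case (elim z)
      then have z: "z \<in> SFT A \<times> UNIV" by (simp add: space_\<mu>0)
      let ?z' = "(sel z, undefined :: 'k)"
      have z': "?z' \<in> SFT A \<times> UNIV" using sel[OF z] by simp
      have agree: "fst z i = fst ?z' i" if "i \<le> 2 * r" for i using sel[OF z] that by simp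
      have D: "dist (snd ((F ^^ r) z)) (snd ((F ^^ r) ?z')) \<le> \<alpha> ^ r + H * (\<theta> ^ r / (1 - \<theta>)) / (1 - \<alpha>)"
        using elim(1) by (intro orbit_distance[OF \<alpha> _ H H' z z' agree]) auto
      have E: "d_theta \<theta> (fst ((F ^^ r) z)) (fst ((F ^^ r) ?z')) \<le> \<theta> ^ r / (1 - \<theta>)"
        unfolding fst_skew_product_pow
        by (rule d_theta_agree[OF \<theta>]) (use agree in \<open>auto simp: left_shift_pow\<close>)
      have pw: "\<alpha> ^ r \<le> \<rho> ^ r" "\<theta> ^ r \<le> \<rho> ^ r" using \<alpha> \<theta> by (auto simp: \<rho>_def intro!: power_mono)
      have "\<bar>centered \<mu>0 \<phi> ((F ^^ r) z) - h z\<bar> = \<bar>\<phi> ((F ^^ r) z) - \<phi> ((F ^^ r) ?z')\<bar>"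
        by (simp add: h_def centered_def)
      also have "\<dots> \<le> L * (d_theta \<theta> (fst ((F ^^ r) z)) (fst ((F ^^ r) ?z')) + dist (snd ((F ^^ r) z)) (snd ((F ^^ r) ?z')))"
        by (rule L(2)[OF F_pow_space[OF z] F_pow_space[OF z']])
      also have "\<dots> \<le> L * (\<theta> ^ r / (1 - \<theta>) + (\<alpha> ^ r + H * (\<theta> ^ r / (1 - \<theta>)) / (1 - \<alpha>)))"
        using L(1) by (intro mult_left_mono add_mono D E) auto
      also have "\<dots> \<le> L * (\<rho> ^ r / (1 - \<theta>) + (\<rho> ^ r + H * (\<rho> ^ r / (1 - \<theta>)) / (1 - \<alpha>)))"
        using L(1) H \<alpha> \<theta> pw by (intro mult_left_mono add_mono divide_right_mono) auto
      also have "\<dots> = K * \<rho> ^ r" by (simp add: K_def algebra_simps)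
      finally show ?case .
    qed
    ultimately show ?thesis by blast
  qed
  moreover have "0 \<le> K" using L(1) H \<alpha> \<theta> by (simp add: K_def)
  moreover have "0 < \<rho>" "\<rho> < 1" using \<alpha> \<theta> by (auto simp: \<rho>_def)
  ultimately show ?thesis by blast
qed

text \<open>The kernel and the initial vector of \<open>m\<close> are also those of the base
  coordinates under \<mu>0, because the two measures agree on cylinders.\<close>

lemma markov_approximable_centered:
  "\<exists>P p B. markov_approximable \<mu>0 (\<lambda>i z. fst z i) P p F (centered \<mu>0 \<phi>) B"
proof -
  obtain P p where "finite_markov_chain m (\<lambda>i x. x i) P p" using m_chain by blast
  then interpret C: finite_markov_chain m "\<lambda>i x. x i" P p .
  obtain b where b: "\<And>z. z \<in> space \<mu>0 \<Longrightarrow> \<bar>\<phi> z\<bar> \<le> b" using \<phi>_bounded by blast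
  have int: "integrable \<mu>0 \<phi>" by (rule integrable_const_bound[of _ b]) (use b in auto)
  let ?c = "\<integral>w. \<phi> w \<partial>\<mu>0"
  have "markov_approximable \<mu>0 (\<lambda>i z. fst z i) P p F (centered \<mu>0 \<phi>) (b + \<bar>?c\<bar>)"
  proof unfold_locales
    show "prob {z \<in> space \<mu>0. \<forall>i\<le>n. fst z i = w i} = p (w 0) * (\<Prod>i<n. P (w i) (w (Suc i)))" for n w
      using C.cylinder by (simp add: marginal_cylinder)
    show "(\<integral>z. centered \<mu>0 \<phi> z \<partial>\<mu>0) = 0"
      using int by (simp add: centered_def prob_space)
    show "centered \<mu>0 \<phi> \<in> borel_measurable \<mu>0" unfolding centered_def by measurable
    show "\<bar>centered \<mu>0 \<phi> z\<bar> \<le> b + \<bar>?c\<bar>" if "z \<in> space \<mu>0" for z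
      using b[OF that] by (simp add: centered_def)
    show "\<exists>K \<rho>. 0 \<le> K \<and> 0 < \<rho> \<and> \<rho> < 1 \<and>
      (\<forall>r. \<exists>h. depends_on (space \<mu>0) (\<lambda>i z. fst z i) {..2 * r} h \<and>
      (AE z in \<mu>0. \<bar>centered \<mu>0 \<phi> ((F ^^ r) z) - h z\<bar> \<le> K * \<rho> ^ r))"
      by (rule block_approximable)
  qed (use C.P_nonneg C.P_sum C.p_nonneg C.p_sum C.stationary C.primitive F_distr in
      \<open>auto simp: fst_skew_product left_shift_def\<close>)
  then show ?thesis by blast
qed

theorem central_limit_theorem:
  "limit_variance_finite \<mu>0 F \<phi> \<and>
    (limit_variance \<mu>0 F \<phi> = 0 \<longleftrightarrow> L2_coboundary \<mu>0 F (centered \<mu>0 \<phi>)) \<and>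
    (limit_variance \<mu>0 F \<phi> > 0 \<longrightarrow>
       (\<forall>I :: real set. is_interval I \<longrightarrow>
         (\<lambda>n. measure \<mu>0 {z \<in> space \<mu>0.
                (1 / sqrt (real n)) * (\<Sum>j<n. \<phi> ((F ^^ j) z) - (\<integral>w. \<phi> w \<partial>\<mu>0)) \<in> I})
         \<longlonglongrightarrow>
         1 / (sqrt (limit_variance \<mu>0 F \<phi>) * sqrt (2 * pi)) *
           (LINT t:I|lborel. exp (- t\<^sup>2 / (2 * limit_variance \<mu>0 F \<phi>)))))"
proof -
  obtain P p B where "markov_approximable \<mu>0 (\<lambda>i z. fst z i) P p F (centered \<mu>0 \<phi>) B"
    using markov_approximable_centered by blast
  then interpret S: markov_approximable \<mu>0 "\<lambda>i z. fst z i" P p F "centered \<mu>0 \<phi>" B .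
  have var: "limit_variance \<mu>0 F \<phi> = S.variance_limit"
    by (simp add: limit_variance_def S.variance_limit_def S.cov_def power2_eq_square)
  have sum: "(1 / sqrt (real n)) * (\<Sum>j<n. \<phi> ((F ^^ j) z) - (\<integral>w. \<phi> w \<partial>\<mu>0)) = S.birkhoff n z / sqrt (real n)" for n z
    by (simp add: S.birkhoff_def centered_def)
  obtain b where b: "\<And>z. z \<in> space \<mu>0 \<Longrightarrow> \<bar>\<phi> z\<bar> \<le> b" using \<phi>_bounded by blast
  have "integrable \<mu>0 \<phi>" by (rule integrable_const_bound[of _ b]) (use b in auto)
  then have "limit_variance_finite \<mu>0 F \<phi>"
    unfolding limit_variance_finite_def
  proof (intro conjI allI)
    show "integrable \<mu>0 (\<lambda>z. (centered \<mu>0 \<phi> z)\<^sup>2)"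
      using S.integrable_\<phi>_product[of 0 0] by (simp add: power2_eq_square)
    show "integrable \<mu>0 (\<lambda>z. centered \<mu>0 \<phi> z * centered \<mu>0 \<phi> ((F ^^ Suc j) z))" for j
      using S.integrable_\<phi>_product[of 0 "Suc j"] by simp
    show "summable (\<lambda>j. \<integral>z. centered \<mu>0 \<phi> z * centered \<mu>0 \<phi> ((F ^^ Suc j) z) \<partial>\<mu>0)"
      using S.cov_summable by (simp only: S.cov_def)
  qed
  then show ?thesis
    unfolding var sum
    using S.variance_limit_zero_imp_coboundary S.coboundary_imp_variance_limit_zero S.birkhoff_clt by blast
qed

end

theorem theorem4:
  fixes A :: "nat^'n^'n"
    and \<theta> :: real
    and m :: "(nat \<Rightarrow> 'n) measure"
    and G :: "(nat \<Rightarrow> 'n) \<times> 'k::metric_space \<Rightarrow> 'k"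
    and \<mu>0 :: "((nat \<Rightarrow> 'n) \<times> 'k) measure"
    and \<phi> :: "(nat \<Rightarrow> 'n) \<times> 'k \<Rightarrow> real"
  assumes "\<And>i j. A $ i $ j \<in> {0, 1}" and "aperiodic A"
    and "0 < \<theta>" and "\<theta> < 1"
    and "Markov_measure \<theta> A m" and "invariant_measure left_shift m"
    and "compact (UNIV :: 'k set)" and "diameter (UNIV :: 'k set) = 1"
    and "G \<in> measurable (borel_metric (skew_metric \<theta> A)) borel"
    and "G1 m G" and "G2 \<theta> A G"
    and "prob_space \<mu>0" and "sets \<mu>0 = sets (borel_metric (skew_metric \<theta> A))"
    and "invariant_measure (skew_product G) \<mu>0"
    and "measure \<mu>0 \<in> S_inf \<theta> A m"
    and "Lipschitz_continuous_map (skew_metric \<theta> A) euclidean_metric \<phi>"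
  shows "limit_variance_finite \<mu>0 (skew_product G) \<phi> \<and>
    (limit_variance \<mu>0 (skew_product G) \<phi> = 0 \<longleftrightarrow>
       L2_coboundary \<mu>0 (skew_product G) (centered \<mu>0 \<phi>)) \<and>
    (limit_variance \<mu>0 (skew_product G) \<phi> > 0 \<longrightarrow>
       (\<forall>I :: real set. is_interval I \<longrightarrow>
         (\<lambda>n. measure \<mu>0 {z \<in> space \<mu>0.
                (1 / sqrt (real n)) *
                  (\<Sum>j<n. \<phi> ((skew_product G ^^ j) z) - (\<integral>w. \<phi> w \<partial>\<mu>0)) \<in> I})
         \<longlonglongrightarrow>
         1 / (sqrt (limit_variance \<mu>0 (skew_product G) \<phi>) * sqrt (2 * pi)) *
           (LINT t:I|lborel. exp (- t\<^sup>2 / (2 * limit_variance \<mu>0 (skew_product G) \<phi>)))))"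
proof -
  have "bounded (UNIV :: 'k set)" by (rule compact_imp_bounded) fact
  from diameter_bounded_bound[OF this] have "dist y1 y2 \<le> 1" for y1 y2 :: 'k
    using \<open>diameter (UNIV :: 'k set) = 1\<close> by simp
  then have "skew_system A \<theta> m G \<mu>0 \<phi>"
    using assms by (intro skew_system.intro)
  then show ?thesis by (rule skew_system.central_limit_theorem)
qed

end
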